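(* Let $\Gamma$ be a closed embedded curve included in the plane $R=\{(x,y,0): x,y\in\mathbb{R}\}$ of $\mathrm{Sol}$, and let $D\subset R$ be the bounded domain determined by $\Gamma$ in $R$. If $M$ is a compact surface spanning $\Gamma$ and with constant mean curvature $H$, then $$|H|\leq \frac{\int_{\partial M}\sqrt{1+x^2+y^2}\,ds}{2\,A(D)},$$ where $A(D)$ is the area of $D$ and $ds$ is the arc-length element. In particular, if $\Gamma$ is a circle of curvature $c$ in $R$, then $|H|\leq\sqrt{c^2+1}$.
   Context: $\mathrm{Sol}$ is $\mathbb{R}^3$ with canonical coordinates $(x,y,z)$ and the Riemannian metric $\langle\cdot,\cdot\rangle=e^{2z}dx^2+e^{-2z}dy^2+dz^2$. The induced metric on $R$ is the Euclidean metric $dx^2+dy^2$, and a circle of curvature $c$ in $R$ is a Euclidean circle of radius $1/c$. A compact surface $M$ with non-empty boundary spans $\Gamma$ (has boundary $\Gamma$) if there is an isometric immersion of $M$ into $\mathrm{Sol}$ whose restriction to $\partial M$ is a diffeomorphism onto $\Gamma$. The mean curvature $H$ is half the trace of the second fundamental form with respect to a unit normal field. Length and area are those induced by the metric of $\mathrm{Sol}$. *)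

theory Defs
  imports "HOL-Analysis.Analysis"
begin

section \<open>Smooth maps\<close>

text \<open>On an open set, \<open>f\<close> is of class \<open>C\<^sup>k\<close> if all iterated directional derivatives of order
  at most \<open>k\<close> exist and are continuous (all spaces below are finite-dimensional). On an arbitrary
  set, smoothness means the existence of local smooth extensions, as is usual for maps on
  a half-plane or on an embedded submanifold.\<close>

primrec Ck_on :: "nat \<Rightarrow> 'a::real_normed_vector set \<Rightarrow> ('a \<Rightarrow> 'b::real_normed_vector) \<Rightarrow> bool" where
  "Ck_on 0 S f \<longleftrightarrow> continuous_on S f"
| "Ck_on (Suc k) S f \<longleftrightarrow>
     (\<forall>x\<in>S. f differentiable (at x)) \<and> (\<forall>v. Ck_on k S (\<lambda>x. frechet_derivative f (at x) v))"

definition smooth_on :: "'a::real_normed_vector set \<Rightarrow> ('a \<Rightarrow> 'b::real_normed_vector) \<Rightarrow> bool" where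
  "smooth_on S f \<longleftrightarrow>
     (\<forall>x\<in>S. \<exists>V g. open V \<and> x \<in> V \<and> (\<forall>k. Ck_on k V g) \<and> (\<forall>y\<in>S \<inter> V. g y = f y))"

definition partial_within ::
    "(real^'n) set \<Rightarrow> (real^'n \<Rightarrow> 'b::real_normed_vector) \<Rightarrow> 'n \<Rightarrow> real^'n \<Rightarrow> 'b" where
  "partial_within S f i x = frechet_derivative f (at x within S) (axis i 1)"


section \<open>The Riemannian manifold Sol\<close>

text \<open>The points of Sol are the triples \<open>p = (x, y, z)\<close> with \<open>x = p $ 1\<close>, \<open>y = p $ 2\<close>, \<open>z = p $ 3\<close>;
  tangent vectors are given by their components in the coordinate frame.\<close>

definition sol_metric :: "real^3 \<Rightarrow> real^3^3" where
  "sol_metric p = vector [vector [exp (2 * p $ 3), 0, 0],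
                          vector [0, exp (- 2 * p $ 3), 0],
                          vector [0, 0, 1]]"

definition sol_inner :: "real^3 \<Rightarrow> real^3 \<Rightarrow> real^3 \<Rightarrow> real" where
  "sol_inner p u v = u \<bullet> (sol_metric p *v v)"

definition sol_norm :: "real^3 \<Rightarrow> real^3 \<Rightarrow> real" where
  "sol_norm p v = sqrt (sol_inner p v v)"

text \<open>\<open>christoffel p k i j\<close> is the symbol \<open>\<Gamma>\<^sup>k\<^sub>i\<^sub>j\<close> of the Levi-Civita connection of Sol.\<close>

definition christoffel :: "real^3 \<Rightarrow> 3 \<Rightarrow> 3 \<Rightarrow> 3 \<Rightarrow> real" where
  "christoffel p k i j = 1 / 2 * (\<Sum>l\<in>UNIV. matrix_inv (sol_metric p) $ k $ l *
     (partial_within UNIV (\<lambda>q. sol_metric q $ j $ l) i p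
      + partial_within UNIV (\<lambda>q. sol_metric q $ i $ l) j p
      - partial_within UNIV (\<lambda>q. sol_metric q $ i $ j) l p))"


section \<open>Geometry of a parametrised surface in Sol\<close>

text \<open>Throughout, \<open>f\<close> is a map from a relatively open subset \<open>S\<close> of the closed half-plane
  to Sol. Derivatives are taken within \<open>S\<close>, so they are also meaningful at boundary points.\<close>

definition first_form :: "(real^2) set \<Rightarrow> (real^2 \<Rightarrow> real^3) \<Rightarrow> real^2 \<Rightarrow> real^2^2" where
  "first_form S f x =
     (\<chi> i j. sol_inner (f x) (partial_within S f i x) (partial_within S f j x))"

text \<open>The covariant derivative, along the \<open>i\<close>-th coordinate direction, of the tangent field
  \<open>\<partial>\<^sub>j f\<close>, with respect to the Levi-Civita connection of Sol.\<close>

definition sol_covariant ::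
    "(real^2) set \<Rightarrow> (real^2 \<Rightarrow> real^3) \<Rightarrow> 2 \<Rightarrow> 2 \<Rightarrow> real^2 \<Rightarrow> real^3" where
  "sol_covariant S f i j x =
     partial_within S (partial_within S f j) i x
     + (\<chi> k. \<Sum>a\<in>UNIV. \<Sum>b\<in>UNIV. christoffel (f x) k a b *
             partial_within S f i x $ a * partial_within S f j x $ b)"

definition second_form ::
    "(real^2) set \<Rightarrow> (real^2 \<Rightarrow> real^3) \<Rightarrow> (real^2 \<Rightarrow> real^3) \<Rightarrow> real^2 \<Rightarrow> real^2^2" where
  "second_form S f n x = (\<chi> i j. sol_inner (f x) (sol_covariant S f i j x) (n x))"

text \<open>Half the trace of the second fundamental form with respect to the induced metric.\<close>

definition mean_curvature ::
    "(real^2) set \<Rightarrow> (real^2 \<Rightarrow> real^3) \<Rightarrow> (real^2 \<Rightarrow> real^3) \<Rightarrow> real^2 \<Rightarrow> real" where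
  "mean_curvature S f n x =
     trace (matrix_inv (first_form S f x) ** second_form S f n x) / 2"


section \<open>Compact surfaces with boundary\<close>

definition half_plane :: "(real^2) set" where
  "half_plane = {u. u $ 2 \<ge> 0}"

type_synonym 'm atlas = "('m set \<times> ('m \<Rightarrow> real^2)) set"

definition smooth_atlas :: "'m topology \<Rightarrow> 'm atlas \<Rightarrow> bool" where
  "smooth_atlas M A \<longleftrightarrow>
     \<Union> (fst ` A) = topspace M \<and>
     (\<forall>(U, \<psi>)\<in>A. openin M U \<and> openin (top_of_set half_plane) (\<psi> ` U) \<and>
        homeomorphic_map (subtopology M U) (top_of_set (\<psi> ` U)) \<psi>) \<and>
     (\<forall>(U, \<psi>)\<in>A. \<forall>(U', \<psi>')\<in>A. smooth_on (\<psi> ` (U \<inter> U')) (\<psi>' \<circ> inv_into U \<psi>))"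

definition surface_boundary :: "'m atlas \<Rightarrow> 'm set" where
  "surface_boundary A = {p. \<exists>(U, \<psi>)\<in>A. p \<in> U \<and> \<psi> p $ 2 = 0}"

definition compact_surface_with_boundary :: "'m topology \<Rightarrow> 'm atlas \<Rightarrow> bool" where
  "compact_surface_with_boundary M A \<longleftrightarrow>
     compact_space M \<and> Hausdorff_space M \<and> second_countable M \<and>
     smooth_atlas M A \<and> surface_boundary A \<noteq> {}"

definition smooth_on_surface :: "'m atlas \<Rightarrow> ('m \<Rightarrow> real^3) \<Rightarrow> bool" where
  "smooth_on_surface A f \<longleftrightarrow> (\<forall>(U, \<psi>)\<in>A. smooth_on (\<psi> ` U) (f \<circ> inv_into U \<psi>))"

definition smooth_into_surface ::
    "'m topology \<Rightarrow> 'm atlas \<Rightarrow> (real^3) set \<Rightarrow> (real^3 \<Rightarrow> 'm) \<Rightarrow> bool" where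
  "smooth_into_surface M A C h \<longleftrightarrow>
     continuous_map (top_of_set C) M h \<and>
     (\<forall>(U, \<psi>)\<in>A. smooth_on {q \<in> C. h q \<in> U} (\<psi> \<circ> h))"


section \<open>Immersed surfaces of constant mean curvature spanning a curve\<close>

text \<open>The surface carries the metric induced by the immersion, so an immersion into Sol is
  automatically isometric.\<close>

definition immersion :: "'m atlas \<Rightarrow> ('m \<Rightarrow> real^3) \<Rightarrow> bool" where
  "immersion A \<phi> \<longleftrightarrow> smooth_on_surface A \<phi> \<and>
     (\<forall>(U, \<psi>)\<in>A. \<forall>x\<in>\<psi> ` U.
        inj (frechet_derivative (\<phi> \<circ> inv_into U \<psi>) (at x within \<psi> ` U)))"

text \<open>The restriction of \<open>\<phi>\<close> to the boundary is a diffeomorphism onto \<open>\<Gamma>\<close>: it is smooth since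
  \<open>\<phi>\<close> is, it is bijective, and its inverse is smooth.\<close>

definition spans :: "'m topology \<Rightarrow> 'm atlas \<Rightarrow> ('m \<Rightarrow> real^3) \<Rightarrow> (real^3) set \<Rightarrow> bool" where
  "spans M A \<phi> \<Gamma> \<longleftrightarrow> immersion A \<phi> \<and>
     bij_betw \<phi> (surface_boundary A) \<Gamma> \<and>
     smooth_into_surface M A \<Gamma> (inv_into (surface_boundary A) \<phi>)"

definition unit_normal_field :: "'m atlas \<Rightarrow> ('m \<Rightarrow> real^3) \<Rightarrow> ('m \<Rightarrow> real^3) \<Rightarrow> bool" where
  "unit_normal_field A \<phi> N \<longleftrightarrow> smooth_on_surface A N \<and>
     (\<forall>(U, \<psi>)\<in>A. \<forall>p\<in>U. sol_norm (\<phi> p) (N p) = 1 \<and>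
        (\<forall>v. sol_inner (\<phi> p)
               (frechet_derivative (\<phi> \<circ> inv_into U \<psi>) (at (\<psi> p) within \<psi> ` U) v) (N p) = 0))"

definition constant_mean_curvature ::
    "'m atlas \<Rightarrow> ('m \<Rightarrow> real^3) \<Rightarrow> ('m \<Rightarrow> real^3) \<Rightarrow> real \<Rightarrow> bool" where
  "constant_mean_curvature A \<phi> N H \<longleftrightarrow>
     (\<forall>(U, \<psi>)\<in>A. \<forall>x\<in>\<psi> ` U.
        mean_curvature (\<psi> ` U) (\<phi> \<circ> inv_into U \<psi>) (N \<circ> inv_into U \<psi>) x = H)"


section \<open>Curves in the plane R, arc length and area\<close>

definition plane_point :: "real^2 \<Rightarrow> real^3" where
  "plane_point u = vector [u $ 1, u $ 2, 0]"

definition plane_R :: "(real^3) set" where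
  "plane_R = range plane_point"

text \<open>\<open>\<gamma>\<close> is a regular 1-periodic parametrisation of the closed embedded curve \<open>\<Gamma>\<close>.\<close>

definition parametrises_closed_curve :: "(real \<Rightarrow> real^3) \<Rightarrow> (real^3) set \<Rightarrow> bool" where
  "parametrises_closed_curve \<gamma> \<Gamma> \<longleftrightarrow>
     smooth_on UNIV \<gamma> \<and> (\<forall>t. \<gamma> (t + 1) = \<gamma> t) \<and> inj_on \<gamma> {0..<1} \<and>
     (\<forall>t. vector_derivative \<gamma> (at t) \<noteq> 0) \<and> range \<gamma> = \<Gamma>"

text \<open>The integral of \<open>h\<close> over the boundary of the surface with respect to arc length. The boundary
  is parametrised by \<open>\<beta>\<close>, the pullback of \<open>\<gamma>\<close> under \<open>\<phi>\<close>; its speed in the induced metric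
  is the Sol-length of the velocity of \<open>\<phi> \<circ> \<beta>\<close>.\<close>

definition boundary_integral ::
    "'m atlas \<Rightarrow> ('m \<Rightarrow> real^3) \<Rightarrow> (real \<Rightarrow> real^3) \<Rightarrow> ('m \<Rightarrow> real) \<Rightarrow> real" where
  "boundary_integral A \<phi> \<gamma> h =
     (let \<beta> = inv_into (surface_boundary A) \<phi> \<circ> \<gamma> in
      integral {0..1}
        (\<lambda>t. h (\<beta> t) * sol_norm (\<phi> (\<beta> t)) (vector_derivative (\<phi> \<circ> \<beta>) (at t))))"

text \<open>The area element induced by Sol is the square root of the Gram determinant; on the plane
  \<open>z = 0\<close> the induced metric is Euclidean.\<close>

definition plane_area :: "(real^3) set \<Rightarrow> real" where
  "plane_area D =
     integral {u. plane_point u \<in> D} (\<lambda>u. sqrt (det (first_form UNIV plane_point u)))"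

definition bounded_domain_of :: "(real^3) set \<Rightarrow> (real^3) set \<Rightarrow> bool" where
  "bounded_domain_of \<Gamma> D \<longleftrightarrow> D \<in> components (plane_R - \<Gamma>) \<and> bounded D"

definition circle_in_R :: "real^2 \<Rightarrow> real \<Rightarrow> (real^3) set" where
  "circle_in_R q c = plane_point ` sphere q (1 / c)"

end

theory Submission
  imports Defs "HOL-Complex_Analysis.Winding_Numbers"
begin

text \<open>For a point \<open>q\<close> of \<open>\<real>\<^sup>2\<close> let \<open>X\<close> be the field
  \<open>(- (x - q\<^sub>1), y - q\<^sub>2, 1)\<close> (\<open>killing q\<close>). It generates the isometries
  \<open>(x, y, z) \<mapsto> (q\<^sub>1 + e\<^sup>-\<^sup>s (x - q\<^sub>1), q\<^sub>2 + e\<^sup>s (y - q\<^sub>2), z + s)\<close>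
  of Sol, so it is a Killing field, and along \<open>R\<close> its normal component is \<open>1\<close> and its
  length is \<open>sqrt (1 + |p - q|\<^sup>2)\<close>. The volume form of Sol is
  \<open>dx \<and> dy \<and> dz\<close>, so mixed products in coordinates are Euclidean determinants.

  Let \<open>N\<close> be the unit normal of a surface of constant mean curvature \<open>H\<close>. The one-form
  \<open>v \<mapsto> det (v, N, X)\<close> measures the component of \<open>X\<close> along the conormal of the
  boundary. In its exterior derivative the covariant derivative of \<open>X\<close> contributes nothing, because it
  is skew, and that of \<open>N\<close> contributes the trace of the shape operator: the result is
  \<open>2 H\<close> times the flux two-form \<open>det (X, \<cdot>, \<cdot>)\<close>. Since \<open>X\<close> is
  divergence-free, the flux form has a primitive \<open>\<omega>\<close> on all of Sol
  (\<open>flux_potential\<close>). Hence \<open>det (\<cdot>, N, X) - 2 H \<omega>\<close> is a closed one-form on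
  the surface (\<open>flux_form_closed\<close>).

  By Stokes' theorem its integral over the boundary vanishes (\<open>closed_form_boundary_integral\<close>). The
  normal \<open>N\<close> orients the surface, and the whole boundary is traversed in the same sense because it is
  a single closed curve. On \<open>R\<close> the form \<open>\<omega>\<close> is
  \<open>((x - q\<^sub>1) dy - (y - q\<^sub>2) dx) / 2\<close>, so
  \<open>2 |H| |\<integral>\<^sub>\<Gamma> \<omega>| \<le> \<integral>\<^sub>\<Gamma> |X| ds\<close>
  (\<open>flux_inequality\<close>).

  For \<open>q = 0\<close> it remains to see that \<open>|\<integral>\<^sub>\<Gamma> \<omega>| \<ge> A(D)\<close>
  (\<open>bounded_domain_area\<close>). This is Green's theorem for a Jordan curve. It follows by integrating the
  winding number over the plane: the winding number is \<open>\<plusminus>1\<close> inside the curve and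
  \<open>0\<close> outside, and Fubini's theorem turns the integral of its defining kernel into a line integral.
  For a circle of centre \<open>q\<close> and radius \<open>r\<close> the velocity is tangential, so
  \<open>|\<integral>\<^sub>\<Gamma> \<omega>|\<close> is \<open>r / 2\<close> times the length, and the bound
  \<open>sqrt (c\<^sup>2 + 1)\<close> with \<open>c = 1 / r\<close> comes out directly
  (\<open>circle_bound\<close>).\<close>

section \<open>Derivatives on relatively open subsets of the half-plane\<close>

abbreviation half_plane_open :: "(real^2) set \<Rightarrow> bool" where
  "half_plane_open S \<equiv> openin (top_of_set half_plane) S"

text \<open>Boundary points of the half-plane can still be approached along both coordinate axes. This makes derivatives within
  a relatively open set unique.\<close>

lemma half_plane_set_approach:
  assumes S: "half_plane_open S" and x: "x \<in> S" and i: "i \<in> Basis" and e: "(e::real) > 0"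
  shows "\<exists>d. 0 < \<bar>d\<bar> \<and> \<bar>d\<bar> < e \<and> x + d *\<^sub>R i \<in> S"
proof -
  obtain r where r: "r > 0" "ball x r \<inter> half_plane \<subseteq> S"
    using S x by (auto simp: openin_contains_ball)
  define d where "d = min e r / 2"
  have d: "0 < d" "d < e" "d < r" using e r by (auto simp: d_def)
  have hp: "x \<in> half_plane" using S x openin_imp_subset by blast
  obtain k where k: "i = axis k 1" using i by (auto simp: Basis_vec_def)
  have "x + d *\<^sub>R i \<in> half_plane" using hp d k by (auto simp: half_plane_def axis_def)
  moreover have "x + d *\<^sub>R i \<in> ball x r" using d i by (auto simp: dist_norm)
  ultimately show ?thesis using d r(2) by (intro exI[of _ d]) auto
qed

lemma half_plane_derivative_unique:
  assumes "half_plane_open S" "x \<in> S"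
    and "(f has_derivative f') (at x within S)" "(f has_derivative f'') (at x within S)"
  shows "f' = f''"
  by (rule frechet_derivative_unique_within[OF assms(3,4)])
     (use half_plane_set_approach[OF assms(1,2)] in blast)

lemma half_plane_frechet_eq:
  assumes "half_plane_open S" "x \<in> S" "(f has_derivative f') (at x within S)"
  shows "frechet_derivative f (at x within S) = f'"
proof -
  have "(f has_derivative frechet_derivative f (at x within S)) (at x within S)"
    using assms(3) differentiableI frechet_derivative_works by blast
  from half_plane_derivative_unique[OF assms(1,2) this assms(3)] show ?thesis .
qed

lemma half_plane_at_within_openin:
  assumes "half_plane_open S" "half_plane_open T" "x \<in> S" "T \<subseteq> S" "x \<in> T"
  shows "at x within T = at x within S"
proof -
  obtain V where V: "open V" "T = half_plane \<inter> V" using assms(2) by (auto simp: openin_open)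
  have "S \<subseteq> half_plane" using assms(1) openin_imp_subset by blast
  then have "T \<inter> V = S \<inter> V" using V assms(4) by blast
  moreover have "x \<in> V" using V(2) assms(5) by blast
  ultimately show ?thesis using at_within_nhd[of x V T S] V(1) by blast
qed

text \<open>The partition functions below are only once continuously differentiable, so smoothness is too strong a notion for
  them.\<close>

definition C1_within :: "'a::real_normed_vector set \<Rightarrow> ('a \<Rightarrow> 'b::real_normed_vector) \<Rightarrow> bool" where
  "C1_within S f \<longleftrightarrow> (\<forall>x\<in>S. f differentiable (at x within S)) \<and>
     (\<forall>v. continuous_on S (\<lambda>x. frechet_derivative f (at x within S) v))"

lemma C1_within_differentiable: "C1_within S f \<Longrightarrow> x \<in> S \<Longrightarrow> f differentiable (at x within S)"
  by (simp add: C1_within_def)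

lemma C1_within_continuous: "C1_within S f \<Longrightarrow> continuous_on S f"
  unfolding continuous_on_eq_continuous_within
  by (intro ballI differentiable_imp_continuous_within C1_within_differentiable)

text \<open>The derivative of a local extension is also a derivative within \<open>S\<close>, at every nearby point of
  \<open>S\<close>; by uniqueness it does not depend on the extension.\<close>

lemma smooth_on_local_extension:
  assumes sm: "smooth_on S f" and x: "x \<in> S"
  obtains V g where "open V" "x \<in> V" "\<And>k. Ck_on k V g" "\<And>y. y \<in> S \<inter> V \<Longrightarrow> g y = f y"
     "\<And>y. y \<in> S \<inter> V \<Longrightarrow> (f has_derivative frechet_derivative g (at y)) (at y within S)"
proof -
  obtain V g where V: "open V" "x \<in> V" "\<And>k. Ck_on k V g" "\<And>y. y \<in> S \<inter> V \<Longrightarrow> g y = f y"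
    using bspec[OF sm[unfolded smooth_on_def] x] by auto
  have "(f has_derivative frechet_derivative g (at y)) (at y within S)" if y: "y \<in> S \<inter> V" for y
  proof -
    have "Ck_on (Suc 0) V g" using V by blast
    then have "g differentiable (at y)" using y by simp
    then have "(g has_derivative frechet_derivative g (at y)) (at y within S)"
      using frechet_derivative_works has_derivative_at_withinI by blast
    then have "(g has_derivative frechet_derivative g (at y)) (at y within S \<inter> V)"
      by (rule has_derivative_subset) simp
    then have "(f has_derivative frechet_derivative g (at y)) (at y within S \<inter> V)"
      by (rule has_derivative_transform[rotated 2]) (use V(4) y in auto)
    moreover have "at y within S \<inter> V = at y within S"
      using at_within_nhd[of y V "S \<inter> V" S] V(1) y by blast
    ultimately show ?thesis by simp
  qed
  from that[OF V(1,2,3,4) this] show ?thesis by simp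
qed

lemma smooth_on_differentiable:
  assumes "smooth_on S f" "x \<in> S" shows "f differentiable (at x within S)"
  by (rule smooth_on_local_extension[OF assms]) (use assms(2) differentiableI in blast)

lemma smooth_on_continuous:
  assumes "smooth_on S f" shows "continuous_on S f"
  unfolding continuous_on_eq_continuous_within
  by (intro ballI differentiable_imp_continuous_within smooth_on_differentiable[OF assms])

lemma smooth_on_derivative:
  assumes S: "half_plane_open S" and sm: "smooth_on S f"
  shows "smooth_on S (\<lambda>x. frechet_derivative f (at x within S) v)"
  unfolding smooth_on_def
proof
  fix x assume x: "x \<in> S"
  obtain V g where V: "open V" "x \<in> V" "\<And>k. Ck_on k V g"
     and d: "\<And>y. y \<in> S \<inter> V \<Longrightarrow> (f has_derivative frechet_derivative g (at y)) (at y within S)"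
    by (rule smooth_on_local_extension[OF sm x]) blast
  have "Ck_on k V (\<lambda>x. frechet_derivative g (at x) v)" for k
    using V(3)[of "Suc k"] by simp
  moreover have "frechet_derivative g (at y) v = frechet_derivative f (at y within S) v" if "y \<in> S \<inter> V" for y
    using half_plane_frechet_eq[OF S _ d[OF that]] that by simp
  ultimately show "\<exists>V g. open V \<and> x \<in> V \<and> (\<forall>k. Ck_on k V g) \<and>
      (\<forall>y\<in>S \<inter> V. g y = frechet_derivative f (at y within S) v)"
    using V(1,2) by (intro exI[of _ V] exI[of _ "\<lambda>x. frechet_derivative g (at x) v"]) auto
qed

lemma smooth_on_C1_within:
  assumes "half_plane_open S" "smooth_on S f"
  shows "C1_within S f"
  using smooth_on_differentiable[OF assms(2)] smooth_on_continuous[OF smooth_on_derivative[OF assms]]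
  by (simp add: C1_within_def)

lemma smooth_on_partial_within:
  assumes "half_plane_open S" "smooth_on S f"
  shows "smooth_on S (partial_within S f i)"
  using smooth_on_derivative[OF assms] by (simp add: partial_within_def[abs_def])

lemma open_upper_half_plane: "open {u::real^2. u $ 2 > 0}"
  using open_halfspace_component_gt_cart[of 0 "2::2"] by (simp add: Collect_mono)

lemma half_plane_interior_nhd:
  assumes S: "half_plane_open S" and x: "x \<in> S" "x $ 2 > 0"
  shows "x \<in> interior S"
proof -
  obtain V where V: "open V" "S = half_plane \<inter> V" using S by (auto simp: openin_open)
  have "V \<inter> {u. u $ 2 > 0} \<subseteq> S" using V by (auto simp: half_plane_def)
  then show ?thesis using V x open_upper_half_plane by (intro interiorI[of "V \<inter> {u. u $ 2 > 0}"]) auto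
qed

lemma half_plane_at_within_interior:
  assumes "half_plane_open S" "x \<in> S" "x $ 2 > 0"
  shows "at x within S = at x"
  using half_plane_interior_nhd[OF assms] at_within_interior by blast

lemma frechet_derivative_expand2:
  fixes f :: "real^2 \<Rightarrow> 'b::real_normed_vector"
  assumes "f differentiable (at x within S)"
  shows "frechet_derivative f (at x within S) v
    = v $ 1 *\<^sub>R partial_within S f 1 x + v $ 2 *\<^sub>R partial_within S f 2 x"
proof -
  have l: "linear (frechet_derivative f (at x within S))"
    using assms linear_frechet_derivative by blast
  have "v = v $ 1 *\<^sub>R axis 1 1 + v $ 2 *\<^sub>R axis 2 1"
    by (simp add: vec_eq_iff forall_2 axis_def)
  then have "frechet_derivative f (at x within S) v =
    frechet_derivative f (at x within S) (v $ 1 *\<^sub>R axis 1 1 + v $ 2 *\<^sub>R axis 2 1)" by simp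
  also have "\<dots> = v $ 1 *\<^sub>R partial_within S f 1 x + v $ 2 *\<^sub>R partial_within S f 2 x"
    by (simp add: linear_add[OF l] linear_cmul[OF l] partial_within_def)
  finally show ?thesis .
qed

section \<open>Symmetry of second derivatives\<close>

text \<open>The second difference over a small square equals, by two applications of the mean value theorem, a mixed second
  derivative at some point of the square. Exchanging the two directions does not change the difference, which gives
  Schwarz's theorem.\<close>

lemma mixed_difference_mean_value:
  fixes g :: "real^2 \<Rightarrow> real"
  assumes h: "h > 0"
    and dom: "\<And>s t. 0 \<le> s \<Longrightarrow> s \<le> h \<Longrightarrow> 0 \<le> t \<Longrightarrow> t \<le> h \<Longrightarrow> x + s *\<^sub>R axis i 1 + t *\<^sub>R axis j 1 \<in> W"
    and g: "\<And>y. y \<in> W \<Longrightarrow> g differentiable (at y)"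
    and gi: "\<And>y. y \<in> W \<Longrightarrow> (\<lambda>y. frechet_derivative g (at y) (axis i 1)) differentiable (at y)"
  shows "\<exists>s t. 0 \<le> s \<and> s \<le> h \<and> 0 \<le> t \<and> t \<le> h \<and>
     g (x + h *\<^sub>R axis i 1 + h *\<^sub>R axis j 1) - g (x + h *\<^sub>R axis i 1) - g (x + h *\<^sub>R axis j 1) + g x
      = h * h * frechet_derivative (\<lambda>y. frechet_derivative g (at y) (axis i 1))
                 (at (x + s *\<^sub>R axis i 1 + t *\<^sub>R axis j 1)) (axis j 1)"
proof -
  let ?i = "axis i (1::real)" and ?j = "axis j (1::real)"
  let ?gi = "\<lambda>y. frechet_derivative g (at y) ?i"
  have line: "((\<lambda>s. f (p + s *\<^sub>R v)) has_field_derivative frechet_derivative f (at (p + s *\<^sub>R v)) v) (at s)"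
    if "f differentiable (at (p + s *\<^sub>R v))" for f :: "real^2 \<Rightarrow> real" and p v s
  proof -
    have 1: "(f has_derivative frechet_derivative f (at (p + s *\<^sub>R v))) (at (p + s *\<^sub>R v))"
      using that frechet_derivative_works by blast
    have 2: "((\<lambda>s. p + s *\<^sub>R v) has_derivative (\<lambda>d. d *\<^sub>R v)) (at s)"
      by (auto intro!: derivative_eq_intros)
    have "((\<lambda>s. f (p + s *\<^sub>R v)) has_derivative (\<lambda>d. frechet_derivative f (at (p + s *\<^sub>R v)) (d *\<^sub>R v))) (at s)"
      using has_derivative_compose[OF 2 1] by simp
    moreover have "frechet_derivative f (at (p + s *\<^sub>R v)) (d *\<^sub>R v) = frechet_derivative f (at (p + s *\<^sub>R v)) v * d" for d
      using linear_cmul[OF linear_frechet_derivative[OF that]] by simp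
    ultimately show ?thesis by (simp add: has_field_derivative_def)
  qed
  define F where "F s = g ((x + h *\<^sub>R ?j) + s *\<^sub>R ?i) - g (x + s *\<^sub>R ?i)" for s
  have "\<exists>s. s > 0 \<and> s < h \<and> F h - F 0 = (h - 0) * (?gi ((x + h *\<^sub>R ?j) + s *\<^sub>R ?i) - ?gi (x + s *\<^sub>R ?i))"
    unfolding F_def
  proof (rule MVT2)
    fix s :: real assume s: "0 \<le> s" "s \<le> h"
    have "x + h *\<^sub>R ?j + s *\<^sub>R ?i \<in> W" using dom[of s h] s h by (simp add: algebra_simps)
    moreover have "x + s *\<^sub>R ?i \<in> W" using dom[of s 0] s h by (simp add: algebra_simps)
    ultimately show "((\<lambda>s. g (x + h *\<^sub>R ?j + s *\<^sub>R ?i) - g (x + s *\<^sub>R ?i)) has_field_derivative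
       ?gi (x + h *\<^sub>R ?j + s *\<^sub>R ?i) - ?gi (x + s *\<^sub>R ?i)) (at s)"
      by (intro DERIV_diff line g)
  qed (use h in auto)
  then obtain s where s: "s > 0" "s < h"
    and Fs: "F h - F 0 = h * (?gi ((x + h *\<^sub>R ?j) + s *\<^sub>R ?i) - ?gi (x + s *\<^sub>R ?i))" by auto
  have "\<exists>t. t > 0 \<and> t < h \<and> ?gi ((x + s *\<^sub>R ?i) + h *\<^sub>R ?j) - ?gi ((x + s *\<^sub>R ?i) + 0 *\<^sub>R ?j)
     = (h - 0) * frechet_derivative ?gi (at ((x + s *\<^sub>R ?i) + t *\<^sub>R ?j)) ?j"
  proof (rule MVT2)
    fix t :: real assume t: "0 \<le> t" "t \<le> h"
    have "x + s *\<^sub>R ?i + t *\<^sub>R ?j \<in> W" using dom[of s t] s t h by simp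
    then show "((\<lambda>t. ?gi (x + s *\<^sub>R ?i + t *\<^sub>R ?j)) has_field_derivative
       frechet_derivative ?gi (at (x + s *\<^sub>R ?i + t *\<^sub>R ?j)) ?j) (at t)"
      by (intro line gi)
  qed (use h in auto)
  then obtain t where t: "t > 0" "t < h" and
    ft: "?gi ((x + s *\<^sub>R ?i) + h *\<^sub>R ?j) - ?gi (x + s *\<^sub>R ?i)
     = h * frechet_derivative ?gi (at ((x + s *\<^sub>R ?i) + t *\<^sub>R ?j)) ?j" by auto
  have swap: "x + h *\<^sub>R ?j + s *\<^sub>R ?i = x + s *\<^sub>R ?i + h *\<^sub>R ?j" by (simp add: algebra_simps)
  have "F h - F 0 = h * h * frechet_derivative ?gi (at ((x + s *\<^sub>R ?i) + t *\<^sub>R ?j)) ?j"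
    using Fs ft unfolding swap by simp
  moreover have "F h - F 0 = g (x + h *\<^sub>R ?i + h *\<^sub>R ?j) - g (x + h *\<^sub>R ?i) - g (x + h *\<^sub>R ?j) + g x"
    by (simp add: F_def algebra_simps)
  ultimately show ?thesis using s t by (intro exI[of _ s] exI[of _ t]) auto
qed

lemma mixed_partials_commute_real:
  fixes g :: "real^2 \<Rightarrow> real"
  assumes W: "open W" "x \<in> W"
    and g: "\<And>y. y \<in> W \<Longrightarrow> g differentiable (at y)"
    and gi: "\<And>y i. y \<in> W \<Longrightarrow> (\<lambda>y. frechet_derivative g (at y) (axis i 1)) differentiable (at y)"
    and cont: "\<And>i j. continuous_on W (\<lambda>y. frechet_derivative (\<lambda>y. frechet_derivative g (at y) (axis i 1)) (at y) (axis j 1))"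
  shows "frechet_derivative (\<lambda>y. frechet_derivative g (at y) (axis 1 1)) (at x) (axis 2 1)
       = frechet_derivative (\<lambda>y. frechet_derivative g (at y) (axis 2 1)) (at x) (axis 1 1)"
proof (rule ccontr)
  let ?D = "\<lambda>i j y. frechet_derivative (\<lambda>y. frechet_derivative g (at y) (axis i 1)) (at y) (axis j 1)"
  assume ne: "?D 1 2 x \<noteq> ?D 2 1 x"
  define e where "e = \<bar>?D 1 2 x - ?D 2 1 x\<bar> / 2"
  have e: "e > 0" using ne by (simp add: e_def)
  have tend: "\<forall>\<^sub>F y in nhds x. dist (?D i j y) (?D i j x) < e" for i j
  proof -
    have "isCont (?D i j) x" using cont[of i j] W continuous_on_eq_continuous_at by blast
    moreover have "isCont f x \<Longrightarrow> filterlim f (nhds (f x)) (nhds x)" for f :: "real^2 \<Rightarrow> real"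
      using tendsto_at_iff_tendsto_nhds[of f x] by (simp add: isCont_def)
    ultimately have "filterlim (?D i j) (nhds (?D i j x)) (nhds x)" by blast
    then show ?thesis using e by (rule tendstoD)
  qed
  have "\<forall>\<^sub>F y in nhds x. dist (?D 1 2 y) (?D 1 2 x) < e \<and> dist (?D 2 1 y) (?D 2 1 x) < e \<and> y \<in> W"
    using tend[of 1 2] tend[of 2 1] eventually_nhds_in_open[OF W] by eventually_elim auto
  then obtain r where r: "r > 0" and
    rb: "\<And>y. dist y x < r \<Longrightarrow> dist (?D 1 2 y) (?D 1 2 x) < e \<and> dist (?D 2 1 y) (?D 2 1 x) < e \<and> y \<in> W"
    unfolding eventually_nhds_metric by blast
  define h where "h = r / 3"
  have h: "h > 0" using r by (simp add: h_def)
  have near: "dist (x + s *\<^sub>R axis i 1 + t *\<^sub>R axis j (1::real)) x < r"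
    if "0 \<le> s" "s \<le> h" "0 \<le> t" "t \<le> h" for s t and i j :: 2
  proof -
    have "dist (x + s *\<^sub>R axis i 1 + t *\<^sub>R axis j (1::real)) x = norm (s *\<^sub>R axis i 1 + t *\<^sub>R axis j (1::real))"
      by (simp add: dist_norm)
    also have "\<dots> \<le> \<bar>s\<bar> + \<bar>t\<bar>"
      by (rule order_trans[OF norm_triangle_ineq]) simp
    also have "\<dots> < r" using that r by (simp add: h_def)
    finally show ?thesis .
  qed
  obtain s t where st: "0 \<le> s" "s \<le> h" "0 \<le> t" "t \<le> h"
     and 1: "g (x + h *\<^sub>R axis 1 1 + h *\<^sub>R axis 2 1) - g (x + h *\<^sub>R axis 1 1) - g (x + h *\<^sub>R axis 2 1) + g x
      = h * h * ?D 1 2 (x + s *\<^sub>R axis 1 1 + t *\<^sub>R axis 2 1)"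
    using mixed_difference_mean_value[of h x "1::2" 2 W g, OF h _ g gi] rb near by auto
  obtain s' t' where st': "0 \<le> s'" "s' \<le> h" "0 \<le> t'" "t' \<le> h"
     and 2: "g (x + h *\<^sub>R axis 2 1 + h *\<^sub>R axis 1 1) - g (x + h *\<^sub>R axis 2 1) - g (x + h *\<^sub>R axis 1 1) + g x
      = h * h * ?D 2 1 (x + s' *\<^sub>R axis 2 1 + t' *\<^sub>R axis 1 1)"
    using mixed_difference_mean_value[of h x "2::2" 1 W g, OF h _ g gi] rb near by auto
  have "h * h * ?D 1 2 (x + s *\<^sub>R axis 1 1 + t *\<^sub>R axis 2 1) = h * h * ?D 2 1 (x + s' *\<^sub>R axis 2 1 + t' *\<^sub>R axis 1 1)"
    using 1 2 by (simp add: algebra_simps)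
  then have eq: "?D 1 2 (x + s *\<^sub>R axis 1 1 + t *\<^sub>R axis 2 1) = ?D 2 1 (x + s' *\<^sub>R axis 2 1 + t' *\<^sub>R axis 1 1)"
    using h by simp
  have "dist (?D 1 2 (x + s *\<^sub>R axis 1 1 + t *\<^sub>R axis 2 1)) (?D 1 2 x) < e"
    using rb near st by blast
  moreover have "dist (?D 2 1 (x + s' *\<^sub>R axis 2 1 + t' *\<^sub>R axis 1 1)) (?D 2 1 x) < e"
    using rb near st' by blast
  ultimately have "\<bar>?D 1 2 x - ?D 2 1 x\<bar> < 2 * e"
    unfolding eq dist_real_def by linarith
  then show False by (simp add: e_def)
qed

lemma mixed_partials_commute:
  fixes f :: "real^2 \<Rightarrow> 'b::euclidean_space"
  assumes S: "half_plane_open S" and sm: "smooth_on S f" and x: "x \<in> S" "x $ 2 > 0"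
  shows "partial_within S (partial_within S f 1) 2 x = partial_within S (partial_within S f 2) 1 x"
proof (rule euclidean_eqI)
  fix b :: 'b assume "b \<in> Basis"
  define W where "W = S \<inter> {u. u $ 2 > 0}"
  have WS: "at y within S = at y" if "y \<in> W" for y
    using half_plane_at_within_interior[OF S] that by (auto simp: W_def)
  obtain V where V: "open V" "S = half_plane \<inter> V" using S by (auto simp: openin_open)
  have "W = V \<inter> {u. u $ 2 > 0}" using V by (auto simp: W_def half_plane_def)
  then have W: "open W" "x \<in> W" using V open_upper_half_plane x by (auto simp: W_def)
  have WsubS: "W \<subseteq> S" by (auto simp: W_def)
  let ?g = "\<lambda>y. f y \<bullet> b"
  let ?p = "\<lambda>i. partial_within S f i"
  let ?pp = "\<lambda>i j. partial_within S (?p i) j"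
  have hd: "(F has_derivative frechet_derivative F (at y within S)) (at y)" if "smooth_on S F" "y \<in> W" for F :: "real^2 \<Rightarrow> 'b" and y
  proof -
    have "F differentiable (at y within S)" using smooth_on_differentiable[OF that(1)] that(2) WsubS by blast
    then show ?thesis using frechet_derivative_works WS[OF that(2)] by auto
  qed
  have in_der: "((\<lambda>y. F y \<bullet> b) has_derivative (\<lambda>v. frechet_derivative F (at y within S) v \<bullet> b)) (at y)"
    if "smooth_on S F" "y \<in> W" for F :: "real^2 \<Rightarrow> 'b" and y
    using has_derivative_inner_left[OF hd[OF that]] by simp
  have smp: "smooth_on S (?p i)" for i using smooth_on_partial_within[OF S sm] .
  have smpp: "smooth_on S (?pp i j)" for i j using smooth_on_partial_within[OF S smp] .
  have g1: "frechet_derivative ?g (at y) (axis i 1) = ?p i y \<bullet> b" if "y \<in> W" for y i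
    using frechet_derivative_at[OF in_der[OF sm that]] by (metis partial_within_def)
  have gd: "((\<lambda>y. frechet_derivative ?g (at y) (axis i 1)) has_derivative (\<lambda>v. frechet_derivative (?p i) (at y within S) v \<bullet> b)) (at y)"
     if "y \<in> W" for y i
    by (rule has_derivative_transform_within_open[OF in_der[OF smp that] W(1) that]) (simp add: g1)
  have g2: "frechet_derivative (\<lambda>y. frechet_derivative ?g (at y) (axis i 1)) (at y) (axis j 1) = ?pp i j y \<bullet> b" if "y \<in> W" for y i j
    using frechet_derivative_at[OF gd[OF that]] by (metis partial_within_def)
  have "frechet_derivative (\<lambda>y. frechet_derivative ?g (at y) (axis 1 1)) (at x) (axis 2 1)
       = frechet_derivative (\<lambda>y. frechet_derivative ?g (at y) (axis 2 1)) (at x) (axis 1 1)"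
  proof (rule mixed_partials_commute_real[OF W])
    show "?g differentiable at y" if "y \<in> W" for y using in_der[OF sm that] differentiableI by blast
    show "(\<lambda>y. frechet_derivative ?g (at y) (axis i 1)) differentiable at y" if "y \<in> W" for y i
      using gd[OF that] differentiableI by blast
    show "continuous_on W (\<lambda>y. frechet_derivative (\<lambda>y. frechet_derivative ?g (at y) (axis i 1)) (at y) (axis j 1))" for i j
    proof -
      have "continuous_on W (\<lambda>y. ?pp i j y \<bullet> b)"
        using continuous_on_subset[OF smooth_on_continuous[OF smpp] WsubS] by (intro continuous_intros)
      then show ?thesis using g2 by (simp cong: continuous_on_cong)
    qed
  qed
  then show "?pp 1 2 x \<bullet> b = ?pp 2 1 x \<bullet> b" using g2 W by simp
qed

section \<open>The geometry of Sol in the orthonormal frame\<close>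

lemma sol_inner_expand:
  "sol_inner p u v = exp (2 * p $ 3) * u $ 1 * v $ 1 + exp (- 2 * p $ 3) * u $ 2 * v $ 2 + u $ 3 * v $ 3"
  by (simp add: sol_inner_def sol_metric_def inner_vec_def matrix_vector_mult_def sum_3 algebra_simps)

text \<open>The components of a tangent vector in the orthonormal frame
  \<open>e\<^sup>-\<^sup>z \<partial>\<^sub>x, e\<^sup>z \<partial>\<^sub>y, \<partial>\<^sub>z\<close>. In this
  frame the metric is the Euclidean inner product, and the exponentials disappear from the algebraic identities.\<close>

definition sol_frame :: "real^3 \<Rightarrow> real^3 \<Rightarrow> real^3" where
  "sol_frame p v = vector [exp (p $ 3) * v $ 1, exp (- p $ 3) * v $ 2, v $ 3]"

lemma exp_double: "exp (2 * z) = exp z * exp (z::real)" 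
  by (simp add: exp_add[symmetric])

lemma sol_inner_frame: "sol_inner p u v = sol_frame p u \<bullet> sol_frame p v"
  using exp_double[of "p$3"] exp_double[of "- p$3"]
  by (simp add: sol_inner_expand sol_frame_def inner_vec_def sum_3 algebra_simps)

text \<open>The change of frame has determinant \<open>1\<close>: the volume form of Sol is the Euclidean one.\<close>

lemma sol_frame_cross: "sol_frame p u \<bullet> cross3 (sol_frame p v) (sol_frame p w) = u \<bullet> cross3 v w"
proof -
  have "exp (p $ 3) * exp (- p $ 3) = 1" by (simp add: exp_add[symmetric])
  moreover have "sol_frame p u \<bullet> cross3 (sol_frame p v) (sol_frame p w) = (exp (p $ 3) * exp (- p $ 3)) * (u \<bullet> cross3 v w)"
    by (simp add: sol_frame_def cross3_def inner_vec_def sum_3 vector_def algebra_simps)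
  ultimately show ?thesis by simp
qed

lemma sol_frame_linear:
  "sol_frame p (u + v) = sol_frame p u + sol_frame p v"
  "sol_frame p (c *\<^sub>R u) = c *\<^sub>R sol_frame p u"
  by (simp_all add: sol_frame_def vec_eq_iff forall_3 algebra_simps)

lemma matrix_inv_eqI:
  fixes A B :: "real^'n^'n" assumes "A ** B = mat 1" shows "matrix_inv A = B"
proof -
  have BA: "B ** A = mat 1" using assms matrix_left_right_inverse by blast
  have "A ** matrix_inv A = mat 1 \<and> matrix_inv A ** A = mat 1"
    unfolding matrix_inv_def by (rule someI[of _ B]) (use assms BA in simp)
  then have "matrix_inv A ** (A ** B) = B" by (simp add: matrix_mul_assoc)
  then show ?thesis using assms by simp
qed

lemma matrix_inv_sol_metric:
  "matrix_inv (sol_metric p) = vector [vector [exp (- 2 * p $ 3), 0, 0], vector [0, exp (2 * p $ 3), 0], vector [0, 0, 1]]"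
proof (rule matrix_inv_eqI)
  have "exp (2 * p $ 3) * exp (- 2 * p $ 3) = 1" by (simp add: exp_add[symmetric])
  then show "sol_metric p ** vector [vector [exp (- 2 * p $ 3), 0, 0], vector [0, exp (2 * p $ 3), 0], vector [0, 0, 1]] = mat 1"
    by (simp add: sol_metric_def matrix_matrix_mult_def mat_def vec_eq_iff forall_3 sum_3 mult.commute)
qed

lemma partial_sol_metric:
  "partial_within UNIV (\<lambda>q. sol_metric q $ j $ l) i p =
     (if i = 3 \<and> j = l then (if j = 1 then 2 * exp (2 * p $ 3) else if j = 2 then - 2 * exp (- 2 * p $ 3) else 0) else 0)"
proof -
  have c3: "k = 1 \<or> k = 2 \<or> k = 3" for k :: 3 using exhaust_3 by auto
  have comp: "((\<lambda>q::real^3. q $ 3) has_derivative (\<lambda>v. v $ 3)) (at p)"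
    by (rule bounded_linear.has_derivative[OF bounded_linear_vec_nth]) (rule has_derivative_ident)
  have e1: "((\<lambda>q::real^3. exp (2 * q $ 3)) has_derivative (\<lambda>v. 2 * exp (2 * p $ 3) * v $ 3)) (at p)"
    by (auto intro!: derivative_eq_intros comp)
  have e2: "((\<lambda>q::real^3. exp (- 2 * q $ 3)) has_derivative (\<lambda>v. - 2 * exp (- 2 * p $ 3) * v $ 3)) (at p)"
    by (auto intro!: derivative_eq_intros comp)
  have "((\<lambda>q. sol_metric q $ j $ l) has_derivative
     (\<lambda>v. (if j = l then (if j = 1 then 2 * exp (2 * p $ 3) else if j = 2 then - 2 * exp (- 2 * p $ 3) else 0) else 0) * v $ 3)) (at p)"
    using c3[of j] c3[of l] e1 e2 by (elim disjE) (simp_all add: sol_metric_def)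
  from frechet_derivative_at[OF this]
  have "frechet_derivative (\<lambda>q. sol_metric q $ j $ l) (at p) = (\<lambda>v. (if j = l then (if j = 1 then 2 * exp (2 * p $ 3) else if j = 2 then - 2 * exp (- 2 * p $ 3) else 0) else 0) * v $ 3)"
    by (rule sym)
  then show ?thesis unfolding partial_within_def by (simp only:) (simp add: axis_def)
qed

text \<open>The Christoffel part \<open>\<Gamma>\<^sup>k\<^sub>i\<^sub>j u\<^sup>i v\<^sup>j\<close> of the covariant
  derivative.\<close>

definition sol_connection :: "real^3 \<Rightarrow> real^3 \<Rightarrow> real^3 \<Rightarrow> real^3" where
  "sol_connection p u v = vector [u $ 3 * v $ 1 + u $ 1 * v $ 3, - (u $ 3 * v $ 2 + u $ 2 * v $ 3),
      - exp (2 * p $ 3) * u $ 1 * v $ 1 + exp (- 2 * p $ 3) * u $ 2 * v $ 2]"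

lemma christoffel_sum:
  "(\<chi> k. \<Sum>a\<in>UNIV. \<Sum>b\<in>UNIV. christoffel p k a b * u $ a * v $ b) = sol_connection p u v"
proof -
  have e: "exp (2 * p $ 3) * exp (- (2 * p $ 3)) = 1" "exp (- (2 * p $ 3)) * exp (2 * p $ 3) = 1" by (simp_all add: exp_add[symmetric])
  have "christoffel p 1 a b = (if a = 1 \<and> b = 3 \<or> a = 3 \<and> b = 1 then 1 else 0)" for a b
    unfolding christoffel_def matrix_inv_sol_metric partial_sol_metric using exhaust_3[of a] exhaust_3[of b]
    by (auto simp: sum_3 e algebra_simps)
  moreover have "christoffel p 2 a b = (if a = 2 \<and> b = 3 \<or> a = 3 \<and> b = 2 then -1 else 0)" for a b
    unfolding christoffel_def matrix_inv_sol_metric partial_sol_metric using exhaust_3[of a] exhaust_3[of b]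
    by (auto simp: sum_3 e algebra_simps)
  moreover have "christoffel p 3 a b = (if a = 1 \<and> b = 1 then - exp (2 * p $ 3) else if a = 2 \<and> b = 2 then exp (- 2 * p $ 3) else 0)" for a b
    unfolding christoffel_def matrix_inv_sol_metric partial_sol_metric using exhaust_3[of a] exhaust_3[of b]
    by (auto simp: sum_3 algebra_simps)
  ultimately show ?thesis
    by (simp add: vec_eq_iff forall_3 sol_connection_def sum_3 algebra_simps)
qed

text \<open>The same bilinear map in frame components, where it no longer depends on the point.\<close>

definition frame_connection :: "real^3 \<Rightarrow> real^3 \<Rightarrow> real^3" where
  "frame_connection U V = vector [U $ 3 * V $ 1 + U $ 1 * V $ 3, - (U $ 3 * V $ 2 + U $ 2 * V $ 3), - U $ 1 * V $ 1 + U $ 2 * V $ 2]"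

lemma sol_frame_connection: "sol_frame p (sol_connection p u v) = frame_connection (sol_frame p u) (sol_frame p v)"
  using exp_double[of "p$3"] exp_double[of "- p$3"]
  by (simp add: sol_frame_def sol_connection_def frame_connection_def vec_eq_iff forall_3 algebra_simps)

text \<open>Parallel transport preserves volume: the endomorphism \<open>frame_connection U\<close> is trace-free, and a
  trace-free endomorphism annihilates the determinant.\<close>

lemma frame_connection_volume:
  "cross3 (frame_connection U Y) V \<bullet> W + cross3 Y (frame_connection U V) \<bullet> W + cross3 Y V \<bullet> (frame_connection U W) = 0"
  by (simp add: frame_connection_def cross3_def inner_vec_def sum_3 vector_def algebra_simps)

lemma frame_connection_metric:
  "frame_connection U V \<bullet> W + V \<bullet> frame_connection U W = 2 * U $ 3 * (V $ 1 * W $ 1 - V $ 2 * W $ 2)"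
  by (simp add: frame_connection_def inner_vec_def sum_3 algebra_simps)

text \<open>The double cross product \<open>N \<times> (N \<times> W)\<close> vanishes for \<open>W = U \<times> V\<close>,
  because \<open>N \<times> (U \<times> V)\<close> does; expanding it gives the claim.\<close>

lemma cross_of_orthogonal_to_unit:
  assumes "U \<bullet> N = 0" "V \<bullet> N = 0" "N \<bullet> N = 1"
  shows "cross3 U V = (N \<bullet> cross3 U V) *\<^sub>R N"
proof -
  have "cross3 N (cross3 U V) = 0"
    using assms by (simp add: Lagrange inner_commute)
  then have "cross3 N (cross3 N W) = 0" if "W = cross3 U V" for W using that by simp
  then show ?thesis using assms(3) Lagrange[of N N "cross3 U V"] by simp
qed

text \<open>Here \<open>A, B\<close> span the tangent plane, \<open>N\<close> is the normal, and \<open>M1, M2\<close> are the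
  covariant derivatives of the normal in the directions \<open>A, B\<close>. As tangent vectors, \<open>-M1\<close>
  and \<open>-M2\<close> are the images of \<open>A\<close> and \<open>B\<close> under the shape operator
  \<open>S\<close>, and \<open>det (Y, S A, B) + det (Y, A, S B) = tr S \<cdot> det (Y, A, B)\<close>. The last
  hypothesis says that half the trace of \<open>S\<close> is \<open>H\<close>, written without dividing by the Gram
  determinant. The proof compares coefficients of \<open>N\<close>, since every cross product of tangent vectors is
  a multiple of \<open>N\<close>.\<close>

lemma shape_operator_trace:
  fixes A B N M1 M2 Y :: "real^3"
  assumes o: "A \<bullet> N = 0" "B \<bullet> N = 0" "N \<bullet> N = 1" "M1 \<bullet> N = 0" "M2 \<bullet> N = 0" and ind: "cross3 A B \<noteq> 0"
    and tr: "- (B \<bullet> B) * (A \<bullet> M1) + (A \<bullet> B) * (A \<bullet> M2) + (A \<bullet> B) * (B \<bullet> M1) - (A \<bullet> A) * (B \<bullet> M2)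
        = 2 * H * ((A \<bullet> A) * (B \<bullet> B) - (A \<bullet> B)\<^sup>2)"
  shows "Y \<bullet> cross3 B M1 - Y \<bullet> cross3 A M2 = 2 * H * (Y \<bullet> cross3 A B)"
proof -
  define w where "w = N \<bullet> cross3 A B"
  have AB: "cross3 A B = w *\<^sub>R N" unfolding w_def by (rule cross_of_orthogonal_to_unit[OF o(1-3)])
  have BM: "cross3 B M1 = (N \<bullet> cross3 B M1) *\<^sub>R N" by (rule cross_of_orthogonal_to_unit[OF o(2,4,3)])
  have AM: "cross3 A M2 = (N \<bullet> cross3 A M2) *\<^sub>R N" by (rule cross_of_orthogonal_to_unit[OF o(1,5,3)])
  have w0: "w \<noteq> 0" using ind AB by auto
  have "w * (N \<bullet> cross3 B M1) = cross3 A B \<bullet> cross3 B M1" by (simp add: AB)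
  also have "\<dots> = (A \<bullet> B) * (B \<bullet> M1) - (A \<bullet> M1) * (B \<bullet> B)" by (simp add: dot_cross inner_commute)
  finally have 1: "w * (N \<bullet> cross3 B M1) = (A \<bullet> B) * (B \<bullet> M1) - (A \<bullet> M1) * (B \<bullet> B)" .
  have "w * (N \<bullet> cross3 A M2) = cross3 A B \<bullet> cross3 A M2" by (simp add: AB)
  also have "\<dots> = (A \<bullet> A) * (B \<bullet> M2) - (A \<bullet> M2) * (A \<bullet> B)" by (simp add: dot_cross inner_commute)
  finally have 2: "w * (N \<bullet> cross3 A M2) = (A \<bullet> A) * (B \<bullet> M2) - (A \<bullet> M2) * (A \<bullet> B)" .
  have "w * w = cross3 A B \<bullet> cross3 A B" by (simp add: AB o)
  also have "\<dots> = (A \<bullet> A) * (B \<bullet> B) - (A \<bullet> B)\<^sup>2" by (simp add: dot_cross inner_commute power2_eq_square)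
  finally have 3: "w * w = (A \<bullet> A) * (B \<bullet> B) - (A \<bullet> B)\<^sup>2" .
  have "w * (N \<bullet> cross3 B M1 - N \<bullet> cross3 A M2) = w * (2 * H * w)"
  proof -
    have "w * (N \<bullet> cross3 B M1 - N \<bullet> cross3 A M2)
       = ((A \<bullet> B) * (B \<bullet> M1) - (A \<bullet> M1) * (B \<bullet> B)) - ((A \<bullet> A) * (B \<bullet> M2) - (A \<bullet> M2) * (A \<bullet> B))"
      using 1 2 by (simp add: right_diff_distrib)
    also have "\<dots> = 2 * H * ((A \<bullet> A) * (B \<bullet> B) - (A \<bullet> B)\<^sup>2)" using tr by (simp add: mult.commute)
    also have "\<dots> = w * (2 * H * w)" unfolding 3[symmetric] by simp
    finally show ?thesis .
  qed
  then have "N \<bullet> cross3 B M1 - N \<bullet> cross3 A M2 = 2 * H * w" using w0 by simp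
  then have "(Y \<bullet> N) * (N \<bullet> cross3 B M1 - N \<bullet> cross3 A M2) = (Y \<bullet> N) * (2 * H * w)" by simp
  moreover have "Y \<bullet> cross3 B M1 = (Y \<bullet> N) * (N \<bullet> cross3 B M1)" by (subst BM) (simp add: mult.commute)
  moreover have "Y \<bullet> cross3 A M2 = (Y \<bullet> N) * (N \<bullet> cross3 A M2)" by (subst AM) (simp add: mult.commute)
  ultimately show ?thesis by (simp add: AB algebra_simps)
qed

section \<open>The flux form of a Killing field\<close>

definition killing :: "real^2 \<Rightarrow> real^3 \<Rightarrow> real^3" where
  "killing q p = vector [- (p $ 1 - q $ 1), p $ 2 - q $ 2, 1]"

definition killing_deriv :: "real^3 \<Rightarrow> real^3" where
  "killing_deriv v = vector [- v $ 1, v $ 2, 0]"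

text \<open>A primitive of the flux two-form \<open>det (killing q, \<cdot>, \<cdot>)\<close>:
  \<open>\<omega> = ((x - q\<^sub>1) dy - (y - q\<^sub>2) dx) / 2 - (x - q\<^sub>1) (y - q\<^sub>2) dz\<close>.\<close>

definition flux_potential :: "real^2 \<Rightarrow> real^3 \<Rightarrow> real^3" where
  "flux_potential q p = vector [- (p $ 2 - q $ 2) / 2, (p $ 1 - q $ 1) / 2, - ((p $ 1 - q $ 1) * (p $ 2 - q $ 2))]"

definition flux_potential_deriv :: "real^2 \<Rightarrow> real^3 \<Rightarrow> real^3 \<Rightarrow> real^3" where
  "flux_potential_deriv q p v = vector [- v $ 2 / 2, v $ 1 / 2, - (v $ 1 * (p $ 2 - q $ 2) + (p $ 1 - q $ 1) * v $ 2)]"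

text \<open>The one-form \<open>v \<mapsto> det (v, n, X) - 2 H \<omega>(v)\<close>, represented by its coefficient vector.\<close>

definition flux_form :: "real^2 \<Rightarrow> real \<Rightarrow> real^3 \<Rightarrow> real^3 \<Rightarrow> real^3" where
  "flux_form q H p n = cross3 n (killing q p) - (2 * H) *\<^sub>R flux_potential q p"

lemma has_derivative_vector3:
  fixes a b c :: "'a::real_normed_vector \<Rightarrow> real"
  assumes "(a has_derivative a') F" "(b has_derivative b') F" "(c has_derivative c') F"
  shows "((\<lambda>x. vector [a x, b x, c x] :: real^3) has_derivative (\<lambda>v. vector [a' v, b' v, c' v])) F"
proof -
  have eq: "vector [r, s, t] = r *\<^sub>R axis 1 1 + s *\<^sub>R axis 2 1 + t *\<^sub>R (axis 3 1 :: real^3)" for r s t :: real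
    by (simp add: vec_eq_iff forall_3 axis_def)
  show ?thesis unfolding eq using assms by (intro derivative_intros)
qed

lemma has_derivative_component:
  assumes "(f has_derivative f') F" shows "((\<lambda>x. (f x :: real^'n) $ i) has_derivative (\<lambda>v. f' v $ i)) F"
  by (rule bounded_linear.has_derivative[OF bounded_linear_vec_nth assms])

lemma killing_has_derivative:
  assumes "(f has_derivative f') F"
  shows "((\<lambda>x. killing q (f x)) has_derivative (\<lambda>v. killing_deriv (f' v))) F"
  unfolding killing_def killing_deriv_def
  by (rule has_derivative_vector3) (auto intro!: derivative_eq_intros has_derivative_component assms)

lemma flux_potential_has_derivative:
  assumes "(f has_derivative f') (at x within S)"
  shows "((\<lambda>x. flux_potential q (f x)) has_derivative (\<lambda>v. flux_potential_deriv q (f x) (f' v))) (at x within S)"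
  unfolding flux_potential_def flux_potential_deriv_def
  by (rule has_derivative_vector3) (auto intro!: derivative_eq_intros has_derivative_component assms simp: algebra_simps)

lemma bounded_bilinear_cross3: "bounded_bilinear cross3"
  using bilinear_conv_bounded_bilinear bilinear_cross by blast

lemma flux_form_has_derivative:
  assumes "(f has_derivative f') (at x within S)" "(n has_derivative n') (at x within S)"
  shows "((\<lambda>x. flux_form q H (f x) (n x)) has_derivative
     (\<lambda>v. cross3 (n x) (killing_deriv (f' v)) + cross3 (n' v) (killing q (f x)) - (2 * H) *\<^sub>R flux_potential_deriv q (f x) (f' v))) (at x within S)"
  unfolding flux_form_def
  by (intro derivative_intros bounded_bilinear.FDERIV[OF bounded_bilinear_cross3] killing_has_derivative flux_potential_has_derivative assms)

lemma flux_potential_curl: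
  "b \<bullet> flux_potential_deriv q p a - a \<bullet> flux_potential_deriv q p b = killing q p \<bullet> cross3 a b"
  by (simp add: flux_potential_deriv_def killing_def cross3_def inner_vec_def sum_3 vector_def algebra_simps)

text \<open>The covariant derivative of the Killing field is a cross product with a fixed vector, hence skew; this is Killing's
  equation.\<close>

lemma killing_frame:
  "sol_frame p (killing_deriv u) + frame_connection (sol_frame p u) (sol_frame p (killing q p))
     = cross3 (vector [sol_frame p (killing q p) $ 2, sol_frame p (killing q p) $ 1, 0]) (sol_frame p u)"
  by (simp add: sol_frame_def killing_def killing_deriv_def frame_connection_def cross3_def vec_eq_iff forall_3 vector_def algebra_simps)

lemma frame_connection_sym: "frame_connection U V = frame_connection V U"
  by (simp add: frame_connection_def vec_eq_iff forall_3 algebra_simps)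

text \<open>Closedness of the flux form at a point, after the second derivatives of the immersion have cancelled. The vectors
  \<open>a, b\<close> are the coordinate tangent vectors and \<open>n1, n2\<close> the coordinate derivatives of
  the normal. Passing to covariant derivatives in the frame, the correction terms cancel by
  \<open>frame_connection_volume\<close>, the derivative of the Killing field drops out by skewness, and the
  derivative of the normal gives the mean curvature term, which is matched by the curl of the potential.\<close>

lemma flux_form_closed_algebra:
  fixes a b n n1 n2 p :: "real^3"
  defines "A \<equiv> sol_frame p a" and "B \<equiv> sol_frame p b" and "N \<equiv> sol_frame p n"
  defines "M1 \<equiv> sol_frame p n1 + frame_connection A N" and "M2 \<equiv> sol_frame p n2 + frame_connection B N"
  assumes o: "A \<bullet> N = 0" "B \<bullet> N = 0" "N \<bullet> N = 1" "M1 \<bullet> N = 0" "M2 \<bullet> N = 0" and ind: "cross3 A B \<noteq> 0"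
    and tr: "- (B \<bullet> B) * (A \<bullet> M1) + (A \<bullet> B) * (A \<bullet> M2) + (A \<bullet> B) * (B \<bullet> M1) - (A \<bullet> A) * (B \<bullet> M2)
        = 2 * H * ((A \<bullet> A) * (B \<bullet> B) - (A \<bullet> B)\<^sup>2)"
  shows "b \<bullet> (cross3 n (killing_deriv a) + cross3 n1 (killing q p) - (2 * H) *\<^sub>R flux_potential_deriv q p a)
       = a \<bullet> (cross3 n (killing_deriv b) + cross3 n2 (killing q p) - (2 * H) *\<^sub>R flux_potential_deriv q p b)"
proof -
  define Y where "Y = sol_frame p (killing q p)"
  define R :: "real^3" where "R = vector [Y $ 2, Y $ 1, 0]"
  let ?G = frame_connection
  have K: "sol_frame p (killing_deriv u) = cross3 R (sol_frame p u) - ?G (sol_frame p u) Y" for u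
    using killing_frame[of p u q] by (simp add: R_def Y_def algebra_simps)
  have cyc: "u \<bullet> cross3 v w = v \<bullet> cross3 w u" for u v w by (simp add: cross3_simps)
  have cyc': "u \<bullet> cross3 v w = w \<bullet> cross3 u v" for u v w by (simp add: cross3_simps)
  have anti: "u \<bullet> cross3 v w = - (u \<bullet> cross3 w v)" for u v w by (simp add: cross3_simps)
  have "b \<bullet> cross3 n (killing_deriv a) - a \<bullet> cross3 n (killing_deriv b)
     = B \<bullet> cross3 N (cross3 R A - ?G A Y) - A \<bullet> cross3 N (cross3 R B - ?G B Y)"
    using sol_frame_cross[of p b n "killing_deriv a"] sol_frame_cross[of p a n "killing_deriv b"]
    unfolding A_def B_def N_def K by simp
  also have "\<dots> = B \<bullet> cross3 N (cross3 R A) - A \<bullet> cross3 N (cross3 R B) - B \<bullet> cross3 N (?G A Y) + A \<bullet> cross3 N (?G B Y)"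
    by (simp add: Cross3.right_diff_distrib inner_diff_right)
  also have "B \<bullet> cross3 N (cross3 R A) - A \<bullet> cross3 N (cross3 R B) = 0"
    using o(1,2) by (simp add: Lagrange inner_diff_right inner_commute)
  finally have 1: "b \<bullet> cross3 n (killing_deriv a) - a \<bullet> cross3 n (killing_deriv b) = - (B \<bullet> cross3 N (?G A Y)) + A \<bullet> cross3 N (?G B Y)" by simp
  have "b \<bullet> cross3 n1 (killing q p) - a \<bullet> cross3 n2 (killing q p) = B \<bullet> cross3 (M1 - ?G A N) Y - A \<bullet> cross3 (M2 - ?G B N) Y"
    using sol_frame_cross[of p b n1 "killing q p"] sol_frame_cross[of p a n2 "killing q p"]
    by (simp add: M1_def M2_def A_def B_def Y_def)
  also have "\<dots> = (Y \<bullet> cross3 B M1 - Y \<bullet> cross3 A M2) - Y \<bullet> cross3 B (?G A N) + Y \<bullet> cross3 A (?G B N)"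
    unfolding cyc'[of _ _ Y] by (simp add: Cross3.right_diff_distrib inner_diff_right)
  also have "Y \<bullet> cross3 B M1 - Y \<bullet> cross3 A M2 = 2 * H * (Y \<bullet> cross3 A B)"
    by (rule shape_operator_trace[OF o ind tr])
  also have "Y \<bullet> cross3 A B = killing q p \<bullet> cross3 a b"
    unfolding Y_def A_def B_def by (rule sol_frame_cross)
  finally have 2: "b \<bullet> cross3 n1 (killing q p) - a \<bullet> cross3 n2 (killing q p)
    = 2 * H * (killing q p \<bullet> cross3 a b) - Y \<bullet> cross3 B (?G A N) + Y \<bullet> cross3 A (?G B N)" .
  have vol1: "B \<bullet> cross3 N (?G A Y) + Y \<bullet> cross3 (?G A B) N + Y \<bullet> cross3 B (?G A N) = 0"
    using frame_connection_volume[of A Y B N] by (simp add: cross3_simps)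
  have vol2: "A \<bullet> cross3 N (?G B Y) + Y \<bullet> cross3 (?G B A) N + Y \<bullet> cross3 A (?G B N) = 0"
    using frame_connection_volume[of B Y A N] by (simp add: cross3_simps)
  have vol: "- (B \<bullet> cross3 N (?G A Y)) + A \<bullet> cross3 N (?G B Y) - Y \<bullet> cross3 B (?G A N) + Y \<bullet> cross3 A (?G B N) = 0"
    using vol1 vol2 frame_connection_sym[of A B] by simp
  have 3: "2 * H * (b \<bullet> flux_potential_deriv q p a - a \<bullet> flux_potential_deriv q p b) = 2 * H * (killing q p \<bullet> cross3 a b)"
    by (simp add: flux_potential_curl)
  show ?thesis using 1 2 3 vol by (simp add: inner_simps algebra_simps)
qed

lemma sol_inner_has_derivative:
  assumes F: "(F has_derivative F') (at x within S)" and V: "(V has_derivative V') (at x within S)"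
    and W: "(W has_derivative W') (at x within S)"
  shows "((\<lambda>y. sol_inner (F y) (V y) (W y)) has_derivative
    (\<lambda>v. (sol_frame (F x) (V' v) + frame_connection (sol_frame (F x) (F' v)) (sol_frame (F x) (V x))) \<bullet> sol_frame (F x) (W x)
        + sol_frame (F x) (V x) \<bullet> (sol_frame (F x) (W' v) + frame_connection (sol_frame (F x) (F' v)) (sol_frame (F x) (W x)))))
    (at x within S)"
proof -
  let ?P = "sol_frame (F x)"
  have e: "exp (2 * F x $ 3) = exp (F x $ 3) * exp (F x $ 3)" "exp (- (2 * F x $ 3)) = exp (- (F x $ 3)) * exp (- (F x $ 3))"
    using exp_double[of "F x $ 3"] exp_double[of "- F x $ 3"] by simp_all
  have c: "(?P (V' v) + frame_connection (?P (F' v)) (?P (V x))) \<bullet> ?P (W x)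
        + ?P (V x) \<bullet> (?P (W' v) + frame_connection (?P (F' v)) (?P (W x)))
      = ?P (V' v) \<bullet> ?P (W x) + ?P (V x) \<bullet> ?P (W' v) + 2 * F' v $ 3 * (?P (V x) $ 1 * ?P (W x) $ 1 - ?P (V x) $ 2 * ?P (W x) $ 2)" for v
    using frame_connection_metric[of "?P (F' v)" "?P (V x)" "?P (W x)"]
    by (simp add: inner_add_left inner_add_right) (simp add: sol_frame_def)
  show ?thesis unfolding c sol_inner_expand
    by (rule has_derivative_eq_rhs, (rule derivative_intros has_derivative_component F V W)+)
       (simp add: fun_eq_iff sol_frame_def inner_vec_def sum_3 e algebra_simps)
qed

lemma partial_within_eqI:
  assumes "half_plane_open S" "x \<in> S" "(f has_derivative f') (at x within S)"
  shows "partial_within S f i x = f' (axis i 1)"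
  unfolding partial_within_def half_plane_frechet_eq[OF assms] ..

lemma trace_matrix_inv_2:
  fixes G B :: "real^2^2" assumes "det G \<noteq> 0"
  shows "trace (matrix_inv G ** B) * det G = G$2$2 * B$1$1 - G$1$2 * B$2$1 - G$2$1 * B$1$2 + G$1$1 * B$2$2"
proof -
  define d where "d = det G"
  have d: "d \<noteq> 0" "G$1$1 * G$2$2 - G$1$2 * G$2$1 = d" using assms by (simp_all add: d_def det_2)
  have "matrix_inv G = (\<chi> i j. (if i = j then (if i = 1 then G$2$2 else G$1$1) else - G$i$j) / d)"
    by (rule matrix_inv_eqI)
       (use d in \<open>simp add: matrix_matrix_mult_def mat_def vec_eq_iff forall_2 sum_2 divide_simps, simp add: algebra_simps\<close>)
  then show ?thesis using d unfolding d_def[symmetric] by (simp add: trace_def matrix_matrix_mult_def sum_2 field_simps)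
qed

lemma inj_derivative_cross_nonzero:
  fixes f :: "real^2 \<Rightarrow> real^3"
  assumes "f differentiable (at x within S)" "inj (frechet_derivative f (at x within S))"
  shows "cross3 (partial_within S f 1 x) (partial_within S f 2 x) \<noteq> 0"
proof
  let ?a = "partial_within S f 1 x" and ?b = "partial_within S f 2 x"
  assume "cross3 ?a ?b = 0"
  then have "?a = 0 \<or> ?b = 0 \<or> (\<exists>c. ?b = c *\<^sub>R ?a)"
    by (simp add: cross_eq_0 collinear_lemma)
  then obtain r s where rs: "r *\<^sub>R ?a + s *\<^sub>R ?b = 0" "r \<noteq> 0 \<or> s \<noteq> 0"
  proof (elim disjE exE)
    fix c assume "?b = c *\<^sub>R ?a" then show ?thesis using that[of "- c" 1] by simp
  next assume "?a = 0" then show ?thesis using that[of 1 0] by simp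
  next assume "?b = 0" then show ?thesis using that[of 0 1] by simp
  qed
  define v :: "real^2" where "v = vector [r, s]"
  have "frechet_derivative f (at x within S) v = 0"
    using rs(1) frechet_derivative_expand2[OF assms(1), of v] by (simp add: v_def)
  moreover have "frechet_derivative f (at x within S) 0 = 0"
    using linear_0[OF linear_frechet_derivative[OF assms(1)]] .
  ultimately have "v = 0" using assms(2) by (simp add: inj_def)
  then show False using rs(2) by (simp add: v_def vec_eq_iff forall_2)
qed

lemma sol_frame_cross_nonzero:
  assumes "cross3 a b \<noteq> 0" shows "cross3 (sol_frame p a) (sol_frame p b) \<noteq> 0"
proof
  assume "cross3 (sol_frame p a) (sol_frame p b) = 0"
  then have "cross3 a b \<bullet> cross3 a b = 0" using sol_frame_cross[of p "cross3 a b" a b] by simp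
  then show False using assms by simp
qed

text \<open>Differentiating the relations \<open>\<langle>N, N\<rangle> = 1\<close> and
  \<open>\<langle>\<partial>\<^sub>j f, N\<rangle> = 0\<close> shows that the covariant derivatives of the normal
  are tangential and represent the second fundamental form up to sign. The claim is then
  \<open>flux_form_closed_algebra\<close> together with the symmetry of second derivatives.\<close>

lemma flux_form_closed:
  fixes f n :: "real^2 \<Rightarrow> real^3"
  assumes S: "half_plane_open S" and f: "smooth_on S f" and n: "smooth_on S n"
    and x: "x \<in> S" "x $ 2 > 0"
    and unit: "\<And>y. y \<in> S \<Longrightarrow> sol_norm (f y) (n y) = 1"
    and perp: "\<And>y v. y \<in> S \<Longrightarrow> sol_inner (f y) (frechet_derivative f (at y within S) v) (n y) = 0"
    and inj: "inj (frechet_derivative f (at x within S))"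
    and H: "mean_curvature S f n x = H"
  shows "partial_within S (\<lambda>y. flux_form q H (f y) (n y) \<bullet> partial_within S f 2 y) 1 x
       = partial_within S (\<lambda>y. flux_form q H (f y) (n y) \<bullet> partial_within S f 1 y) 2 x"
proof -
  let ?D = "\<lambda>g. frechet_derivative g (at x within S)"
  let ?f = "\<lambda>i. partial_within S f i"
  have hd: "(g has_derivative ?D g) (at x within S)" if "smooth_on S g" for g :: "real^2 \<Rightarrow> real^3"
    using smooth_on_differentiable[OF that x(1)] frechet_derivative_works by blast
  have smf: "smooth_on S (?f i)" for i by (rule smooth_on_partial_within[OF S f])
  let ?P = "sol_frame (f x)"
  define A where "A i = ?P (?f i x)" for i
  define N where "N = ?P (n x)"
  define M where "M i = ?P (partial_within S n i x) + frame_connection (A i) N" for i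
  define B where "B i j = (?P (partial_within S (?f j) i x) + frame_connection (A i) (A j)) \<bullet> N" for i j
  have zero: "g' = (\<lambda>v. 0)" if "(g has_derivative g') (at x within S)" "\<And>y. y \<in> S \<Longrightarrow> g y = c" for g :: "real^2 \<Rightarrow> real" and g' c
  proof -
    have "((\<lambda>y. c) has_derivative g') (at x within S)"
      by (rule has_derivative_transform[OF x(1) _ that(1)]) (use that(2) in simp)
    from half_plane_derivative_unique[OF S x(1) this has_derivative_const] show ?thesis .
  qed
  have NN: "N \<bullet> N = 1" using unit[OF x(1)] by (simp add: sol_norm_def sol_inner_frame N_def)
  have AN: "A i \<bullet> N = 0" for i
    using perp[OF x(1), of "axis i 1"] by (simp add: sol_inner_frame N_def A_def partial_within_def)
  have MN: "M i \<bullet> N = 0" for i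
  proof -
    have "sol_inner (f y) (n y) (n y) = 1" if "y \<in> S" for y
      using unit[OF that] by (simp add: sol_norm_def)
    from zero[OF sol_inner_has_derivative[OF hd[OF f] hd[OF n] hd[OF n]] this]
    have "M i \<bullet> N + N \<bullet> M i = 0" 
      unfolding M_def N_def A_def partial_within_def by (rule fun_cong)
    then show ?thesis by (simp add: inner_commute)
  qed
  have BM: "B i j = - (A j \<bullet> M i)" for i j
  proof -
    have "sol_inner (f y) (?f j y) (n y) = 0" if "y \<in> S" for y
      using perp[OF that] by (simp add: partial_within_def)
    from zero[OF sol_inner_has_derivative[OF hd[OF f] hd[OF smf] hd[OF n]] this]
    have "B i j + A j \<bullet> M i = 0" 
      unfolding B_def M_def N_def A_def partial_within_def by (rule fun_cong)
    then show ?thesis by simp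
  qed
  have B2: "second_form S f n x $ i $ j = B i j" for i j
    by (simp add: second_form_def sol_covariant_def christoffel_sum sol_inner_frame sol_frame_linear
        sol_frame_connection B_def A_def N_def)
  have G: "first_form S f x $ i $ j = A i \<bullet> A j" for i j
    by (simp add: first_form_def sol_inner_frame A_def)
  have ind: "cross3 (A 1) (A 2) \<noteq> 0"
    unfolding A_def by (intro sol_frame_cross_nonzero inj_derivative_cross_nonzero smooth_on_differentiable[OF f x(1)] inj)
  have detG: "det (first_form S f x) = (A 1 \<bullet> A 1) * (A 2 \<bullet> A 2) - (A 1 \<bullet> A 2)\<^sup>2"
    by (simp add: det_2 G inner_commute power2_eq_square)
  also have "\<dots> = cross3 (A 1) (A 2) \<bullet> cross3 (A 1) (A 2)"
    by (simp add: dot_cross inner_commute power2_eq_square)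
  finally have "det (first_form S f x) \<noteq> 0" using ind by simp
  from trace_matrix_inv_2[OF this, of "second_form S f n x"]
  have tr: "- (A 2 \<bullet> A 2) * (A 1 \<bullet> M 1) + (A 1 \<bullet> A 2) * (A 1 \<bullet> M 2) + (A 1 \<bullet> A 2) * (A 2 \<bullet> M 1) - (A 1 \<bullet> A 1) * (A 2 \<bullet> M 2)
     = 2 * H * ((A 1 \<bullet> A 1) * (A 2 \<bullet> A 2) - (A 1 \<bullet> A 2)\<^sup>2)"
    using H unfolding mean_curvature_def detG by (simp add: G B2 BM inner_commute)
  let ?L = "\<lambda>y. flux_form q H (f y) (n y)"
  define L' where "L' v = cross3 (n x) (killing_deriv (?D f v)) + cross3 (?D n v) (killing q (f x)) - (2 * H) *\<^sub>R flux_potential_deriv q (f x) (?D f v)" for v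
  have Ld: "(?L has_derivative L') (at x within S)"
    unfolding L'_def by (rule flux_form_has_derivative[OF hd[OF f] hd[OF n]])
  have th: "partial_within S (\<lambda>y. ?L y \<bullet> ?f j y) i x = ?L x \<bullet> partial_within S (?f j) i x + L' (axis i 1) \<bullet> ?f j x" for i j
    using partial_within_eqI[OF S x(1) has_derivative_inner[OF Ld hd[OF smf]]] by (simp add: partial_within_def)
  have "?f 2 x \<bullet> L' (axis 1 1) = ?f 1 x \<bullet> L' (axis 2 1)"
    unfolding L'_def partial_within_def[symmetric]
    by (rule flux_form_closed_algebra)
       (fold A_def N_def, fold M_def, (rule AN NN MN ind tr)+)
  then show ?thesis
    unfolding th using mixed_partials_commute[OF S f x] by (simp add: inner_commute)
qed

section \<open>Green's theorem for Jordan curves via winding numbers\<close>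

text \<open>The form \<open>d arg (z - w)\<close> at \<open>z = x + i y\<close>, \<open>w = a + i b\<close>, evaluated on the
  velocity \<open>x' + i y'\<close>.\<close>

definition winding_kernel :: "real \<Rightarrow> real \<Rightarrow> real \<Rightarrow> real \<Rightarrow> real \<Rightarrow> real \<Rightarrow> real" where
  "winding_kernel x y x' y' a b = (y' * (x - a) - x' * (y - b)) / ((x - a)\<^sup>2 + (y - b)\<^sup>2)"

lemma Im_kernel: "Im (Complex x' y' / (Complex x y - Complex a b)) = winding_kernel x y x' y' a b"
  by (simp add: winding_kernel_def Im_divide)

text \<open>The kernel is of order \<open>1 / |z - w|\<close>, and \<open>|z - w|\<^sup>2 \<ge> |x - a| |y - b|\<close>. The
  resulting bound is a product of functions of one variable, integrable by Tonelli's theorem without polar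
  coordinates.\<close>

lemma winding_kernel_bound:
  assumes "x \<noteq> a" "y \<noteq> b"
  shows "\<bar>winding_kernel x y x' y' a b\<bar> \<le> (\<bar>x'\<bar> + \<bar>y'\<bar>) * (1 / sqrt \<bar>a - x\<bar>) * (1 / sqrt \<bar>b - y\<bar>)"
proof -
  define u v where "u = \<bar>a - x\<bar>" and "v = \<bar>b - y\<bar>"
  have uv: "u > 0" "v > 0" using assms by (auto simp: u_def v_def)
  define r where "r = sqrt (u\<^sup>2 + v\<^sup>2)"
  have r: "r > 0" "r * r = u\<^sup>2 + v\<^sup>2" using uv by (simp_all add: r_def add_pos_pos)
  have ur: "u \<le> r" "v \<le> r" unfolding r_def using uv by (simp_all add: real_le_rsqrt)
  have sr: "sqrt u * sqrt v \<le> r"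
  proof -
    have "sqrt u * sqrt v \<le> sqrt r * sqrt r"
      by (intro mult_mono) (use ur uv r in auto)
    then show ?thesis using r by simp
  qed
  have "\<bar>y' * (x - a) - x' * (y - b)\<bar> \<le> \<bar>y'\<bar> * u + \<bar>x'\<bar> * v"
    by (rule order_trans[OF abs_triangle_ineq4]) (simp add: u_def v_def abs_mult abs_minus_commute)
  also have "\<dots> \<le> \<bar>y'\<bar> * r + \<bar>x'\<bar> * r"
    by (intro add_mono mult_left_mono) (use ur in auto)
  finally have num: "\<bar>y' * (x - a) - x' * (y - b)\<bar> \<le> (\<bar>x'\<bar> + \<bar>y'\<bar>) * r" by (simp add: algebra_simps)
  have den: "(x - a)\<^sup>2 + (y - b)\<^sup>2 = r * r" unfolding r(2) u_def v_def by (simp add: power2_commute)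
  have "\<bar>winding_kernel x y x' y' a b\<bar> = \<bar>y' * (x - a) - x' * (y - b)\<bar> / (r * r)"
    unfolding winding_kernel_def den using r by (simp add: abs_divide abs_mult)
  also have "\<dots> \<le> ((\<bar>x'\<bar> + \<bar>y'\<bar>) * r) / (r * r)" using num r by (simp add: divide_right_mono)
  also have "\<dots> = (\<bar>x'\<bar> + \<bar>y'\<bar>) * (1 / r)" using r(1) by (simp add: field_simps)
  also have "\<dots> \<le> (\<bar>x'\<bar> + \<bar>y'\<bar>) * (1 / (sqrt u * sqrt v))"
    using sr uv r(1) by (intro mult_left_mono divide_left_mono) (auto intro!: mult_pos_pos)
  finally show ?thesis by (simp add: u_def v_def)
qed

text \<open>For negative arguments \<open>sqrt u\<close> is \<open>- sqrt (- u)\<close>, so that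
  \<open>2 * sqrt (a - c)\<close> is a primitive on both sides of the singularity.\<close>

lemma nn_integral_inverse_sqrt:
  assumes c: "\<bar>c\<bar> \<le> n"
  shows "(\<integral>\<^sup>+ a. ennreal (indicator {-n..n} a * (1 / sqrt \<bar>a - c\<bar>)) \<partial>lborel) \<le> ennreal (4 * sqrt (2 * n))"
proof -
  define F where "F a = 2 * sqrt (a - c)" for a
  have n: "n \<ge> 0" "-n \<le> c" "c \<le> n" using c by auto
  have "((\<lambda>a. 1 / sqrt \<bar>a - c\<bar>) has_integral (F n - F (-n))) {-n..n}"
  proof (rule fundamental_theorem_of_calculus_interior_strong[of "{c}"])
    fix a assume a: "a \<in> {-n<..<n} - {c}"
    show "(F has_vector_derivative 1 / sqrt \<bar>a - c\<bar>) (at a)"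
    proof (cases "a > c")
      case True
      have "((\<lambda>a. a - c) has_real_derivative 1) (at a)" by (auto intro!: derivative_eq_intros)
      then have "((\<lambda>a. 2 * sqrt (a - c)) has_real_derivative 2 * (inverse (sqrt (a - c)) / 2 * 1)) (at a)"
        using True by (intro DERIV_cmult DERIV_chain2[OF DERIV_real_sqrt]) auto
      then have "((\<lambda>a. 2 * sqrt (a - c)) has_real_derivative 1 / sqrt \<bar>a - c\<bar>) (at a)"
        using True by (simp add: inverse_eq_divide)
      then have "(F has_real_derivative 1 / sqrt \<bar>a - c\<bar>) (at a)"
        by (rule has_field_derivative_transform_within_open[of _ _ _ "{c<..}"]) (use True in \<open>simp_all add: F_def\<close>)
      then show ?thesis by (simp add: has_real_derivative_iff_has_vector_derivative)
    next
      case False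
      then have ac: "a < c" using a by auto
      have "((\<lambda>a. c - a) has_real_derivative - 1) (at a)" by (auto intro!: derivative_eq_intros)
      then have "((\<lambda>a. (-2) * sqrt (c - a)) has_real_derivative (-2) * (inverse (sqrt (c - a)) / 2 * (- 1))) (at a)"
        using ac by (intro DERIV_cmult DERIV_chain2[OF DERIV_real_sqrt]) auto
      then have "((\<lambda>a. - (2 * sqrt (c - a))) has_real_derivative 1 / sqrt \<bar>a - c\<bar>) (at a)"
        using ac by (simp add: inverse_eq_divide)
      then have "(F has_real_derivative 1 / sqrt \<bar>a - c\<bar>) (at a)"
        by (rule has_field_derivative_transform_within_open[of _ _ _ "{..<c}"]) (use ac real_sqrt_minus[of "_ - c"] in \<open>auto simp: F_def\<close>)
      then show ?thesis by (simp add: has_real_derivative_iff_has_vector_derivative)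
    qed
  next
    show "continuous_on {- n..n} F" unfolding F_def by (intro continuous_intros)
  qed (use n in auto)
  from nn_integral_has_integral_lebesgue[OF _ this]
  have "(\<integral>\<^sup>+ a. ennreal (indicator {-n..n} a * (1 / sqrt \<bar>a - c\<bar>)) \<partial>lborel) = ennreal (F n - F (-n))" by simp
  also have "F n - F (-n) \<le> 4 * sqrt (2 * n)"
  proof -
    have "F n \<le> 2 * sqrt (2 * n)" unfolding F_def using n by simp
    moreover have "- F (-n) \<le> 2 * sqrt (2 * n)" unfolding F_def using n real_sqrt_minus[of "n + c"] by simp
    ultimately show ?thesis by simp
  qed
  finally show ?thesis by (simp add: ennreal_leI)
qed

lemma winding_kernel_measurable [measurable]:
  assumes [measurable]: "x \<in> borel_measurable M" "y \<in> borel_measurable M" "x' \<in> borel_measurable M"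
    "y' \<in> borel_measurable M" "a \<in> borel_measurable M" "b \<in> borel_measurable M"
  shows "(\<lambda>p. winding_kernel (x p) (y p) (x' p) (y' p) (a p) (b p)) \<in> borel_measurable M"
  unfolding winding_kernel_def by measurable

lemma kernel_nn_integral_box:
  assumes "\<bar>x\<bar> \<le> m" "\<bar>y\<bar> \<le> n"
  shows "(\<integral>\<^sup>+ p. ennreal (indicator {-m..m} (fst p) * indicator {-n..n} (snd p) * \<bar>winding_kernel x y x' y' (fst p) (snd p)\<bar>) \<partial>(lborel \<Otimes>\<^sub>M lborel))
     \<le> ennreal (\<bar>x'\<bar> + \<bar>y'\<bar>) * ennreal (4 * sqrt (2 * m)) * ennreal (4 * sqrt (2 * n))"
proof -
  let ?f = "\<lambda>a b. indicator {-m..m} a * indicator {-n..n} b * \<bar>winding_kernel x y x' y' a b\<bar>"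
  let ?g = "\<lambda>m c a. indicator {-m..m} a * (1 / sqrt \<bar>a - c\<bar>) :: real"
  have "(\<integral>\<^sup>+ p. ennreal (?f (fst p) (snd p)) \<partial>(lborel \<Otimes>\<^sub>M lborel)) = (\<integral>\<^sup>+ a. \<integral>\<^sup>+ b. ennreal (?f a b) \<partial>lborel \<partial>lborel)"
    by (subst lborel.nn_integral_fst[symmetric]) (auto intro!: measurable_compose[OF _ measurable_ennreal])
  also have "\<dots> \<le> (\<integral>\<^sup>+ a. ennreal (\<bar>x'\<bar> + \<bar>y'\<bar>) * ennreal (?g m x a) * ennreal (4 * sqrt (2 * n)) \<partial>lborel)"
  proof (rule nn_integral_mono_AE)
    have "AE a in lborel. a \<noteq> x" by (rule AE_lborel_singleton)
    then show "AE a in lborel. (\<integral>\<^sup>+ b. ennreal (?f a b) \<partial>lborel) \<le> ennreal (\<bar>x'\<bar> + \<bar>y'\<bar>) * ennreal (?g m x a) * ennreal (4 * sqrt (2 * n))"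
    proof eventually_elim
      case (elim a)
      have "(\<integral>\<^sup>+ b. ennreal (?f a b) \<partial>lborel) \<le> (\<integral>\<^sup>+ b. ennreal ((\<bar>x'\<bar> + \<bar>y'\<bar>) * ?g m x a) * ennreal (?g n y b) \<partial>lborel)"
      proof (rule nn_integral_mono_AE)
        have "AE b in lborel. b \<noteq> y" by (rule AE_lborel_singleton)
        then show "AE b in lborel. ennreal (?f a b) \<le> ennreal ((\<bar>x'\<bar> + \<bar>y'\<bar>) * ?g m x a) * ennreal (?g n y b)"
        proof eventually_elim
          case (elim b)
          have "?f a b \<le> ((\<bar>x'\<bar> + \<bar>y'\<bar>) * ?g m x a) * ?g n y b"
            using winding_kernel_bound[of x a y b x' y'] \<open>a \<noteq> x\<close> \<open>b \<noteq> y\<close> by (auto simp: indicator_def)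
          then show ?case by (subst ennreal_mult[symmetric]) (auto intro!: ennreal_leI mult_nonneg_nonneg)
        qed
      qed
      also have "\<dots> = ennreal ((\<bar>x'\<bar> + \<bar>y'\<bar>) * ?g m x a) * (\<integral>\<^sup>+ b. ennreal (?g n y b) \<partial>lborel)"
        by (rule nn_integral_cmult) (auto intro!: measurable_compose[OF _ measurable_ennreal])
      also have "\<dots> \<le> ennreal ((\<bar>x'\<bar> + \<bar>y'\<bar>) * ?g m x a) * ennreal (4 * sqrt (2 * n))"
        by (intro mult_left_mono nn_integral_inverse_sqrt assms) simp
      also have "ennreal ((\<bar>x'\<bar> + \<bar>y'\<bar>) * ?g m x a) = ennreal (\<bar>x'\<bar> + \<bar>y'\<bar>) * ennreal (?g m x a)"
        by (rule ennreal_mult) (auto intro!: mult_nonneg_nonneg)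
      finally show ?case .
    qed
  qed
  also have "\<dots> = (\<integral>\<^sup>+ a. (ennreal (\<bar>x'\<bar> + \<bar>y'\<bar>) * ennreal (4 * sqrt (2 * n))) * ennreal (?g m x a) \<partial>lborel)"
    by (simp add: mult_ac)
  also have "\<dots> = (ennreal (\<bar>x'\<bar> + \<bar>y'\<bar>) * ennreal (4 * sqrt (2 * n))) * (\<integral>\<^sup>+ a. ennreal (?g m x a) \<partial>lborel)"
    by (rule nn_integral_cmult) (auto intro!: measurable_compose[OF _ measurable_ennreal])
  also have "\<dots> \<le> (ennreal (\<bar>x'\<bar> + \<bar>y'\<bar>) * ennreal (4 * sqrt (2 * n))) * ennreal (4 * sqrt (2 * m))"
    by (intro mult_left_mono nn_integral_inverse_sqrt assms) simp
  finally show ?thesis by (simp add: mult_ac)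
qed

text \<open>The integral of the kernel over \<open>a\<close> in \<open>[-m, m]\<close>, for \<open>y \<noteq> b\<close>.\<close>

definition row_integral :: "real \<Rightarrow> real \<Rightarrow> real \<Rightarrow> real \<Rightarrow> real \<Rightarrow> real \<Rightarrow> real" where
  "row_integral m x y x' y' b = y' * ((ln ((x + m)\<^sup>2 + (y - b)\<^sup>2) - ln ((x - m)\<^sup>2 + (y - b)\<^sup>2)) / 2)
     + x' * (arctan ((x - m) / (y - b)) - arctan ((x + m) / (y - b)))"

lemma kernel_row_integral:
  assumes yb: "y \<noteq> b" and m: "m \<ge> 0"
  shows "(\<integral>a. indicator {-m..m} a * winding_kernel x y x' y' a b \<partial>lborel) = row_integral m x y x' y' b"
proof -
  define F where "F a = - (y' / 2) * ln ((x - a)\<^sup>2 + (y - b)\<^sup>2) + x' * arctan ((x - a) / (y - b))" for a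
  have pos: "(x - a)\<^sup>2 + (y - b)\<^sup>2 > 0" for a using yb by (simp add: add_nonneg_pos)
  have "(\<integral>a. indicator {-m..m} a *\<^sub>R winding_kernel x y x' y' a b \<partial>lborel) = F m - F (-m)"
  proof (rule integral_FTC_Icc)
    fix a
    have "((x - a) / (y - b))\<^sup>2 + 1 = ((x - a)\<^sup>2 + (y - b)\<^sup>2) / (y - b)\<^sup>2" using yb by (simp add: field_simps)
    then have at: "inverse (1 + ((x - a) / (y - b))\<^sup>2) = (y - b)\<^sup>2 / ((x - a)\<^sup>2 + (y - b)\<^sup>2)"
      by (simp add: add.commute)
    have d1: "((\<lambda>a. ln ((x - a)\<^sup>2 + (y - b)\<^sup>2)) has_real_derivative (- 2 * (x - a)) / ((x - a)\<^sup>2 + (y - b)\<^sup>2)) (at a)"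
      using pos[of a] by (auto intro!: derivative_eq_intros simp: divide_simps)
    have d2: "((\<lambda>a. arctan ((x - a) / (y - b))) has_real_derivative - (y - b) / ((x - a)\<^sup>2 + (y - b)\<^sup>2)) (at a)"
    proof -
      have "((\<lambda>a. arctan ((x - a) / (y - b))) has_real_derivative inverse (1 + ((x - a) / (y - b))\<^sup>2) * (- 1 / (y - b))) (at a)"
      proof -
        have s: "s \<noteq> 0 \<Longrightarrow> ((\<lambda>a. (x - a) / s) has_real_derivative - 1 / s) (at a)" for s
          by (auto intro!: derivative_eq_intros simp: divide_simps)
        show ?thesis using DERIV_chain2[OF DERIV_arctan s[of "y - b"]] yb by simp
      qed
      moreover have "inverse (1 + ((x - a) / (y - b))\<^sup>2) * (- 1 / (y - b)) = - (y - b) / ((x - a)\<^sup>2 + (y - b)\<^sup>2)"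
      proof -
        have "s \<noteq> 0 \<Longrightarrow> s\<^sup>2 / d * (- 1 / s) = - s / d" for s d :: real by (simp add: power2_eq_square)
        from this[of "y - b" "(x - a)\<^sup>2 + (y - b)\<^sup>2"] show ?thesis unfolding at using yb by simp
      qed
      ultimately show ?thesis by simp
    qed
    have "(F has_real_derivative - (y' / 2) * ((- 2 * (x - a)) / ((x - a)\<^sup>2 + (y - b)\<^sup>2)) + x' * (- (y - b) / ((x - a)\<^sup>2 + (y - b)\<^sup>2))) (at a)"
      unfolding F_def by (rule DERIV_add[OF DERIV_cmult[OF d1] DERIV_cmult[OF d2]])
    moreover have "- (y' / 2) * ((- 2 * (x - a)) / ((x - a)\<^sup>2 + (y - b)\<^sup>2)) + x' * (- (y - b) / ((x - a)\<^sup>2 + (y - b)\<^sup>2)) = winding_kernel x y x' y' a b"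
    proof -
      have "- (y' / 2) * ((- 2 * u) / d) + x' * (- v / d) = (y' * u - x' * v) / d" for u v d :: real
        by (simp add: diff_divide_distrib)
      then show ?thesis unfolding winding_kernel_def by blast
    qed
    ultimately have "(F has_real_derivative winding_kernel x y x' y' a b) (at a)" by simp
    then show "(F has_vector_derivative winding_kernel x y x' y' a b) (at a within {-m..m})"
      by (simp add: has_real_derivative_iff_has_vector_derivative has_vector_derivative_at_within)
  next
    have "\<forall>a\<in>{-m..m}. (x - a)\<^sup>2 + (y - b)\<^sup>2 \<noteq> 0" using pos by (metis less_irrefl)
    then show "continuous_on {-m..m} (\<lambda>a. winding_kernel x y x' y' a b)"
      unfolding winding_kernel_def by (intro continuous_intros)
  qed (use m in auto)
  then show ?thesis by (simp add: F_def row_integral_def algebra_simps add_divide_distrib diff_divide_distrib)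
qed

text \<open>The logarithmic term decays like \<open>1 / m\<close>; this follows from
  \<open>ln p - ln r \<le> (p - r) / r\<close>.\<close>

lemma row_log_bound:
  assumes x: "\<bar>x\<bar> \<le> C" and m: "m \<ge> 2 * C + 1"
  shows "\<bar>ln ((x + m)\<^sup>2 + s\<^sup>2) - ln ((x - m)\<^sup>2 + s\<^sup>2)\<bar> \<le> 16 * C / (m::real)"
proof -
  have C: "C \<ge> 0" using x by simp
  have m0: "m > 0" using m C by simp
  have low: "(m / 2)\<^sup>2 \<le> z\<^sup>2 + s\<^sup>2" if "\<bar>z\<bar> \<ge> m / 2" for z
  proof -
    have "(m / 2)\<^sup>2 \<le> z\<^sup>2" using that m0 by (metis abs_le_square_iff abs_of_pos half_gt_zero)
    then show ?thesis by (simp add: add_increasing2)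
  qed
  have u: "(m / 2)\<^sup>2 \<le> (x + m)\<^sup>2 + s\<^sup>2" and v: "(m / 2)\<^sup>2 \<le> (x - m)\<^sup>2 + s\<^sup>2"
    using x m C by (auto intro!: low simp: abs_if split: if_splits)
  have m2: "(m / 2)\<^sup>2 > 0" using m0 by simp
  have key: "ln p - ln r \<le> 16 * C / m" if "(m / 2)\<^sup>2 \<le> p" "(m / 2)\<^sup>2 \<le> r" "p - r \<le> 4 * C * m" for p r :: real
  proof -
    have pr: "p > 0" "r > 0" using that m2 by linarith+
    have "ln p - ln r \<le> (p - r) / r" using pr by (intro ln_diff_le) auto
    also have "\<dots> \<le> (4 * C * m) / r" using that pr by (intro divide_right_mono) auto
    also have "\<dots> \<le> (4 * C * m) / (m / 2)\<^sup>2"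
      by (intro divide_left_mono mult_nonneg_nonneg mult_pos_pos) (use that(2) m2 C m0 pr in auto)
    also have "\<dots> = 16 * C / m" using m0 by (simp add: power2_eq_square field_simps)
    finally show ?thesis .
  qed
  have xm: "x * m \<le> C * m" "- (x * m) \<le> C * m" using x m0 by (auto simp: abs_le_iff intro: mult_right_mono) (metis minus_mult_left mult_right_mono less_imp_le abs_le_iff)
  have "((x + m)\<^sup>2 + s\<^sup>2) - ((x - m)\<^sup>2 + s\<^sup>2) = 4 * (x * m)" by (simp add: power2_eq_square algebra_simps)
  then show ?thesis using key[OF u v] key[OF v u] xm by (simp add: abs_le_iff)
qed

lemma row_integral_bound:
  assumes x: "\<bar>x\<bar> \<le> C" and m: "m \<ge> 2 * C + 1"
  shows "\<bar>row_integral m x y x' y' b\<bar> \<le> \<bar>y'\<bar> * (8 * C) + \<bar>x'\<bar> * pi"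
proof -
  have C: "C \<ge> 0" using x by simp
  have "\<bar>ln ((x + m)\<^sup>2 + (y - b)\<^sup>2) - ln ((x - m)\<^sup>2 + (y - b)\<^sup>2)\<bar> \<le> 16 * C / m"
    by (rule row_log_bound[OF assms])
  also have "\<dots> \<le> 16 * C / 1" using m C by (intro divide_left_mono) auto
  finally have 1: "\<bar>(ln ((x + m)\<^sup>2 + (y - b)\<^sup>2) - ln ((x - m)\<^sup>2 + (y - b)\<^sup>2)) / 2\<bar> \<le> 8 * C" by simp
  have 2: "\<bar>arctan u - arctan v\<bar> \<le> pi" for u v
    using arctan_bounded[of u] arctan_bounded[of v] by (simp add: abs_le_iff)
  show ?thesis unfolding row_integral_def
    by (rule order_trans[OF abs_triangle_ineq], unfold abs_mult, intro add_mono mult_left_mono 1 2) auto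
qed

text \<open>Over the whole line, the argument of \<open>z - w\<close> changes by \<open>\<pi>\<close> as \<open>w\<close> runs
  below or above \<open>z\<close>, with opposite signs, while the logarithms at the two ends cancel.\<close>

lemma row_integral_limit:
  assumes yb: "y \<noteq> b"
  shows "(\<lambda>m. row_integral (real m) x y x' y' b) \<longlonglongrightarrow> - pi * sgn (y - b) * x'"
proof -
  have logs: "(\<lambda>m. ln ((x + real m)\<^sup>2 + (y - b)\<^sup>2) - ln ((x - real m)\<^sup>2 + (y - b)\<^sup>2)) \<longlonglongrightarrow> 0"
  proof (rule Lim_null_comparison)
    show "\<forall>\<^sub>F m in sequentially. norm (ln ((x + real m)\<^sup>2 + (y - b)\<^sup>2) - ln ((x - real m)\<^sup>2 + (y - b)\<^sup>2)) \<le> 16 * \<bar>x\<bar> / real m"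
      using eventually_ge_at_top[of "nat \<lceil>2 * \<bar>x\<bar> + 1\<rceil>"]
    proof eventually_elim
      case (elim m)
      then have "real m \<ge> 2 * \<bar>x\<bar> + 1" by linarith
      from row_log_bound[OF order_refl this] show ?case by simp
    qed
    show "(\<lambda>m. 16 * \<bar>x\<bar> / real m) \<longlonglongrightarrow> 0" by (rule lim_const_over_n)
  qed
  have lin: "filterlim (\<lambda>m. c + d * real m) at_top sequentially" if "d > 0" for c d
    using that by (intro filterlim_tendsto_add_at_top[OF tendsto_const] filterlim_tendsto_pos_mult_at_top[OF tendsto_const _ filterlim_real_sequentially])
  have lin': "filterlim (\<lambda>m. c + d * real m) at_bot sequentially" if "d < 0" for c d
    using lin[of "-d" "-c"] that by (simp add: filterlim_uminus_at_bot algebra_simps)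
  have e: "(x - real m) / (y - b) = x / (y - b) + (- 1 / (y - b)) * real m"
          "(x + real m) / (y - b) = x / (y - b) + (1 / (y - b)) * real m" for m
    by (simp_all add: diff_divide_distrib add_divide_distrib)
  have "(\<lambda>m. arctan ((x - real m) / (y - b)) - arctan ((x + real m) / (y - b))) \<longlonglongrightarrow> - pi * sgn (y - b)"
  proof (cases "y > b")
    case True
    have 1: "(\<lambda>m. arctan ((x - real m) / (y - b))) \<longlonglongrightarrow> - (pi / 2)"
      unfolding e by (rule filterlim_compose[OF tendsto_arctan_at_bot lin']) (use True in simp)
    have 2: "(\<lambda>m. arctan ((x + real m) / (y - b))) \<longlonglongrightarrow> pi / 2"
      unfolding e by (rule filterlim_compose[OF tendsto_arctan_at_top lin]) (use True in simp)
    show ?thesis using tendsto_diff[OF 1 2] True by simp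
  next
    case False
    then have yb': "y < b" using yb by simp
    have 1: "(\<lambda>m. arctan ((x - real m) / (y - b))) \<longlonglongrightarrow> pi / 2"
      unfolding e by (rule filterlim_compose[OF tendsto_arctan_at_top lin]) (use yb' in \<open>simp add: divide_simps\<close>)
    have 2: "(\<lambda>m. arctan ((x + real m) / (y - b))) \<longlonglongrightarrow> - (pi / 2)"
      unfolding e by (rule filterlim_compose[OF tendsto_arctan_at_bot lin']) (use yb' in \<open>simp add: divide_simps\<close>)
    show ?thesis using tendsto_diff[OF 1 2] yb' by simp
  qed
  from tendsto_add[OF tendsto_mult[OF tendsto_const[of y'] tendsto_divide[OF logs tendsto_const[of 2]]] tendsto_mult[OF tendsto_const[of x'] this]]
  show ?thesis unfolding row_integral_def by (simp add: mult.commute)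
qed

lemma integral_sgn_box:
  fixes y C :: real assumes "\<bar>y\<bar> \<le> C"
  shows "(\<integral>b. indicator {-C..C} b * sgn (y - b) \<partial>lborel) = 2 * y"
proof -
  have "(\<lambda>b. indicator {-C..C} b * sgn (y - b)) = (\<lambda>b. indicator {-C..<y} b - indicator {y<..C} b :: real)"
    using assms by (auto simp: fun_eq_iff indicator_def sgn_if)
  then have "(\<integral>b. indicator {-C..C} b * sgn (y - b) \<partial>lborel) = (\<integral>b. indicator {-C..<y} b - indicator {y<..C} b \<partial>lborel)" by simp
  also have "\<dots> = (\<integral>b. indicator {-C..<y} b \<partial>lborel) - (\<integral>b. indicator {y<..C} b \<partial>lborel)"
    using assms by (intro Bochner_Integration.integral_diff integrable_real_indicator) auto
  also have "\<dots> = 2 * y" using assms by simp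
  finally show ?thesis .
qed

lemma row_integral_measurable [measurable]:
  assumes [measurable]: "x \<in> borel_measurable M" "y \<in> borel_measurable M" "x' \<in> borel_measurable M"
    "y' \<in> borel_measurable M" "b \<in> borel_measurable M"
  shows "(\<lambda>p. row_integral m (x p) (y p) (x' p) (y' p) (b p)) \<in> borel_measurable M"
  unfolding row_integral_def by measurable

lemma strip_integral_limit:
  fixes x y x' y' C :: real
  assumes x: "\<bar>x\<bar> \<le> C" and y: "\<bar>y\<bar> \<le> C"
  defines "I \<equiv> \<lambda>m. \<integral>b. indicator {-C..C} b * row_integral m x y x' y' b \<partial>lborel"
  shows "(\<lambda>m. I (real m)) \<longlonglongrightarrow> - 2 * pi * x' * y"
    and "m \<ge> 2 * C + 1 \<Longrightarrow> \<bar>I m\<bar> \<le> 2 * C * (\<bar>y'\<bar> * (8 * C) + \<bar>x'\<bar> * pi)"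
proof -
  let ?B = "\<bar>y'\<bar> * (8 * C) + \<bar>x'\<bar> * pi"
  have C: "C \<ge> 0" using x by simp
  have B: "?B \<ge> 0" using C by simp
  define k where "k = nat \<lceil>2 * C + 1\<rceil>"
  have k: "real (m + k) \<ge> 2 * C + 1" for m unfolding k_def by linarith
  have wint: "integrable lborel (\<lambda>b. indicator {-C..C} b * ?B)"
    by (intro integrable_mult_left integrable_real_indicator) (auto simp: emeasure_lborel_Icc_eq)
  have bound: "norm (indicator {-C..C} b * row_integral m x y x' y' b) \<le> indicator {-C..C} b * ?B" if "m \<ge> 2 * C + 1" for m b
    using row_integral_bound[OF x that, of y x' y' b] by (auto simp: indicator_def)
  have "(\<lambda>m. I (real (m + k))) \<longlonglongrightarrow> (\<integral>b. indicator {-C..C} b * (- pi * sgn (y - b) * x') \<partial>lborel)"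
    unfolding I_def
  proof (rule integral_dominated_convergence[OF _ _ wint])
    have "AE b in lborel. b \<noteq> y" by (rule AE_lborel_singleton)
    then show "AE b in lborel. (\<lambda>m. indicator {-C..C} b * row_integral (real (m + k)) x y x' y' b) \<longlonglongrightarrow> indicator {-C..C} b * (- pi * sgn (y - b) * x')"
    proof eventually_elim
      case (elim b)
      then show ?case by (intro tendsto_mult tendsto_const LIMSEQ_ignore_initial_segment[OF row_integral_limit]) simp
    qed
    show "AE b in lborel. norm (indicator {-C..C} b * row_integral (real (m + k)) x y x' y' b) \<le> indicator {-C..C} b * ?B" for m
      using bound[OF k] by blast
  qed measurable
  also have "(\<integral>b. indicator {-C..C} b * (- pi * sgn (y - b) * x') \<partial>lborel) = (\<integral>b. (- pi * x') * (indicator {-C..C} b * sgn (y - b)) \<partial>lborel)"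
    by (simp add: mult_ac)
  also have "\<dots> = - 2 * pi * x' * y" unfolding integral_mult_right_zero integral_sgn_box[OF y] by simp
  finally show "(\<lambda>m. I (real m)) \<longlonglongrightarrow> - 2 * pi * x' * y" by (rule LIMSEQ_offset)
  show "\<bar>I m\<bar> \<le> 2 * C * ?B" if m: "m \<ge> 2 * C + 1"
  proof -
    have "norm (I m) \<le> (\<integral>b. indicator {-C..C} b * ?B \<partial>lborel)"
      unfolding I_def by (rule Bochner_Integration.integral_norm_bound_integral[OF _ wint bound[OF m]])
        (rule Bochner_Integration.integrable_bound[OF wint], measurable, use bound[OF m] B in \<open>auto simp: indicator_def\<close>)
    also have "\<dots> = 2 * C * ?B" using C by simp
    finally show ?thesis by simp
  qed
qed

text \<open>Fubini's theorem over the curve parameter and a strip of half-width \<open>m\<close> that contains the support of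
  \<open>v\<close>. As \<open>m\<close> grows, the integral of the kernel over the strip tends to
  \<open>- 2 \<pi> x' y\<close>, boundedly in the parameter, while the integral of \<open>v\<close> stays the same.\<close>

lemma integral_winding_density:
  fixes x y x' y' :: "real \<Rightarrow> real" and v :: "real \<times> real \<Rightarrow> real"
  assumes cont: "continuous_on UNIV x" "continuous_on UNIV y" "continuous_on UNIV x'" "continuous_on UNIV y'"
    and bx: "\<And>t. t \<in> {0..1} \<Longrightarrow> \<bar>x t\<bar> \<le> C" and by': "\<And>t. t \<in> {0..1} \<Longrightarrow> \<bar>y t\<bar> \<le> C"
    and w: "AE p in lborel. (\<integral>t. indicator {0..1} t * winding_kernel (x t) (y t) (x' t) (y' t) (fst p) (snd p) \<partial>lborel) = 2 * pi * v p"
    and supp: "\<And>p. v p \<noteq> 0 \<Longrightarrow> \<bar>fst p\<bar> \<le> C \<and> \<bar>snd p\<bar> \<le> C"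
    and [measurable]: "v \<in> borel_measurable borel"
  shows "(\<integral>p. v p \<partial>lborel) = - (\<integral>t. indicator {0..1} t * (x' t * y t) \<partial>lborel)"
proof -
  have [measurable]: "x \<in> borel_measurable borel" "y \<in> borel_measurable borel" "x' \<in> borel_measurable borel" "y' \<in> borel_measurable borel"
    using cont by (auto intro: borel_measurable_continuous_onI)
  have [measurable]: "(fst :: real \<times> real \<Rightarrow> real) \<in> borel_measurable borel" "(snd :: real \<times> real \<Rightarrow> real) \<in> borel_measurable borel"
    by (auto intro!: borel_measurable_continuous_onI continuous_intros)
  have C: "C \<ge> 0" using bx[of 0] by simp
  let ?k = "\<lambda>t p. winding_kernel (x t) (y t) (x' t) (y' t) (fst p) (snd p)"
  let ?box = "\<lambda>m p. indicator {-m..m} (fst p) * indicator {-C..C} (snd p) :: real"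
  define K where "K m t p = indicator {0..1} t * (?box m p * ?k t p)" for m t p
  define I where "I m t = (\<integral>b. indicator {-C..C} b * row_integral m (x t) (y t) (x' t) (y' t) b \<partial>lborel)" for m t
  have [measurable]: "(\<lambda>q. K m (fst q) (snd q)) \<in> borel_measurable (lborel \<Otimes>\<^sub>M lborel)" for m
    unfolding K_def by measurable
  have [measurable]: "K m t \<in> borel_measurable lborel" for m t
    unfolding K_def by measurable
  have "compact ((\<lambda>t. \<bar>x' t\<bar> + \<bar>y' t\<bar>) ` {0..1})"
    by (intro compact_continuous_image continuous_intros continuous_on_subset[OF cont(3)] continuous_on_subset[OF cont(4)]) auto
  then obtain D where D: "\<And>t. t \<in> {0..1} \<Longrightarrow> \<bar>x' t\<bar> + \<bar>y' t\<bar> \<le> D"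
    using bounded_imp_bdd_above[OF compact_imp_bounded] unfolding bdd_above_def by fastforce
  have nn: "(\<integral>\<^sup>+ p. ennreal \<bar>K m t p\<bar> \<partial>lborel) \<le> indicator {0..1} t * ennreal (D * (4 * sqrt (2 * m)) * (4 * sqrt (2 * C)))" if m: "m \<ge> C" for m t
  proof (cases "t \<in> {0..1}")
    case True
    have "(\<integral>\<^sup>+ p. ennreal \<bar>K m t p\<bar> \<partial>lborel) = (\<integral>\<^sup>+ p. ennreal (?box m p * \<bar>?k t p\<bar>) \<partial>(lborel \<Otimes>\<^sub>M lborel))"
      unfolding lborel_prod using True by (intro nn_integral_cong) (simp add: K_def abs_mult)
    also have "\<dots> \<le> ennreal (\<bar>x' t\<bar> + \<bar>y' t\<bar>) * ennreal (4 * sqrt (2 * m)) * ennreal (4 * sqrt (2 * C))"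
      by (rule kernel_nn_integral_box) (use bx[OF True] by'[OF True] m in auto)
    also have "\<dots> = ennreal ((\<bar>x' t\<bar> + \<bar>y' t\<bar>) * (4 * sqrt (2 * m)) * (4 * sqrt (2 * C)))"
      using m C by (simp only: ennreal_mult[symmetric] mult_nonneg_nonneg real_sqrt_ge_zero add_nonneg_nonneg abs_ge_zero)
    also have "\<dots> \<le> ennreal (D * (4 * sqrt (2 * m)) * (4 * sqrt (2 * C)))"
      using D[OF True] m C by (intro ennreal_leI mult_right_mono) auto
    finally show ?thesis using True by simp
  qed (simp add: K_def)
  have Kint: "integrable (lborel \<Otimes>\<^sub>M lborel) (\<lambda>q. K m (fst q) (snd q))" if m: "m \<ge> C" for m
  proof (rule integrableI_bounded)
    have "(\<integral>\<^sup>+ q. ennreal (norm (K m (fst q) (snd q))) \<partial>(lborel \<Otimes>\<^sub>M lborel)) = (\<integral>\<^sup>+ t. \<integral>\<^sup>+ p. ennreal \<bar>K m t p\<bar> \<partial>lborel \<partial>lborel)"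
      by (subst lborel.nn_integral_fst[symmetric]) (auto intro!: measurable_compose[OF _ measurable_ennreal])
    also have "\<dots> \<le> (\<integral>\<^sup>+ (t::real). ennreal (D * (4 * sqrt (2 * m)) * (4 * sqrt (2 * C))) * indicator {0..1} t \<partial>lborel)"
      by (intro nn_integral_mono) (use nn[OF m] in \<open>simp add: mult.commute\<close>)
    also have "\<dots> = ennreal (D * (4 * sqrt (2 * m)) * (4 * sqrt (2 * C)))"
      by (subst nn_integral_cmult_indicator) auto
    finally show "(\<integral>\<^sup>+ q. ennreal (norm (K m (fst q) (snd q))) \<partial>(lborel \<Otimes>\<^sub>M lborel)) < \<infinity>"
      by (rule le_less_trans) simp
  qed measurable
  have Kt: "integrable lborel (K m t)" if m: "m \<ge> C" for m t
  proof (rule integrableI_bounded)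
    have "indicator {0..1} t * ennreal (D * (4 * sqrt (2 * m)) * (4 * sqrt (2 * C))) < \<infinity>"
      by (simp add: ennreal_mult_less_top indicator_def)
    then show "(\<integral>\<^sup>+ p. ennreal (norm (K m t p)) \<partial>lborel) < \<infinity>"
      using nn[OF m, of t] by (simp add: le_less_trans)
  qed measurable
  have row: "(\<integral>p. K m t p \<partial>lborel) = indicator {0..1} t * I m t" if m: "m \<ge> C" for m t
  proof -
    have int: "integrable (lborel \<Otimes>\<^sub>M lborel) (case_prod (\<lambda>a b. K m t (a, b)))"
      using Kt[OF m, of t] by (simp add: lborel_prod)
    have "(\<integral>p. K m t p \<partial>lborel) = integral\<^sup>L (lborel \<Otimes>\<^sub>M lborel) (case_prod (\<lambda>a b. K m t (a, b)))"
      by (simp add: lborel_prod)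
    also have "\<dots> = (\<integral>b. \<integral>a. K m t (a, b) \<partial>lborel \<partial>lborel)"
      by (rule lborel_pair.integral_snd[OF int, symmetric])
    also have "\<dots> = (\<integral>b. indicator {0..1} t * (indicator {-C..C} b * row_integral m (x t) (y t) (x' t) (y' t) b) \<partial>lborel)"
    proof (rule integral_cong_AE)
      have "(\<lambda>(b, a). K m t (a, b)) \<in> borel_measurable (lborel \<Otimes>\<^sub>M lborel)" unfolding K_def by measurable
      then show "(\<lambda>b. \<integral>a. K m t (a, b) \<partial>lborel) \<in> borel_measurable lborel"
        by (rule lborel.borel_measurable_lebesgue_integral)
      show "(\<lambda>b. indicator {0..1} t * (indicator {-C..C} b * row_integral m (x t) (y t) (x' t) (y' t) b)) \<in> borel_measurable lborel"
        by measurable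
      have "AE b in lborel. b \<noteq> y t" by (rule AE_lborel_singleton)
      then show "AE b in lborel. (\<integral>a. K m t (a, b) \<partial>lborel) = indicator {0..1} t * (indicator {-C..C} b * row_integral m (x t) (y t) (x' t) (y' t) b)"
      proof eventually_elim
        case (elim b)
        have "(\<integral>a. K m t (a, b) \<partial>lborel) = (\<integral>a. (indicator {0..1} t * indicator {-C..C} b) * (indicator {-m..m} a * winding_kernel (x t) (y t) (x' t) (y' t) a b) \<partial>lborel)"
          by (intro Bochner_Integration.integral_cong) (simp_all add: K_def mult_ac)
        also have "\<dots> = (indicator {0..1} t * indicator {-C..C} b) * row_integral m (x t) (y t) (x' t) (y' t) b"
          unfolding integral_mult_right_zero using kernel_row_integral[of "y t" b m] elim m C by simp
        finally show ?case by simp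
      qed
    qed
    also have "\<dots> = indicator {0..1} t * I m t" unfolding I_def by (rule integral_mult_right_zero)
    finally show ?thesis .
  qed
  have [measurable]: "I m \<in> borel_measurable borel" for m
  proof -
    have "(\<lambda>(t, b). indicator {-C..C} b * row_integral m (x t) (y t) (x' t) (y' t) b) \<in> borel_measurable (borel \<Otimes>\<^sub>M lborel)"
      by measurable
    then show ?thesis unfolding I_def by (rule lborel.borel_measurable_lebesgue_integral)
  qed
  have lhs: "(\<integral>t. indicator {0..1} t * I m t \<partial>lborel) = 2 * pi * (\<integral>p. v p \<partial>lborel)" if m: "m \<ge> C" for m
  proof -
    have "(\<integral>t. indicator {0..1} t * I m t \<partial>lborel) = (\<integral>t. \<integral>p. K m t p \<partial>lborel \<partial>lborel)"
      using row[OF m] by simp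
    also have "\<dots> = (\<integral>p. \<integral>t. K m t p \<partial>lborel \<partial>lborel)"
      by (rule lborel_pair.Fubini_integral[symmetric]) (use Kint[OF m] in \<open>simp add: case_prod_unfold\<close>)
    also have "\<dots> = (\<integral>p. 2 * pi * v p \<partial>lborel)"
    proof (rule integral_cong_AE)
      have "(\<lambda>(p, t). K m t p) \<in> borel_measurable (lborel \<Otimes>\<^sub>M lborel)" unfolding K_def by measurable
      then show "(\<lambda>p. \<integral>t. K m t p \<partial>lborel) \<in> borel_measurable lborel"
        by (rule lborel.borel_measurable_lebesgue_integral)
      show "(\<lambda>p. 2 * pi * v p) \<in> borel_measurable lborel" by measurable
      show "AE p in lborel. (\<integral>t. K m t p \<partial>lborel) = 2 * pi * v p"
        using w
      proof eventually_elim
        case (elim p)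
        have "(\<integral>t. K m t p \<partial>lborel) = (\<integral>t. ?box m p * (indicator {0..1} t * ?k t p) \<partial>lborel)"
          by (intro Bochner_Integration.integral_cong) (simp_all add: K_def mult_ac)
        also have "\<dots> = ?box m p * (2 * pi * v p)" using elim by simp
        also have "\<dots> = 2 * pi * v p"
        proof (cases "v p = 0")
          case False
          then have "\<bar>fst p\<bar> \<le> m" "\<bar>snd p\<bar> \<le> C" using supp[of p] m by auto
          then have "fst p \<in> {-m..m}" "snd p \<in> {-C..C}" by auto
          then show ?thesis by simp
        qed simp
        finally show ?case .
      qed
    qed
    finally show ?thesis by simp
  qed
  \<comment> \<open>The bounds on the row integrals hold from half-width \<open>2 C + 1\<close> on.\<close>
  define k where "k = nat \<lceil>2 * C + 1\<rceil>"
  have k: "real (m + k) \<ge> 2 * C + 1" "real (m + k) \<ge> C" for m unfolding k_def using C by linarith+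
  \<comment> \<open>The uniform bound of \<open>strip_integral_limit\<close> with both speeds replaced by \<open>D\<close>.\<close>
  let ?Q = "2 * C * (D * (8 * C) + D * pi)"
  have "(\<lambda>m. \<integral>t. indicator {0..1} t * I (real (m + k)) t \<partial>lborel) \<longlonglongrightarrow> (\<integral>t. indicator {0..1} t * (- 2 * pi * x' t * y t) \<partial>lborel)"
  proof (rule integral_dominated_convergence[where w = "\<lambda>t. indicator {0..1} t * ?Q"])
    show "integrable lborel (\<lambda>t::real. indicator {0..1} t * ?Q)"
      by (intro integrable_mult_left integrable_real_indicator) auto
    show "AE t in lborel. (\<lambda>m. indicator {0..1} t * I (real (m + k)) t) \<longlonglongrightarrow> indicator {0..1} t * (- 2 * pi * x' t * y t)"
    proof (rule AE_I2)
      fix t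
      show "(\<lambda>m. indicator {0..1} t * I (real (m + k)) t) \<longlonglongrightarrow> indicator {0..1} t * (- 2 * pi * x' t * y t)"
      proof (cases "t \<in> {0..1}")
        case True
        from LIMSEQ_ignore_initial_segment[OF strip_integral_limit(1)[OF bx[OF True] by'[OF True]]]
        show ?thesis unfolding I_def using True by simp
      qed simp
    qed
    show "AE t in lborel. norm (indicator {0..1} t * I (real (m + k)) t) \<le> indicator {0..1} t * ?Q" for m
    proof (rule AE_I2)
      fix t
      show "norm (indicator {0..1} t * I (real (m + k)) t) \<le> indicator {0..1} t * ?Q"
      proof (cases "t \<in> {0..1}")
        case True
        have "\<bar>I (real (m + k)) t\<bar> \<le> 2 * C * (\<bar>y' t\<bar> * (8 * C) + \<bar>x' t\<bar> * pi)"
          unfolding I_def by (rule strip_integral_limit(2)[OF bx[OF True] by'[OF True] k(1)])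
        also have "\<dots> \<le> ?Q"
          using D[OF True] C by (intro mult_left_mono add_mono mult_right_mono) auto
        finally show ?thesis using True by simp
      qed simp
    qed
  qed measurable
  then have "(\<lambda>m::nat. 2 * pi * (\<integral>p. v p \<partial>lborel)) \<longlonglongrightarrow> (\<integral>t. indicator {0..1} t * (- 2 * pi * x' t * y t) \<partial>lborel)"
    using lhs[OF k(2)] by simp
  then have "2 * pi * (\<integral>p. v p \<partial>lborel) = (\<integral>t. indicator {0..1} t * (- 2 * pi * x' t * y t) \<partial>lborel)"
    using LIMSEQ_unique tendsto_const by blast
  also have "\<dots> = (\<integral>t. (- 2 * pi) * (indicator {0..1} t * (x' t * y t)) \<partial>lborel)"
    by (simp add: mult_ac)
  also have "\<dots> = (- 2 * pi) * (\<integral>t. indicator {0..1} t * (x' t * y t) \<partial>lborel)"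
    by (rule integral_mult_right_zero)
  finally have "pi * ((\<integral>p. v p \<partial>lborel) + (\<integral>t. indicator {0..1} t * (x' t * y t) \<partial>lborel)) = 0"
    by (simp add: distrib_left)
  then show ?thesis by (simp add: eq_neg_iff_add_eq_0)
qed

lemma continuous_lebesgue_integral_Icc:
  fixes f :: "real \<Rightarrow> real"
  assumes "continuous_on {a..b} f"
  shows "(\<integral>t. indicator {a..b} t * f t \<partial>lborel) = integral {a..b} f"
proof -
  have "set_integrable lborel {a..b} f" by (rule borel_integrable_atLeastAtMost'[OF assms])
  from set_borel_integral_eq_integral(2)[OF this] show ?thesis by (simp add: set_lebesgue_integral_def)
qed

lemma winding_number_kernel_integral:
  fixes g g' :: "real \<Rightarrow> complex"
  assumes d: "\<And>t. (g has_vector_derivative g' t) (at t)" and c: "continuous_on UNIV g'"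
    and p: "Complex a b \<notin> path_image g"
  shows "(\<integral>t. indicator {0..1} t * winding_kernel (Re (g t)) (Im (g t)) (Re (g' t)) (Im (g' t)) a b \<partial>lborel)
     = 2 * pi * Re (winding_number g (Complex a b))"
proof -
  let ?w = "Complex a b"
  have contg: "continuous_on UNIV g"
    using d by (meson continuous_at_imp_continuous_on has_vector_derivative_continuous)
  have vp: "valid_path g"
    unfolding valid_path_def
    by (rule C1_differentiable_imp_piecewise)
       (use d continuous_on_subset[OF c] in \<open>auto simp: C1_differentiable_on_def\<close>)
  have vd: "vector_derivative g (at t) = g' t" for t by (rule vector_derivative_at[OF d])
  have cont: "continuous_on {0..1} (\<lambda>t. g' t / (g t - ?w))"
  proof -
    have "\<forall>t\<in>{0..1}. g t - ?w \<noteq> 0" using p unfolding path_image_def by (metis imageI right_minus_eq)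
    then show ?thesis by (intro continuous_intros continuous_on_subset[OF c] continuous_on_subset[OF contg]) auto
  qed
  have k: "Im (g' t / (g t - ?w)) = winding_kernel (Re (g t)) (Im (g t)) (Re (g' t)) (Im (g' t)) a b" for t
    using Im_kernel[of "Re (g' t)" "Im (g' t)" "Re (g t)" "Im (g t)" a b] by (simp only: complex_surj)
  have contk: "continuous_on {0..1} (\<lambda>t. winding_kernel (Re (g t)) (Im (g t)) (Re (g' t)) (Im (g' t)) a b)"
    using continuous_on_Im[OF cont] unfolding k .
  have "winding_number g ?w = 1 / (2 * pi * \<i>) * integral {0..1} (\<lambda>t. g' t / (g t - ?w))"
    unfolding winding_number_valid_path[OF vp p] contour_integral_integral vd by (simp add: field_simps)
  then have "integral {0..1} (\<lambda>t. g' t / (g t - ?w)) = (2 * pi * \<i>) * winding_number g ?w" by simp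
  then have "Im (integral {0..1} (\<lambda>t. g' t / (g t - ?w))) = 2 * pi * Re (winding_number g ?w)" by simp
  moreover have "Im (integral {0..1} (\<lambda>t. g' t / (g t - ?w))) = integral {0..1} (\<lambda>t. Im (g' t / (g t - ?w)))"
    using integral_linear[OF integrable_continuous_real[OF cont] bounded_linear_Im] by (simp add: o_def)
  ultimately show ?thesis unfolding k continuous_lebesgue_integral_Icc[OF contk] by simp
qed

text \<open>The winding number of a simple closed curve is a constant \<open>\<plusminus>1\<close> inside and \<open>0\<close>
  outside, and the curve itself is a null set because it is the differentiable image of an interval. So the
  integral of the winding number is the area up to sign.\<close>

lemma jordan_curve_area:
  fixes g g' :: "real \<Rightarrow> complex"
  assumes d: "\<And>t. (g has_vector_derivative g' t) (at t)" and c: "continuous_on UNIV g'"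
    and sp: "simple_path g" and loop: "pathfinish g = pathstart g"
  shows "measure lborel {p. Complex (fst p) (snd p) \<in> inside (path_image g)}
      = \<bar>integral {0..1} (\<lambda>t. Re (g' t) * Im (g t))\<bar>"
proof -
  have contg: "continuous_on UNIV g"
    using d by (meson continuous_at_imp_continuous_on has_vector_derivative_continuous)
  have path: "path g" using sp by (rule simple_path_imp_path)
  obtain e :: real where e: "\<bar>e\<bar> = 1" and we: "\<And>z. z \<in> inside (path_image g) \<Longrightarrow> winding_number g z = of_real e"
  proof (rule simple_closed_path_winding_number_inside[OF sp])
    assume "\<And>z. z \<in> inside (path_image g) \<Longrightarrow> winding_number g z = 1" then show ?thesis using that[of 1] by simp
  next
    assume "\<And>z. z \<in> inside (path_image g) \<Longrightarrow> winding_number g z = -1" then show ?thesis using that[of "-1"] by simp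
  qed
  have "bounded (path_image g)" using compact_path_image[OF path] by (rule compact_imp_bounded)
  then obtain C where "\<forall>z\<in>path_image g. norm z \<le> C" unfolding bounded_iff by blast
  then have C: "path_image g \<subseteq> cball 0 C" by auto
  have ins: "inside (path_image g) \<subseteq> cball 0 C" 
    using outside_subset_convex[OF convex_cball C] inside_Int_outside[of "path_image g"] by blast
  define E where "E = {p :: real \<times> real. Complex (fst p) (snd p) \<in> inside (path_image g)}"
  have cm: "continuous_on UNIV (\<lambda>p :: real \<times> real. Complex (fst p) (snd p))"
    unfolding Complex_eq by (intro continuous_intros)
  have "open (inside (path_image g))" using Jordan_inside_outside[OF sp loop] by blast
  then have "open E"
    using open_vimage[OF _ cm] unfolding E_def vimage_def by blast
  then have Em [measurable]: "E \<in> sets borel" by simp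
  define v where "v p = e * indicator E p" for p
  have "negligible ((\<lambda>t. (Re (g t), Im (g t))) ` {0..1::real})"
  proof (rule negligible_differentiable_image_lowdim)
    have "(\<lambda>t. (Re (g t), Im (g t))) differentiable (at t)" for t
    proof -
      have "(g has_derivative (\<lambda>h. h *\<^sub>R g' t)) (at t)" using d[of t] by (simp add: has_vector_derivative_def)
      from has_derivative_Pair[OF bounded_linear.has_derivative[OF bounded_linear_Re this] bounded_linear.has_derivative[OF bounded_linear_Im this]]
      show ?thesis by (rule differentiableI)
    qed
    then show "(\<lambda>t. (Re (g t), Im (g t))) differentiable_on {0..1::real}"
      by (simp add: differentiable_at_imp_differentiable_on)
  qed simp
  then have "(\<lambda>t. (Re (g t), Im (g t))) ` {0..1::real} \<in> null_sets lebesgue" by (simp add: negligible_iff_null_sets)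
  then have "AE p in lebesgue. p \<notin> (\<lambda>t. (Re (g t), Im (g t))) ` {0..1::real}" by (rule AE_not_in)
  then have ae: "AE p in lborel. p \<notin> (\<lambda>t. (Re (g t), Im (g t))) ` {0..1::real}" by (simp add: AE_completion_iff)
  have Cb: "\<bar>Re z\<bar> \<le> C" "\<bar>Im z\<bar> \<le> C" if "z \<in> cball 0 C" for z
    using that abs_Re_le_cmod[of z] abs_Im_le_cmod[of z] by auto
  have gC: "g t \<in> cball 0 C" if "t \<in> {0..1}" for t using C that unfolding path_image_def by blast
  have "(\<integral>p. v p \<partial>lborel) = - (\<integral>t. indicator {0..1} t * (Re (g' t) * Im (g t)) \<partial>lborel)"
  proof (rule integral_winding_density[where C = C and x = "\<lambda>t. Re (g t)" and y' = "\<lambda>t. Im (g' t)"])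
    show "AE p in lborel. (\<integral>t. indicator {0..1} t * winding_kernel (Re (g t)) (Im (g t)) (Re (g' t)) (Im (g' t)) (fst p) (snd p) \<partial>lborel) = 2 * pi * v p"
      using ae
    proof eventually_elim
      case (elim p)
      let ?w = "Complex (fst p) (snd p)"
      have np: "?w \<notin> path_image g"
      proof
        assume "?w \<in> path_image g"
        then obtain t where "t \<in> {0..1}" "?w = g t" by (auto simp: path_image_def)
        then have "p = (Re (g t), Im (g t))" by (metis complex.sel prod.collapse)
        then show False using elim \<open>t \<in> {0..1}\<close> by blast
      qed
      have "Re (winding_number g ?w) = v p"
      proof (cases "p \<in> E")
        case True then show ?thesis using we[of ?w] by (simp add: v_def E_def)
      next
        case False
        then have "?w \<in> outside (path_image g)" using np by (simp add: outside_inside E_def)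
        then show ?thesis using winding_number_zero_in_outside[OF path loop] False by (simp add: v_def)
      qed
      then show ?case using winding_number_kernel_integral[OF d c np] by simp
    qed
    show "\<bar>fst p\<bar> \<le> C \<and> \<bar>snd p\<bar> \<le> C" if "v p \<noteq> 0" for p
    proof -
      have "Complex (fst p) (snd p) \<in> cball 0 C" using that ins by (auto simp: v_def E_def indicator_def split: if_splits)
      from Cb[OF this] show ?thesis by simp
    qed
    show "\<bar>Re (g t)\<bar> \<le> C" "\<bar>Im (g t)\<bar> \<le> C" if "t \<in> {0..1}" for t using Cb[OF gC[OF that]] by auto
    show "v \<in> borel_measurable borel" unfolding v_def by measurable
  qed (intro continuous_intros contg c)+
  also have "(\<integral>t. indicator {0..1} t * (Re (g' t) * Im (g t)) \<partial>lborel) = integral {0..1} (\<lambda>t. Re (g' t) * Im (g t))"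
    by (intro continuous_lebesgue_integral_Icc continuous_intros continuous_on_subset[OF c] continuous_on_subset[OF contg]) auto
  also have "(\<integral>p. v p \<partial>lborel) = e * measure lborel E" unfolding v_def by simp
  finally have "\<bar>e\<bar> * \<bar>measure lborel E\<bar> = \<bar>integral {0..1} (\<lambda>t. Re (g' t) * Im (g t))\<bar>"
    by (metis abs_mult abs_minus_cancel)
  then show ?thesis unfolding E_def[symmetric] using e by simp
qed

section \<open>Coordinates on the plane R\<close>

text \<open>This makes Fubini's theorem available for vectors.\<close>

lemma lborel_vec2: "lborel = distr lborel borel (\<lambda>p :: real \<times> real. vector [fst p, snd p] :: real^2)"
proof (rule lborel_eqI)
  let ?v = "\<lambda>p :: real \<times> real. vector [fst p, snd p] :: real^2"
  have veq: "?v p = fst p *\<^sub>R axis 1 1 + snd p *\<^sub>R axis 2 1" for p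
    by (simp add: vec_eq_iff forall_2 axis_def)
  have [measurable]: "?v \<in> borel \<rightarrow>\<^sub>M borel"
    unfolding veq by (intro borel_measurable_continuous_onI continuous_intros)
  fix l u :: "real^2" assume lu: "\<And>b. b \<in> Basis \<Longrightarrow> l \<bullet> b \<le> u \<bullet> b"
  have lu': "l $ i \<le> u $ i" for i using lu[of "axis i 1"] by (auto simp: Basis_vec_def inner_axis)
  have "?v -` box l u = box (l $ 1, l $ 2) (u $ 1, u $ 2)"
  proof (rule set_eqI)
    fix p :: "real \<times> real"
    have "p \<in> ?v -` box l u \<longleftrightarrow> (l $ 1 < fst p \<and> fst p < u $ 1) \<and> (l $ 2 < snd p \<and> snd p < u $ 2)"
      by (simp add: mem_box_cart forall_2)
    also have "\<dots> \<longleftrightarrow> p \<in> box (l $ 1, l $ 2) (u $ 1, u $ 2)"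
      by (cases p) (auto simp: box_def Basis_prod_def)
    finally show "p \<in> ?v -` box l u \<longleftrightarrow> p \<in> box (l $ 1, l $ 2) (u $ 1, u $ 2)" .
  qed
  then have "emeasure (distr lborel borel ?v) (box l u) = emeasure lborel (box (l $ 1, l $ 2) (u $ 1, u $ 2))"
    by (simp add: emeasure_distr)
  also have "\<dots> = ennreal ((u $ 1 - l $ 1) * (u $ 2 - l $ 2))"
    using lu' by (subst emeasure_lborel_box) (auto simp: Basis_prod_def prod.union_disjoint)
  also have "(u $ 1 - l $ 1) * (u $ 2 - l $ 2) = (\<Prod>b\<in>Basis. (u - l) \<bullet> b)"
  proof -
    have B: "Basis = range (\<lambda>i. axis i 1 :: real^2)" by (auto simp: Basis_vec_def)
    have "(\<Prod>b\<in>Basis. (u - l) \<bullet> b) = (\<Prod>i\<in>UNIV. (u - l) \<bullet> axis i 1)"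
      unfolding B by (subst prod.reindex) (auto simp: inj_on_def axis_eq_axis)
    then show ?thesis by (simp add: UNIV_2 inner_axis)
  qed
  finally show "emeasure (distr lborel borel ?v) (box l u) = ennreal (\<Prod>b\<in>Basis. (u - l) \<bullet> b)" .
qed simp

lemma measure_vec2:
  assumes "S \<in> sets (borel :: (real^2) measure)"
  shows "measure lborel {p :: real \<times> real. vector [fst p, snd p] \<in> S} = measure lborel S"
proof -
  have veq: "vector [fst p, snd p] = fst p *\<^sub>R axis 1 1 + snd p *\<^sub>R (axis 2 1 :: real^2)" for p :: "real \<times> real"
    by (simp add: vec_eq_iff forall_2 axis_def)
  have [measurable]: "(\<lambda>p :: real \<times> real. vector [fst p, snd p] :: real^2) \<in> borel \<rightarrow>\<^sub>M borel"
    unfolding veq by (intro borel_measurable_continuous_onI continuous_intros)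
  have "measure lborel S = measure (distr lborel borel (\<lambda>p :: real \<times> real. vector [fst p, snd p] :: real^2)) S"
    by (subst lborel_vec2) (rule refl)
  also have "\<dots> = measure lborel {p :: real \<times> real. vector [fst p, snd p] \<in> S}"
    using assms by (subst measure_distr) (auto simp: vimage_def)
  finally show ?thesis by simp
qed

lemma plane_point_component [simp]:
  "plane_point u $ 1 = u $ 1" "plane_point u $ 2 = u $ 2" "plane_point u $ 3 = 0"
  by (simp_all add: plane_point_def)

lemma plane_R_iff: "p \<in> plane_R \<longleftrightarrow> p $ 3 = 0"
proof
  assume "p $ 3 = 0"
  then have "p = plane_point (vector [p $ 1, p $ 2])" by (simp add: vec_eq_iff forall_3)
  then show "p \<in> plane_R" unfolding plane_R_def by blast
qed (auto simp: plane_R_def)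

lemma plane_point_has_derivative: "(plane_point has_derivative plane_point) (at u within S)"
proof -
  have eq: "plane_point = (\<lambda>u. u $ 1 *\<^sub>R axis 1 1 + u $ 2 *\<^sub>R axis 2 1)"
    by (auto simp: fun_eq_iff vec_eq_iff forall_3 axis_def)
  have "bounded_linear plane_point"
    unfolding eq by (intro bounded_linear_add bounded_linear_scaleR_const bounded_linear_vec_nth)
  then show ?thesis by (rule bounded_linear.has_derivative) (rule has_derivative_ident)
qed

lemma plane_area_measure:
  assumes "open {u. plane_point u \<in> D}" "bounded {u. plane_point u \<in> D}"
  shows "plane_area D = measure lborel {u. plane_point u \<in> D}"
proof -
  have pd: "partial_within UNIV plane_point i u = plane_point (axis i 1)" for i u
    unfolding partial_within_def using frechet_derivative_at[OF plane_point_has_derivative[of u UNIV]] by simp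
  have "sqrt (det (first_form UNIV plane_point u)) = 1" for u
    by (simp add: det_2 first_form_def pd sol_inner_expand axis_def)
  then have "plane_area D = integral {u. plane_point u \<in> D} (\<lambda>u. 1)" by (simp add: plane_area_def)
  also have "\<dots> = measure lborel {u. plane_point u \<in> D}"
  proof -
    have "{u. plane_point u \<in> D} \<in> lmeasurable" using assms by (rule lmeasurable_open[rotated])
    then have "integral {u. plane_point u \<in> D} (\<lambda>u. 1::real) = measure lebesgue {u. plane_point u \<in> D}"
      by (simp add: lmeasure_integral)
    then show ?thesis using assms(1) by (simp add: measure_completion)
  qed
  finally show ?thesis .
qed

lemma parametrises_closed_curve_derivative:
  assumes "parametrises_closed_curve \<gamma> \<Gamma>"
  shows "(\<gamma> has_vector_derivative vector_derivative \<gamma> (at t)) (at t)"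
    and "continuous_on UNIV (\<lambda>t. vector_derivative \<gamma> (at t))"
proof -
  have sm: "smooth_on UNIV \<gamma>" using assms by (simp add: parametrises_closed_curve_def)
  show 1: "(\<gamma> has_vector_derivative vector_derivative \<gamma> (at t)) (at t)" for t
    using smooth_on_differentiable[OF sm, of t] by (simp add: vector_derivative_works)
  show "continuous_on UNIV (\<lambda>t. vector_derivative \<gamma> (at t))"
    unfolding continuous_on_eq_continuous_within
  proof
    fix t :: real
    obtain V g where V: "open V" "t \<in> V" "\<And>k. Ck_on k V g"
       and d: "\<And>s. s \<in> UNIV \<inter> V \<Longrightarrow> (\<gamma> has_derivative frechet_derivative g (at s)) (at s within UNIV)"
      by (rule smooth_on_local_extension[OF sm, of t]) auto
    have "Ck_on (Suc 0) V g" by (rule V(3))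
    then have c: "continuous_on V (\<lambda>s. frechet_derivative g (at s) 1)" by simp
    have eq: "vector_derivative \<gamma> (at s) = frechet_derivative g (at s) 1" if "s \<in> V" for s
    proof -
      have "(\<gamma> has_derivative (\<lambda>h. h *\<^sub>R vector_derivative \<gamma> (at s))) (at s)"
        using 1[of s] by (simp add: has_vector_derivative_def)
      from has_derivative_unique[OF this d[of s]] that
      have "(\<lambda>h. h *\<^sub>R vector_derivative \<gamma> (at s)) = frechet_derivative g (at s)" by simp
      from fun_cong[OF this, of 1] show ?thesis by simp
    qed
    have "continuous_on V (\<lambda>s. vector_derivative \<gamma> (at s))" using c eq by (simp cong: continuous_on_cong)
    then have "isCont (\<lambda>s. vector_derivative \<gamma> (at s)) t" using V(1,2) by (simp add: continuous_on_eq_continuous_at)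
    then show "continuous (at t within UNIV) (\<lambda>t. vector_derivative \<gamma> (at t))" by simp
  qed
qed

lemma closed_curve_frac:
  fixes \<gamma> :: "real \<Rightarrow> 'a"
  assumes per: "\<And>t. \<gamma> (t + 1) = \<gamma> t"
  shows "\<gamma> t = \<gamma> (frac t)"
proof -
  have pern: "\<gamma> (s + real n) = \<gamma> s" for s n
  proof (induction n)
    case (Suc n) then show ?case using per[of "s + real n"] by (simp add: algebra_simps)
  qed simp
  have "\<gamma> (s + of_int k) = \<gamma> s" for s k
  proof (cases "k \<ge> 0")
    case True then show ?thesis using pern[of s "nat k"] by simp
  next
    case False then show ?thesis using pern[of "s + of_int k" "nat (- k)"] by simp
  qed
  from this[of "frac t" "\<lfloor>t\<rfloor>"] show ?thesis by (simp add: frac_def)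
qed

text \<open>Projecting \<open>R\<close> to the complex plane, \<open>D\<close> becomes a bounded component of the complement of
  a Jordan curve. It therefore lies inside the curve, and it is open, so its area is positive.\<close>

lemma bounded_domain_area:
  assumes par: "parametrises_closed_curve \<gamma> \<Gamma>" and GR: "\<Gamma> \<subseteq> plane_R" and D: "bounded_domain_of \<Gamma> D"
  defines "\<gamma>' \<equiv> \<lambda>t. vector_derivative \<gamma> (at t)"
  shows "plane_area D > 0" "plane_area D \<le> \<bar>integral {0..1} (\<lambda>t. \<gamma>' t $ 1 * \<gamma> t $ 2)\<bar>"
proof -
  define g where "g t = Complex (\<gamma> t $ 1) (\<gamma> t $ 2)" for t
  define g' where "g' t = Complex (\<gamma>' t $ 1) (\<gamma>' t $ 2)" for t
  have gd: "(\<gamma> has_vector_derivative \<gamma>' t) (at t)" and gc: "continuous_on UNIV \<gamma>'" for t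
    using parametrises_closed_curve_derivative[OF par] by (auto simp: \<gamma>'_def)
  have per: "\<gamma> (t + 1) = \<gamma> t" and inj: "inj_on \<gamma> {0..<1}" and ran: "range \<gamma> = \<Gamma>" for t
    using par by (auto simp: parametrises_closed_curve_def)
  have d: "(g has_vector_derivative g' t) (at t)" for t
  proof -
    have comp: "((\<lambda>t. \<gamma> t $ i) has_real_derivative \<gamma>' t $ i) (at t)" for i
      using bounded_linear.has_vector_derivative[OF bounded_linear_vec_nth gd]
      by (simp add: has_real_derivative_iff_has_vector_derivative)
    have "((\<lambda>t. of_real (\<gamma> t $ 1) + \<i> * of_real (\<gamma> t $ 2)) has_vector_derivative of_real (\<gamma>' t $ 1) + \<i> * of_real (\<gamma>' t $ 2)) (at t)"
      by (intro has_vector_derivative_add has_vector_derivative_mult_right has_vector_derivative_of_real comp)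
    moreover have "g = (\<lambda>t. of_real (\<gamma> t $ 1) + \<i> * of_real (\<gamma> t $ 2))" by (simp add: fun_eq_iff g_def Complex_eq)
    ultimately show ?thesis by (simp add: g'_def Complex_eq)
  qed
  have c: "continuous_on UNIV g'" unfolding g'_def Complex_eq by (intro continuous_intros gc)
  have contg: "continuous_on UNIV g"
    using d by (meson continuous_at_imp_continuous_on has_vector_derivative_continuous)
  have g_eq: "g s = g t \<longleftrightarrow> \<gamma> s = \<gamma> t" for s t
  proof -
    have "\<gamma> s $ 3 = 0" "\<gamma> t $ 3 = 0" using GR ran plane_R_iff by blast+
    then show ?thesis by (auto simp: g_def vec_eq_iff forall_3)
  qed
  have loop: "pathfinish g = pathstart g" using per[of 0] by (simp add: pathfinish_def pathstart_def g_def)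
  have sp: "simple_path g"
    unfolding simple_path_def loop_free_def
  proof (intro conjI ballI impI)
    show "path g" using contg continuous_on_subset by (auto simp: path_def)
    fix s t :: real assume st: "s \<in> {0..1}" "t \<in> {0..1}" "g s = g t"
    have 01: "\<gamma> 1 = \<gamma> 0" using per[of 0] by simp
    \<comment> \<open>The parameter \<open>1\<close> is moved to \<open>0\<close>, where injectivity on the half-open interval applies.\<close>
    define r where "r u = (if u = 1 then 0 else u)" for u :: real
    have "\<gamma> (r u) = \<gamma> u" for u using 01 by (simp add: r_def)
    then have "\<gamma> (r s) = \<gamma> (r t)" using st(3) by (simp add: g_eq)
    moreover have "r s \<in> {0..<1}" "r t \<in> {0..<1}" using st by (auto simp: r_def)
    ultimately have "r s = r t" using inj by (simp add: inj_on_def)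
    then show "s = t \<or> s = 0 \<and> t = 1 \<or> s = 1 \<and> t = 0" by (auto simp: r_def split: if_splits)
  qed
  have im: "path_image g = range g"
  proof
    show "range g \<subseteq> path_image g"
    proof clarify
      fix t :: real
      have "\<gamma> t = \<gamma> (frac t)" by (rule closed_curve_frac[of \<gamma>, OF per])
      then have "g t = g (frac t)" by (simp add: g_def)
      moreover have "frac t \<in> {0..1}" by (simp add: frac_ge_0 frac_lt_1 less_imp_le)
      ultimately show "g t \<in> path_image g" unfolding path_image_def by blast
    qed
  qed (auto simp: path_image_def)
  let ?p = "\<lambda>z. plane_point (vector [Re z, Im z])"
  have peq: "?p z = Re z *\<^sub>R axis 1 1 + Im z *\<^sub>R axis 2 1" for z
    by (simp add: vec_eq_iff forall_3 axis_def)
  have pc: "continuous_on S ?p" for S unfolding peq by (intro continuous_intros)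
  let ?D = "{z. ?p z \<in> D}"
  have Dc: "D \<in> components (plane_R - \<Gamma>)" and Db: "bounded D" using D by (auto simp: bounded_domain_of_def)
  have G: "?p z \<in> \<Gamma> \<longleftrightarrow> z \<in> path_image g" for z
  proof -
    have "?p z = \<gamma> t \<longleftrightarrow> z = g t" for t
    proof -
      have "\<gamma> t $ 3 = 0" using GR ran plane_R_iff by blast
      then show ?thesis by (auto simp: g_def vec_eq_iff forall_3 complex_eq_iff)
    qed
    then show ?thesis unfolding im ran[symmetric] by (auto simp: image_def)
  qed
  have Dsub: "D \<subseteq> plane_R - \<Gamma>" and Dcon: "connected D" and Dne: "D \<noteq> {}"
    using Dc in_components_subset in_components_connected in_components_nonempty by blast+
  have Dmax: "T \<subseteq> D" if "connected T" "T \<subseteq> plane_R - \<Gamma>" "T \<inter> D \<noteq> {}" for T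
    using components_maximal[OF Dc] that by blast
  define q where "q p = Complex (p $ 1) (p $ 2)" for p :: "real^3"
  have qc: "continuous_on S q" for S unfolding q_def Complex_eq by (intro continuous_intros)
  have pq: "?p (q p) = p" if "p \<in> plane_R" for p
    using that by (simp add: q_def plane_R_iff vec_eq_iff forall_3)
  have qp: "q (?p z) = z" for z by (simp add: q_def complex_eq_iff)
  have Dimg: "?D = q ` D"
  proof
    show "?D \<subseteq> q ` D" using qp by (metis (no_types, lifting) imageI mem_Collect_eq subsetI)
    show "q ` D \<subseteq> ?D" using pq Dsub by auto
  qed
  have con: "connected ?D" unfolding Dimg by (rule connected_continuous_image[OF qc Dcon])
  obtain z0 where z0: "z0 \<in> ?D" using Dne Dimg by blast
  have Dcomp: "?D = connected_component_set (- path_image g) z0"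
  proof
    have "?D \<subseteq> - path_image g" using G Dsub by blast
    then show "?D \<subseteq> connected_component_set (- path_image g) z0"
      by (rule connected_component_maximal[OF z0 con])
    let ?T = "connected_component_set (- path_image g) z0"
    have "connected (?p ` ?T)" by (rule connected_continuous_image[OF pc connected_connected_component])
    moreover have "?p ` ?T \<subseteq> plane_R - \<Gamma>"
      using G connected_component_subset[of "- path_image g" z0] by (auto simp: plane_R_iff)
    moreover have "?p z0 \<in> ?p ` ?T \<inter> D"
    proof -
      have "z0 \<notin> path_image g" using z0 G Dsub by blast
      then show ?thesis using z0 by (auto simp: connected_component_refl)
    qed
    ultimately have "?p ` ?T \<subseteq> D" using Dmax by blast
    then show "?T \<subseteq> ?D" by auto
  qed
  have cpg: "compact (path_image g)" using sp by (simp add: compact_simple_path_image)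
  have Dopen: "open ?D" unfolding Dcomp
    by (rule open_connected_component) (simp add: compact_imp_closed[OF cpg] open_Compl)
  have Dbd: "bounded ?D"
  proof -
    obtain B where B: "\<And>p. p \<in> D \<Longrightarrow> norm p \<le> B" using Db by (auto simp: bounded_iff)
    have "norm (q p) \<le> B + B" if "p \<in> D" for p
    proof -
      have "norm (q p) \<le> \<bar>p $ 1\<bar> + \<bar>p $ 2\<bar>" using cmod_le[of "q p"] by (simp add: q_def)
      then show ?thesis using B[OF that] component_le_norm_cart[of p 1] component_le_norm_cart[of p 2] by linarith
    qed
    then show ?thesis unfolding Dimg bounded_iff by blast
  qed
  have Dins: "?D \<subseteq> inside (path_image g)"
  proof
    fix z assume z: "z \<in> ?D"
    then have "connected_component_set (- path_image g) z = ?D" unfolding Dcomp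
      using connected_component_eq by metis
    moreover have "z \<notin> path_image g" using z G Dsub by blast
    ultimately show "z \<in> inside (path_image g)" using Dbd unfolding inside_def by simp
  qed
  let ?U = "{u. plane_point u \<in> D}"
  have Ueq: "?U = (\<lambda>u. Complex (u $ 1) (u $ 2)) -` ?D"
  proof -
    have "?p (Complex (u $ 1) (u $ 2)) = plane_point u" for u by (simp add: vec_eq_iff forall_3)
    then show ?thesis by auto
  qed
  have Uopen: "open ?U" unfolding Ueq
    by (rule open_vimage[OF Dopen]) (unfold Complex_eq, intro continuous_intros)
  have Ubd: "bounded ?U"
  proof -
    obtain B where B: "\<And>p. p \<in> D \<Longrightarrow> norm p \<le> B" using Db by (auto simp: bounded_iff)
    have "norm u \<le> B" if "u \<in> ?U" for u
    proof -
      have "norm u = norm (plane_point u)" by (simp add: norm_eq_sqrt_inner inner_vec_def sum_2 sum_3)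
      then show ?thesis using B that by simp
    qed
    then show ?thesis unfolding bounded_iff by blast
  qed
  have area: "plane_area D = measure lborel ?U" by (rule plane_area_measure[OF Uopen Ubd])
  have Une: "?U \<noteq> {}" 
  proof -
    obtain p where "p \<in> D" using Dne by blast
    moreover then obtain u where "p = plane_point u" using Dsub unfolding plane_R_def by blast
    ultimately show ?thesis by blast
  qed
  have "emeasure lborel ?U \<noteq> 0" 
  proof
    assume "emeasure lborel ?U = 0"
    then have "?U \<in> null_sets lborel" using Uopen by (intro null_setsI) auto
    then have "negligible ?U" unfolding negligible_iff_null_sets by (rule null_sets_completionI)
    then show False using open_not_negligible[OF Uopen Une] by blast
  qed
  moreover have "emeasure lborel ?U < \<infinity>" using emeasure_bounded_finite[OF Ubd] .
  ultimately show "plane_area D > 0" unfolding area by (simp add: measure_def enn2real_positive_iff zero_less_iff_neq_zero)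
  let ?E = "{p. Complex (fst p) (snd p) \<in> inside (path_image g)}"
  have "measure lborel ?U = measure lborel {p :: real \<times> real. vector [fst p, snd p] \<in> ?U}"
    using Uopen by (intro measure_vec2[symmetric]) simp
  also have "\<dots> \<le> measure lborel ?E"
  proof (rule measure_mono_fmeasurable)
    show "{p :: real \<times> real. vector [fst p, snd p] \<in> ?U} \<subseteq> ?E"
      using Dins unfolding Ueq by auto
    have cm: "continuous_on UNIV (\<lambda>p :: real \<times> real. Complex (fst p) (snd p))"
      unfolding Complex_eq by (intro continuous_intros)
    have "open ?D \<and> open (inside (path_image g))" using Dopen Jordan_inside_outside[OF sp loop] by blast
    then have op: "open {p. Complex (fst p) (snd p) \<in> ?D}" "open ?E"
      using open_vimage[OF _ cm] unfolding vimage_def by blast+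
    have "{p :: real \<times> real. vector [fst p, snd p] \<in> ?U} = {p. Complex (fst p) (snd p) \<in> ?D}"
      unfolding Ueq by auto
    then show "{p :: real \<times> real. vector [fst p, snd p] \<in> ?U} \<in> sets lborel" using op by simp
    have "bounded ?E"
    proof -
      have "bounded (inside (path_image g))" using bounded_inside compact_imp_bounded[OF cpg] by blast
      then obtain B where B: "\<And>z. z \<in> inside (path_image g) \<Longrightarrow> norm z \<le> B" by (auto simp: bounded_iff)
      have "norm p \<le> B" if "p \<in> ?E" for p
      proof -
        have "norm p = norm (Complex (fst p) (snd p))" by (cases p) (simp add: norm_Pair cmod_def)
        then show ?thesis using B that by simp
      qed
      then show ?thesis unfolding bounded_iff by blast
    qed
    then show "?E \<in> fmeasurable lborel"
      using op(2) emeasure_bounded_finite by (intro fmeasurableI) (auto simp: top.not_eq_extremum)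
  qed
  also have "\<dots> = \<bar>integral {0..1} (\<lambda>t. Re (g' t) * Im (g t))\<bar>" by (rule jordan_curve_area[OF d c sp loop])
  finally show "plane_area D \<le> \<bar>integral {0..1} (\<lambda>t. \<gamma>' t $ 1 * \<gamma> t $ 2)\<bar>"
    unfolding area by (simp add: g_def g'_def)
qed

text \<open>The two integrands differ by the derivative of a periodic function.\<close>

lemma closed_curve_area_form:
  fixes q :: "real^2"
  assumes par: "parametrises_closed_curve \<gamma> \<Gamma>"
  defines "\<gamma>' \<equiv> \<lambda>t. vector_derivative \<gamma> (at t)"
  shows "integral {0..1} (\<lambda>t. ((\<gamma> t $ 1 - q $ 1) * \<gamma>' t $ 2 - (\<gamma> t $ 2 - q $ 2) * \<gamma>' t $ 1) / 2)
       = - integral {0..1} (\<lambda>t. \<gamma>' t $ 1 * \<gamma> t $ 2)"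
proof -
  have gd: "(\<gamma> has_vector_derivative \<gamma>' t) (at t)" and gc: "continuous_on UNIV \<gamma>'" for t
    using parametrises_closed_curve_derivative[OF par] by (auto simp: \<gamma>'_def)
  have contg: "continuous_on UNIV \<gamma>"
    using gd by (meson continuous_at_imp_continuous_on has_vector_derivative_continuous)
  have comp: "((\<lambda>t. \<gamma> t $ i) has_real_derivative \<gamma>' t $ i) (at t)" for i t
    using bounded_linear.has_vector_derivative[OF bounded_linear_vec_nth gd]
    by (simp add: has_real_derivative_iff_has_vector_derivative)
  let ?F = "\<lambda>t. (\<gamma> t $ 1 * \<gamma> t $ 2 - q $ 1 * \<gamma> t $ 2 + q $ 2 * \<gamma> t $ 1) / 2"
  let ?F' = "\<lambda>t. ((\<gamma> t $ 1 - q $ 1) * \<gamma>' t $ 2 - (\<gamma> t $ 2 - q $ 2) * \<gamma>' t $ 1) / 2 + \<gamma>' t $ 1 * \<gamma> t $ 2"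
  have "(?F' has_integral (?F 1 - ?F 0)) {0..1}"
  proof (rule fundamental_theorem_of_calculus)
    fix t :: real
    have "(?F has_real_derivative ?F' t) (at t)"
      by (auto intro!: derivative_eq_intros comp simp: algebra_simps add_divide_distrib diff_divide_distrib)
    then show "(?F has_vector_derivative ?F' t) (at t within {0..1})"
      by (simp add: has_real_derivative_iff_has_vector_derivative has_vector_derivative_at_within)
  qed simp
  moreover have "\<gamma> 1 = \<gamma> 0" using par unfolding parametrises_closed_curve_def by (metis add_0)
  ultimately have "integral {0..1} ?F' = 0" by (simp add: integral_unique)
  moreover have "integral {0..1} ?F' = integral {0..1} (\<lambda>t. ((\<gamma> t $ 1 - q $ 1) * \<gamma>' t $ 2 - (\<gamma> t $ 2 - q $ 2) * \<gamma>' t $ 1) / 2)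
     + integral {0..1} (\<lambda>t. \<gamma>' t $ 1 * \<gamma> t $ 2)"
    by (intro Henstock_Kurzweil_Integration.integral_add integrable_continuous_real continuous_intros
        continuous_on_subset[OF gc] continuous_on_subset[OF contg]) auto
  ultimately show ?thesis by simp
qed

section \<open>Stokes' theorem on the half-plane\<close>

lemma C1_withinI:
  assumes S: "half_plane_open S" and d: "\<And>x. x \<in> S \<Longrightarrow> (f has_derivative f' x) (at x within S)"
    and c: "\<And>v. continuous_on S (\<lambda>x. f' x v)"
  shows "C1_within S f"
  unfolding C1_within_def
proof (intro conjI ballI allI)
  fix x assume "x \<in> S" then show "f differentiable (at x within S)" using d differentiableI by blast
next
  fix v
  have "frechet_derivative f (at x within S) v = f' x v" if "x \<in> S" for x
    using half_plane_frechet_eq[OF S that d[OF that]] by simp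
  then show "continuous_on S (\<lambda>x. frechet_derivative f (at x within S) v)"
    using c[of v] by (simp cong: continuous_on_cong)
qed

lemma C1_within_has_derivative:
  assumes "C1_within S f" "x \<in> S"
  shows "(f has_derivative frechet_derivative f (at x within S)) (at x within S)"
  using C1_within_differentiable[OF assms] frechet_derivative_works by blast

lemma C1_within_derivative_continuous:
  "C1_within S f \<Longrightarrow> continuous_on S (\<lambda>x. frechet_derivative f (at x within S) v)"
  by (simp add: C1_within_def)

lemma C1_within_partial_continuous:
  "C1_within S f \<Longrightarrow> continuous_on S (partial_within S f i)"
  unfolding partial_within_def[abs_def] by (rule C1_within_derivative_continuous)

lemma C1_within_cong:
  assumes S: "half_plane_open S" and f: "C1_within S f" and eq: "\<And>x. x \<in> S \<Longrightarrow> g x = f x"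
  shows "C1_within S g"
proof (rule C1_withinI[OF S])
  fix x assume x: "x \<in> S"
  show "(g has_derivative frechet_derivative f (at x within S)) (at x within S)"
    by (rule has_derivative_transform[OF x _ C1_within_has_derivative[OF f x]]) (rule eq)
qed (rule C1_within_derivative_continuous[OF f])

lemma frechet_derivative_openin:
  assumes "half_plane_open S" "half_plane_open W" "W \<subseteq> S" "x \<in> W"
  shows "frechet_derivative f (at x within W) = frechet_derivative f (at x within S)"
  using half_plane_at_within_openin[OF assms(1,2) _ assms(3,4)] assms(3,4) by auto

lemma C1_within_local:
  assumes S: "half_plane_open S"
    and loc: "\<And>x. x \<in> S \<Longrightarrow> \<exists>W. half_plane_open W \<and> x \<in> W \<and> W \<subseteq> S \<and> C1_within W f"
  shows "C1_within S f"
  unfolding C1_within_def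
proof (intro conjI ballI allI)
  fix x assume x: "x \<in> S"
  then obtain W where W: "half_plane_open W" "x \<in> W" "W \<subseteq> S" "C1_within W f" using loc by blast
  then show "f differentiable (at x within S)"
    using C1_within_differentiable[OF W(4,2)] half_plane_at_within_openin[OF S W(1) x W(3,2)] by simp
next
  fix v
  show "continuous_on S (\<lambda>x. frechet_derivative f (at x within S) v)"
    unfolding continuous_on_eq_continuous_within
  proof
    fix x assume x: "x \<in> S"
    then obtain W where W: "half_plane_open W" "x \<in> W" "W \<subseteq> S" "C1_within W f" using loc by blast
    have "continuous_on W (\<lambda>x. frechet_derivative f (at x within S) v)"
      by (rule continuous_on_eq[OF C1_within_derivative_continuous[OF W(4), of v]])
         (simp add: frechet_derivative_openin[OF S W(1,3)])
    then have "continuous (at x within W) (\<lambda>x. frechet_derivative f (at x within S) v)"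
      using W(2) by (simp add: continuous_on_eq_continuous_within)
    then show "continuous (at x within S) (\<lambda>x. frechet_derivative f (at x within S) v)"
      using half_plane_at_within_openin[OF S W(1) x W(3,2)] by simp
  qed
qed

lemma C1_within_const: "half_plane_open S \<Longrightarrow> C1_within S (\<lambda>x. c)"
  by (rule C1_withinI[where f' = "\<lambda>x v. 0"]) (auto intro!: derivative_intros continuous_intros)

lemma C1_within_sum:
  assumes S: "half_plane_open S" and f: "\<And>i. i \<in> I \<Longrightarrow> C1_within S (f i)"
  shows "C1_within S (\<lambda>x. \<Sum>i\<in>I. f i x)"
  by (rule C1_withinI[OF S, where f' = "\<lambda>x v. \<Sum>i\<in>I. frechet_derivative (f i) (at x within S) v"])
     (auto intro!: has_derivative_sum continuous_on_sum C1_within_has_derivative[OF f] C1_within_derivative_continuous[OF f])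

lemma C1_within_mult:
  fixes f g :: "real^2 \<Rightarrow> real"
  assumes S: "half_plane_open S" and f: "C1_within S f" and g: "C1_within S g"
  shows "C1_within S (\<lambda>x. f x * g x)"
  by (rule C1_withinI[OF S has_derivative_mult[OF C1_within_has_derivative[OF f] C1_within_has_derivative[OF g]]])
     (auto intro!: continuous_intros C1_within_continuous[OF f] C1_within_continuous[OF g]
       C1_within_derivative_continuous[OF f] C1_within_derivative_continuous[OF g])

lemma C1_within_inner:
  fixes f g :: "real^2 \<Rightarrow> 'a::euclidean_space"
  assumes S: "half_plane_open S" and f: "C1_within S f" and g: "C1_within S g"
  shows "C1_within S (\<lambda>x. f x \<bullet> g x)"
  by (rule C1_withinI[OF S has_derivative_inner[OF C1_within_has_derivative[OF f] C1_within_has_derivative[OF g]]])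
     (auto intro!: continuous_intros C1_within_continuous[OF f] C1_within_continuous[OF g]
       C1_within_derivative_continuous[OF f] C1_within_derivative_continuous[OF g])

lemma C1_within_divide:
  fixes f g :: "real^2 \<Rightarrow> real"
  assumes S: "half_plane_open S" and f: "C1_within S f" and g: "C1_within S g" and nz: "\<And>x. x \<in> S \<Longrightarrow> g x \<noteq> 0"
  shows "C1_within S (\<lambda>x. f x / g x)"
  by (rule C1_withinI[OF S has_derivative_divide'[OF C1_within_has_derivative[OF f] C1_within_has_derivative[OF g]]])
     (auto intro!: continuous_intros C1_within_continuous[OF f] C1_within_continuous[OF g]
       C1_within_derivative_continuous[OF f] C1_within_derivative_continuous[OF g] simp: nz)

lemma C1_within_compose:
  fixes g :: "real^2 \<Rightarrow> 'a::real_normed_vector"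
  assumes W: "half_plane_open W" and T: "C1_within W T" "T ` W \<subseteq> S" and g: "C1_within S g"
  shows "C1_within W (\<lambda>x. g (T x))"
    and "x \<in> W \<Longrightarrow> ((\<lambda>x. g (T x)) has_derivative
      (\<lambda>v. frechet_derivative g (at (T x) within S) (frechet_derivative T (at x within W) v))) (at x within W)"
proof -
  show d: "((\<lambda>x. g (T x)) has_derivative
      (\<lambda>v. frechet_derivative g (at (T x) within S) (frechet_derivative T (at x within W) v))) (at x within W)"
    if x: "x \<in> W" for x
  proof -
    have "(g has_derivative frechet_derivative g (at (T x) within S)) (at (T x) within T ` W)"
      using C1_within_has_derivative[OF g, of "T x"] T(2) x has_derivative_subset by blast
    from diff_chain_within[OF C1_within_has_derivative[OF T(1) x] this] show ?thesis by (simp add: o_def)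
  qed
  show "C1_within W (\<lambda>x. g (T x))"
  proof (rule C1_withinI[OF W d])
    fix v
    have cT: "continuous_on W T" by (rule C1_within_continuous[OF T(1)])
    have p: "continuous_on W (\<lambda>x. partial_within S g i (T x))" for i
      using continuous_on_compose2[OF C1_within_partial_continuous[OF g] cT] T(2) by blast
    have "frechet_derivative g (at (T x) within S) u = u $ 1 *\<^sub>R partial_within S g 1 (T x) + u $ 2 *\<^sub>R partial_within S g 2 (T x)"
      if "x \<in> W" for x u
      by (rule frechet_derivative_expand2, rule C1_within_differentiable[OF g]) (use that T(2) in blast)
    moreover have "continuous_on W (\<lambda>x. (frechet_derivative T (at x within W) v) $ 1 *\<^sub>R partial_within S g 1 (T x)
         + (frechet_derivative T (at x within W) v) $ 2 *\<^sub>R partial_within S g 2 (T x))"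
      by (intro continuous_intros p C1_within_derivative_continuous[OF T(1)])
    ultimately show "continuous_on W (\<lambda>x. frechet_derivative g (at (T x) within S) (frechet_derivative T (at x within W) v))"
      by (simp cong: continuous_on_cong)
  qed
qed

lemma half_plane_open_self: "half_plane_open half_plane" by simp

text \<open>The set \<open>S\<close> and the complement of \<open>K\<close> cover the half-plane by relatively open sets, and
  on the second the extended function is constant.\<close>

lemma C1_within_extend_zero:
  fixes f :: "real^2 \<Rightarrow> real"
  assumes S: "half_plane_open S" and f: "C1_within S f" and K: "closed K" "half_plane \<inter> K \<subseteq> S"
    and z: "\<And>x. x \<in> S \<Longrightarrow> x \<notin> K \<Longrightarrow> f x = 0"
  shows "C1_within half_plane (\<lambda>x. if x \<in> S then f x else 0)"
proof (rule C1_within_local[OF half_plane_open_self])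
  let ?F = "\<lambda>x. if x \<in> S then f x else 0"
  have Ssub: "S \<subseteq> half_plane" using S openin_imp_subset by blast
  fix x assume x: "x \<in> half_plane"
  show "\<exists>W. half_plane_open W \<and> x \<in> W \<and> W \<subseteq> half_plane \<and> C1_within W ?F"
  proof (cases "x \<in> S")
    case True
    then show ?thesis using S Ssub C1_within_cong[OF S f, of ?F] by (intro exI[of _ S]) auto
  next
    case False
    let ?W = "half_plane \<inter> - K"
    have W: "half_plane_open ?W" using K(1) by (auto simp: openin_open open_Compl)
    have "C1_within ?W ?F" by (rule C1_within_cong[OF W C1_within_const[OF W, of 0]]) (use z in auto)
    moreover have "x \<in> ?W" using x False K(2) by blast
    ultimately show ?thesis using W by (intro exI[of _ ?W]) auto
  qed
qed

lemma vector2_eq: "vector [a, b] = a *\<^sub>R axis 1 1 + b *\<^sub>R (axis 2 1 :: real^2)"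
  by (simp add: vec_eq_iff forall_2 axis_def)

lemma continuous_on_vector2 [continuous_intros]:
  assumes "continuous_on S f" "continuous_on S g"
  shows "continuous_on S (\<lambda>x. vector [f x, g x] :: real^2)"
  unfolding vector2_eq using assms by (intro continuous_intros)

lemma integral_vec2:
  fixes f :: "real^2 \<Rightarrow> real"
  assumes "f \<in> borel_measurable borel"
  shows "(\<integral>x. f x \<partial>lborel) = (\<integral>p. f (vector [fst p, snd p]) \<partial>(lborel \<Otimes>\<^sub>M lborel))"
    and "integrable lborel f \<Longrightarrow> integrable (lborel \<Otimes>\<^sub>M lborel) (\<lambda>p. f (vector [fst p, snd p]))"
proof -
  have m [measurable]: "(\<lambda>p :: real \<times> real. vector [fst p, snd p] :: real^2) \<in> borel \<rightarrow>\<^sub>M borel"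
    by (intro borel_measurable_continuous_onI continuous_intros)
  show "(\<integral>x. f x \<partial>lborel) = (\<integral>p. f (vector [fst p, snd p]) \<partial>(lborel \<Otimes>\<^sub>M lborel))"
    unfolding lborel_prod by (subst lborel_vec2) (rule integral_distr, use m assms in auto)
  assume "integrable lborel f"
  then have "integrable (distr lborel borel (\<lambda>p :: real \<times> real. vector [fst p, snd p] :: real^2)) f"
    by (subst (asm) lborel_vec2)
  then show "integrable (lborel \<Otimes>\<^sub>M lborel) (\<lambda>p. f (vector [fst p, snd p]))"
    unfolding lborel_prod by (subst (asm) integrable_distr_eq) (use m assms in auto)
qed

lemma half_plane_line_derivative:
  assumes f: "C1_within half_plane f" and p: "p \<in> half_plane"
    and v: "\<And>t. t \<in> T \<Longrightarrow> p + (t - t0) *\<^sub>R axis i 1 \<in> half_plane" and t0: "t0 \<in> T"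
  shows "((\<lambda>t. f (p + (t - t0) *\<^sub>R axis i 1)) has_vector_derivative partial_within half_plane f i p) (at t0 within T)"
proof -
  let ?l = "\<lambda>t. p + (t - t0) *\<^sub>R (axis i 1 :: real^2)"
  have l: "(?l has_vector_derivative axis i 1) (at t0 within T)"
    unfolding has_vector_derivative_def by (auto intro!: derivative_eq_intros)
  have "(f has_derivative frechet_derivative f (at p within half_plane)) (at (?l t0) within ?l ` T)"
  proof -
    have "?l ` T \<subseteq> half_plane" using v by auto
    from has_derivative_subset[OF C1_within_has_derivative[OF f p] this] show ?thesis by simp
  qed
  from vector_derivative_diff_chain_within[OF l this]
  show ?thesis by (simp add: o_def partial_within_def)
qed

text \<open>On a box, Fubini's theorem and the fundamental theorem of calculus evaluate the two terms. The only side of the box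
  that contributes is the one on the boundary line.\<close>

lemma half_plane_stokes:
  fixes P Q :: "real^2 \<Rightarrow> real"
  assumes P: "C1_within half_plane P" and Q: "C1_within half_plane Q"
    and L: "L > 0" and Pz: "\<And>x. norm x \<ge> L \<Longrightarrow> P x = 0" and Qz: "\<And>x. norm x \<ge> L \<Longrightarrow> Q x = 0"
  shows "integral half_plane (\<lambda>x. partial_within half_plane Q 1 x - partial_within half_plane P 2 x)
     = integral UNIV (\<lambda>s. P (vector [s, 0]))"
proof -
  let ?B = "cbox (vector [-L, 0]) (vector [L, L]) :: (real^2) set"
  let ?Q1 = "partial_within half_plane Q 1" and ?P2 = "partial_within half_plane P 2"
  have mB: "vector [a, b] \<in> ?B \<longleftrightarrow> a \<in> {-L..L} \<and> b \<in> {0..L}" for a b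
    by (auto simp: mem_box_cart forall_2)
  have Bsub: "?B \<subseteq> half_plane" by (auto simp: half_plane_def mem_box_cart forall_2)
  have big: "norm (x :: real^2) \<ge> L" if "\<bar>x $ i\<bar> \<ge> L" for x i
    using component_le_norm_cart[of x i] that by linarith
  have zero: "partial_within half_plane F i x = 0"
    if F: "C1_within half_plane F" "\<And>x. norm x \<ge> L \<Longrightarrow> F x = 0" and x: "x \<in> half_plane" "norm x > L" for F :: "real^2 \<Rightarrow> real" and i x
  proof -
    have "((\<lambda>x. 0) has_derivative (\<lambda>v. 0)) (at x within half_plane)" by simp
    moreover have "at x within half_plane = at x within (half_plane \<inter> {x. norm x > L})"
      by (rule at_within_nhd[of _ "{x. norm x > L}"]) (use x in \<open>auto intro!: open_Collect_less continuous_intros\<close>)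
    ultimately have "((\<lambda>x. 0) has_derivative (\<lambda>v. 0)) (at x within (half_plane \<inter> {x. norm x > L}))" by simp
    then have "(F has_derivative (\<lambda>v. 0)) (at x within (half_plane \<inter> {x. norm x > L}))"
      by (rule has_derivative_transform[rotated 2]) (use x F(2) in auto)
    then have "(F has_derivative (\<lambda>v. 0)) (at x within half_plane)"
      using \<open>at x within half_plane = _\<close> by simp
    from partial_within_eqI[OF half_plane_open_self x(1) this] show ?thesis by simp
  qed
  have cQ1: "continuous_on half_plane ?Q1" and cP2: "continuous_on half_plane ?P2"
    by (rule C1_within_partial_continuous[OF Q], rule C1_within_partial_continuous[OF P])
  have outB: "norm x > L" if "x \<in> half_plane" "x \<notin> ?B" for x
  proof -
    have "x $ 1 < - L \<or> x $ 1 > L \<or> x $ 2 > L"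
      using that by (auto simp: half_plane_def mem_box_cart forall_2)
    then show ?thesis using component_le_norm_cart[of x 1] component_le_norm_cart[of x 2] by linarith
  qed
  define F where "F x = (if x \<in> half_plane then ?Q1 x - ?P2 x else 0)" for x
  have int: "set_integrable lborel ?B f" if "continuous_on half_plane f" for f :: "real^2 \<Rightarrow> real"
    unfolding set_integrable_def
    by (rule borel_integrable_compact) (use continuous_on_subset[OF that Bsub] in auto)
  have Beq: "integral ?B f = (\<integral>p. indicator {-L..L} (fst p) * indicator {0..L} (snd p) * f (vector [fst p, snd p]) \<partial>(lborel \<Otimes>\<^sub>M lborel))"
    "integrable (lborel \<Otimes>\<^sub>M lborel) (\<lambda>p. indicator {-L..L} (fst p) * indicator {0..L} (snd p) * f (vector [fst p, snd p]))"
    if f: "continuous_on half_plane f" for f :: "real^2 \<Rightarrow> real"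
  proof -
    have i: "integrable lborel (\<lambda>x. indicator ?B x * f x)" using int[OF f] by (simp add: set_integrable_def)
    have ind: "indicator ?B (vector [fst p, snd p]) = (indicator {-L..L} (fst p) * indicator {0..L} (snd p) :: real)" for p
      by (simp add: indicator_def mB)
    have "integral ?B f = (\<integral>x. indicator ?B x * f x \<partial>lborel)"
      using set_borel_integral_eq_integral(2)[OF int[OF f]] by (simp add: set_lebesgue_integral_def)
    then show "integral ?B f = (\<integral>p. indicator {-L..L} (fst p) * indicator {0..L} (snd p) * f (vector [fst p, snd p]) \<partial>(lborel \<Otimes>\<^sub>M lborel))"
      using integral_vec2(1)[of "\<lambda>x. indicator ?B x * f x"] borel_measurable_integrable[OF i] by (simp add: ind)
    show "integrable (lborel \<Otimes>\<^sub>M lborel) (\<lambda>p. indicator {-L..L} (fst p) * indicator {0..L} (snd p) * f (vector [fst p, snd p]))"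
      using integral_vec2(2)[of "\<lambda>x. indicator ?B x * f x"] borel_measurable_integrable[OF i] i by (simp add: ind)
  qed
  have hp: "vector [a, b] \<in> half_plane \<longleftrightarrow> b \<ge> 0" for a b by (simp add: half_plane_def)
  have line1: "((\<lambda>a. Q (vector [a, b])) has_vector_derivative ?Q1 (vector [a, b])) (at a within {-L..L})"
    if "a \<in> {-L..L}" "b \<ge> 0" for a b
  proof -
    have "vector [a, b] + (t - a) *\<^sub>R axis 1 1 = (vector [t, b] :: real^2)" for t
      by (simp add: vec_eq_iff forall_2 axis_def)
    then show ?thesis
      using half_plane_line_derivative[OF Q, of "vector [a, b]" "{-L..L}" a 1] that by (simp add: hp)
  qed
  have line2: "((\<lambda>b. P (vector [a, b])) has_vector_derivative ?P2 (vector [a, b])) (at b within {0..L})"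
    if "b \<in> {0..L}" for a b
  proof -
    have "vector [a, b] + (t - b) *\<^sub>R axis 2 1 = (vector [a, t] :: real^2)" for t
      by (simp add: vec_eq_iff forall_2 axis_def)
    then show ?thesis
      using half_plane_line_derivative[OF P, of "vector [a, b]" "{0..L}" b 2] that by (simp add: hp)
  qed
  have I1: "integral ?B ?Q1 = 0"
  proof -
    let ?h = "\<lambda>a b. indicator {-L..L} a * indicator {0..L} b * ?Q1 (vector [a, b])"
    have "integral ?B ?Q1 = (\<integral>b. \<integral>a. ?h a b \<partial>lborel \<partial>lborel)"
      using lborel_pair.integral_snd[of ?h] Beq[OF cQ1] by (simp add: case_prod_unfold)
    also have "\<dots> = (\<integral>b. 0 \<partial>(lborel :: real measure))"
    proof (rule Bochner_Integration.integral_cong[OF refl])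
      fix b :: real
      show "(\<integral>a. ?h a b \<partial>lborel) = 0"
      proof (cases "b \<in> {0..L}")
        case True
        have "(\<integral>a. indicator {-L..L} a *\<^sub>R ?Q1 (vector [a, b]) \<partial>lborel) = Q (vector [L, b]) - Q (vector [-L, b])"
          by (rule integral_FTC_Icc[where F = "\<lambda>a. Q (vector [a, b])"])
             (use True L line1 in \<open>auto intro!: continuous_on_compose2[OF cQ1] continuous_intros simp: hp\<close>)
        also have "\<dots> = 0" using Qz[OF big[of "vector [L, b]" 1]] Qz[OF big[of "vector [-L, b]" 1]] L by simp
        finally show ?thesis using True by simp
      qed simp
    qed
    finally show ?thesis by simp
  qed
  have I2: "integral ?B ?P2 = - (\<integral>a. indicator {-L..L} a * P (vector [a, 0]) \<partial>lborel)"
  proof -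
    let ?h = "\<lambda>a b. indicator {-L..L} a * indicator {0..L} b * ?P2 (vector [a, b])"
    have "integral ?B ?P2 = (\<integral>a. \<integral>b. ?h a b \<partial>lborel \<partial>lborel)"
      using lborel_pair.integral_fst[of ?h] Beq[OF cP2] by (simp add: case_prod_unfold)
    also have "\<dots> = (\<integral>a. - (indicator {-L..L} a * P (vector [a, 0])) \<partial>lborel)"
    proof (rule Bochner_Integration.integral_cong[OF refl])
      fix a :: real
      have "(\<integral>b. indicator {0..L} b *\<^sub>R ?P2 (vector [a, b]) \<partial>lborel) = P (vector [a, L]) - P (vector [a, 0])"
        by (rule integral_FTC_Icc[where F = "\<lambda>b. P (vector [a, b])"])
           (use L line2 in \<open>auto intro!: continuous_on_compose2[OF cP2] continuous_intros simp: hp\<close>)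
      also have "P (vector [a, L]) = 0" using Pz[OF big[of "vector [a, L]" 2]] L by simp
      finally have "(\<integral>b. indicator {0..L} b * ?P2 (vector [a, b]) \<partial>lborel) = - P (vector [a, 0])" by simp
      then show "(\<integral>b. ?h a b \<partial>lborel) = - (indicator {-L..L} a * P (vector [a, 0]))"
        by (simp add: mult.assoc)
    qed
    finally show ?thesis by simp
  qed
  have "integral half_plane (\<lambda>x. ?Q1 x - ?P2 x) = integral UNIV F"
    unfolding F_def by (rule Henstock_Kurzweil_Integration.integral_restrict_UNIV[symmetric])
  also have "\<dots> = integral ?B F"
  proof (rule integral_spike_set)
    show "negligible {x \<in> UNIV - ?B. F x \<noteq> 0}"
    proof -
      have "F x = 0" if "x \<notin> ?B" for x
        using outB[OF _ that] zero[OF P Pz, of x 2] zero[OF Q Qz, of x 1] by (simp add: F_def)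
      then have "{x \<in> UNIV - ?B. F x \<noteq> 0} = {}" by blast
      then show ?thesis by (simp only: negligible_empty)
    qed
  qed auto
  also have "\<dots> = integral ?B (\<lambda>x. ?Q1 x - ?P2 x)"
    by (rule Henstock_Kurzweil_Integration.integral_cong) (use Bsub in \<open>auto simp: F_def\<close>)
  also have "\<dots> = integral ?B ?Q1 - integral ?B ?P2"
    using int[OF cQ1] int[OF cP2] set_borel_integral_eq_integral(1) by (intro Henstock_Kurzweil_Integration.integral_diff) blast+
  also have "\<dots> = (\<integral>a. indicator {-L..L} a * P (vector [a, 0]) \<partial>lborel)" using I1 I2 by simp
  also have "\<dots> = integral {-L..L} (\<lambda>s. P (vector [s, 0]))"
    by (rule continuous_lebesgue_integral_Icc)
       (auto intro!: continuous_on_compose2[OF C1_within_continuous[OF P]] continuous_intros simp: hp)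
  also have "\<dots> = integral UNIV (\<lambda>s. P (vector [s, 0]))"
  proof (rule integral_spike_set)
    have "P (vector [s, 0]) = 0" if "s \<notin> {-L..L}" for s
    proof -
      have "L \<le> \<bar>s\<bar>" using that by auto
      then show ?thesis using Pz[OF big[of "vector [s, 0]" 1]] by simp
    qed
    then have "{s \<in> UNIV - {-L..L}. P (vector [s, 0]) \<noteq> 0} = {}" by blast
    then show "negligible {s \<in> UNIV - {-L..L}. P (vector [s, 0]) \<noteq> 0}" by (simp only: negligible_empty)
  qed auto
  finally show ?thesis .
qed

lemma partial_within_mult:
  fixes f g :: "real^2 \<Rightarrow> real"
  assumes S: "half_plane_open S" and f: "C1_within S f" and g: "C1_within S g" and x: "x \<in> S"
  shows "partial_within S (\<lambda>x. f x * g x) i x = f x * partial_within S g i x + partial_within S f i x * g x"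
  using partial_within_eqI[OF S x has_derivative_mult[OF C1_within_has_derivative[OF f x] C1_within_has_derivative[OF g x]]]
  by (simp add: partial_within_def)

lemma partial_within_extend_zero:
  fixes f :: "real^2 \<Rightarrow> real"
  assumes S: "half_plane_open S" and f: "C1_within S f" and K: "closed K" "half_plane \<inter> K \<subseteq> S"
    and z: "\<And>x. x \<in> S \<Longrightarrow> x \<notin> K \<Longrightarrow> f x = 0" and x: "x \<in> half_plane"
  shows "partial_within half_plane (\<lambda>x. if x \<in> S then f x else 0) i x = (if x \<in> S then partial_within S f i x else 0)"
proof -
  let ?F = "\<lambda>x. if x \<in> S then f x else 0"
  have Ssub: "S \<subseteq> half_plane" using S openin_imp_subset by blast
  show ?thesis
  proof (cases "x \<in> S")
    case True
    have "(?F has_derivative frechet_derivative f (at x within S)) (at x within S)"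
      by (rule has_derivative_transform[OF True _ C1_within_has_derivative[OF f True]]) simp
    then have "(?F has_derivative frechet_derivative f (at x within S)) (at x within half_plane)"
      using half_plane_at_within_openin[OF half_plane_open_self S x Ssub True] by simp
    from partial_within_eqI[OF half_plane_open_self x this] show ?thesis using True by (simp add: partial_within_def)
  next
    case False
    let ?W = "half_plane \<inter> - K"
    have W: "half_plane_open ?W" using K(1) by (auto simp: openin_open open_Compl)
    have xW: "x \<in> ?W" using x False K(2) by blast
    have "(?F has_derivative (\<lambda>v. 0)) (at x within ?W)"
      by (rule has_derivative_transform[OF xW _ has_derivative_const[of 0]]) (use z in auto)
    then have "(?F has_derivative (\<lambda>v. 0)) (at x within half_plane)"
      using half_plane_at_within_openin[OF half_plane_open_self W x _ xW] by simp
    from partial_within_eqI[OF half_plane_open_self x this] show ?thesis using False by simp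
  qed
qed

text \<open>For a closed form \<open>\<theta>\<close> one has \<open>d(\<rho> \<theta>) = d\<rho> \<and> \<theta>\<close>.
  Closedness is only available at interior points, but the boundary line is negligible.\<close>

lemma chart_stokes:
  fixes \<rho> \<theta>1 \<theta>2 :: "real^2 \<Rightarrow> real"
  assumes S: "half_plane_open S" and K: "half_plane \<inter> cball c r \<subseteq> S"
    and C1: "C1_within S \<rho>" "C1_within S \<theta>1" "C1_within S \<theta>2"
    and z: "\<And>x. x \<in> S \<Longrightarrow> x \<notin> cball c r \<Longrightarrow> \<rho> x = 0"
    and closed: "\<And>x. x \<in> S \<Longrightarrow> x $ 2 > 0 \<Longrightarrow> partial_within S \<theta>2 1 x = partial_within S \<theta>1 2 x"
  shows "integral S (\<lambda>x. partial_within S \<rho> 1 x * \<theta>2 x - partial_within S \<rho> 2 x * \<theta>1 x)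
       = integral {s. vector [s, 0] \<in> S} (\<lambda>s. \<rho> (vector [s, 0]) * \<theta>1 (vector [s, 0]))"
proof -
  have Ssub: "S \<subseteq> half_plane" using S openin_imp_subset by blast
  let ?P = "\<lambda>x. if x \<in> S then \<rho> x * \<theta>1 x else 0" and ?Q = "\<lambda>x. if x \<in> S then \<rho> x * \<theta>2 x else 0"
  \<comment> \<open>A radius that contains the supporting disc strictly, so that the extended functions vanish at distance \<open>L\<close>.\<close>
  define L where "L = norm c + \<bar>r\<bar> + 1"
  have L: "L > 0" by (simp add: L_def add_nonneg_pos)
  have far: "x \<notin> cball c r" if "norm x \<ge> L" for x
  proof
    assume "x \<in> cball c r"
    then have "norm (x - c) \<le> \<bar>r\<bar>" by (simp add: dist_norm norm_minus_commute)
    then have "norm x \<le> norm c + \<bar>r\<bar>" using norm_triangle_sub[of x c] by linarith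
    then show False using that by (simp add: L_def)
  qed
  note Pm = C1_within_mult[OF S C1(1,2)] and Qm = C1_within_mult[OF S C1(1,3)]
  have "integral half_plane (\<lambda>x. partial_within half_plane ?Q 1 x - partial_within half_plane ?P 2 x)
     = integral UNIV (\<lambda>s. ?P (vector [s, 0]))"
  proof (rule half_plane_stokes[OF _ _ L])
    show "C1_within half_plane ?P" by (rule C1_within_extend_zero[OF S Pm closed_cball K]) (simp add: z)
    show "C1_within half_plane ?Q" by (rule C1_within_extend_zero[OF S Qm closed_cball K]) (simp add: z)
    show "?P x = 0" if "norm x \<ge> L" for x using z[of x] far[OF that] by simp
    show "?Q x = 0" if "norm x \<ge> L" for x using z[of x] far[OF that] by simp
  qed
  moreover have "integral UNIV (\<lambda>s. ?P (vector [s, 0])) = integral {s. vector [s, 0] \<in> S} (\<lambda>s. \<rho> (vector [s, 0]) * \<theta>1 (vector [s, 0]))"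
    using Henstock_Kurzweil_Integration.integral_restrict_UNIV[of "{s. vector [s, 0] \<in> S}" "\<lambda>s. \<rho> (vector [s, 0]) * \<theta>1 (vector [s, 0])"] by simp
  moreover have "integral half_plane (\<lambda>x. partial_within half_plane ?Q 1 x - partial_within half_plane ?P 2 x)
     = integral S (\<lambda>x. partial_within S \<rho> 1 x * \<theta>2 x - partial_within S \<rho> 2 x * \<theta>1 x)" (is "integral _ ?G = integral _ ?g")
  proof -
    have "integral UNIV (\<lambda>x. if x \<in> half_plane then ?G x else 0) = integral UNIV (\<lambda>x. if x \<in> S then ?g x else 0)"
    proof (rule integral_spike[of "{x :: real^2. x $ 2 = 0}"])
      show "negligible {x :: real^2. x $ 2 = 0}" by (rule negligible_standard_hyperplane_cart)
      fix x :: "real^2" assume x: "x \<in> UNIV - {x. x $ 2 = 0}"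
      show "(if x \<in> S then ?g x else 0) = (if x \<in> half_plane then ?G x else 0)"
      proof (cases "x \<in> half_plane")
        case True
        have G: "?G x = (if x \<in> S then partial_within S (\<lambda>x. \<rho> x * \<theta>2 x) 1 x else 0) - (if x \<in> S then partial_within S (\<lambda>x. \<rho> x * \<theta>1 x) 2 x else 0)"
          by (subst partial_within_extend_zero[OF S Qm closed_cball K _ True], simp add: z,
              subst partial_within_extend_zero[OF S Pm closed_cball K _ True], simp add: z, rule refl)
        show ?thesis
        proof (cases "x \<in> S")
          case xS: True
          have "x $ 2 > 0" using True x by (auto simp: half_plane_def)
          from closed[OF xS this] show ?thesis
            unfolding G using xS True by (simp add: partial_within_mult[OF S C1(1,2)] partial_within_mult[OF S C1(1,3)] algebra_simps)
        next
          case False then show ?thesis unfolding G by simp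
        qed
      qed (use Ssub in auto)
    qed
    then show ?thesis unfolding Henstock_Kurzweil_Integration.integral_restrict_UNIV .
  qed
  ultimately show ?thesis by simp
qed

text \<open>The square makes the cut-off continuously differentiable, which is all the smoothness that Stokes' theorem needs.\<close>

definition bump :: "real^2 \<Rightarrow> real \<Rightarrow> real^2 \<Rightarrow> real" where
  "bump c r x = (max 0 (1 - (x - c) \<bullet> (x - c) / r\<^sup>2))\<^sup>2"

lemma DERIV_max_square: "((\<lambda>u::real. (max 0 u)\<^sup>2) has_real_derivative 2 * max 0 u) (at u)"
proof -
  consider "u > 0" | "u < 0" | "u = 0" by linarith
  then show ?thesis
  proof cases
    case 1
    have "((\<lambda>u. u\<^sup>2) has_real_derivative 2 * max 0 u) (at u)" using 1 by (auto intro!: derivative_eq_intros)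
    then show ?thesis by (rule has_field_derivative_transform_within_open[of _ _ _ "{0<..}"]) (use 1 in auto)
  next
    case 2
    have "((\<lambda>u. 0) has_real_derivative 2 * max 0 u) (at u)" using 2 by (auto intro!: derivative_eq_intros)
    then show ?thesis by (rule has_field_derivative_transform_within_open[of _ _ _ "{..<0}"]) (use 2 in auto)
  next
    case 3
    have "(\<lambda>h::real. ((max 0 (0 + h))\<^sup>2 - (max 0 0)\<^sup>2) / h) \<midarrow>0\<rightarrow> 0"
    proof (rule Lim_transform_eventually)
      have "isCont (\<lambda>h::real. max 0 h) 0" by (intro continuous_intros)
      then show "(\<lambda>h::real. max 0 h) \<midarrow>0\<rightarrow> 0" by (simp add: isCont_def)
      show "\<forall>\<^sub>F h in at 0. max 0 h = ((max 0 (0 + h))\<^sup>2 - (max 0 0)\<^sup>2) / (h::real)"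
        by (auto simp: eventually_at_filter max_def power2_eq_square intro!: always_eventually)
    qed
    then show ?thesis using 3 by (simp add: DERIV_def)
  qed
qed

lemma bump_C1:
  assumes S: "half_plane_open S"
  shows "C1_within S (bump c r)"
proof (rule C1_withinI[OF S])
  fix x
  have "((\<lambda>x. 1 - (x - c) \<bullet> (x - c) * k) has_derivative (\<lambda>v. - (2 * ((x - c) \<bullet> v) * k))) (at x within S)" for k
    by (auto intro!: derivative_eq_intros simp: inner_commute distrib_right)
  from this[of "inverse (r\<^sup>2)"]
  have "((\<lambda>x. 1 - (x - c) \<bullet> (x - c) / r\<^sup>2) has_derivative (\<lambda>v. - (2 * ((x - c) \<bullet> v) / r\<^sup>2))) (at x within S)"
    unfolding divide_inverse .
  from has_derivative_compose[OF this DERIV_max_square[unfolded has_field_derivative_def]]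
  show "(bump c r has_derivative (\<lambda>v. 2 * max 0 (1 - (x - c) \<bullet> (x - c) / r\<^sup>2) * - (2 * ((x - c) \<bullet> v) / r\<^sup>2))) (at x within S)"
    unfolding bump_def[abs_def] .
next
  fix v show "continuous_on S (\<lambda>x. 2 * max 0 (1 - (x - c) \<bullet> (x - c) / r\<^sup>2) * - (2 * ((x - c) \<bullet> v) / r\<^sup>2))"
    unfolding divide_inverse by (intro continuous_intros)
qed

lemma bump_nonneg: "bump c r x \<ge> 0" by (simp add: bump_def)

lemma bump_pos_iff: assumes "r > 0" shows "bump c r x \<noteq> 0 \<longleftrightarrow> dist x c < r"
proof -
  have "(x - c) \<bullet> (x - c) = (dist x c)\<^sup>2" by (simp add: dist_norm power2_norm_eq_inner)
  then show ?thesis using assms by (auto simp: bump_def max_def divide_le_eq)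
qed

section \<open>Charts of an oriented immersed surface\<close>

lemma compact_half_plane_ball: "compact (half_plane \<inter> cball c r)"
proof -
  have "closed half_plane" unfolding half_plane_def by (simp add: closed_halfspace_component_ge_cart)
  then show ?thesis by (simp add: closed_Int_compact)
qed

lemma convex_half_plane: "convex half_plane"
  using convex_halfspace_ge[of 0 "axis 2 1 :: real^2"] by (simp add: half_plane_def inner_axis')

lemma absolutely_integrable_compact_support:
  fixes f :: "'a::euclidean_space \<Rightarrow> real"
  assumes f: "continuous_on S f" and C: "compact C" "C \<subseteq> S" and z: "\<And>x. x \<in> S \<Longrightarrow> x \<notin> C \<Longrightarrow> f x = 0"
  shows "f absolutely_integrable_on S"
proof -
  have i: "integrable lborel (\<lambda>x. indicator C x *\<^sub>R f x)"
    by (rule borel_integrable_compact[OF C(1) continuous_on_subset[OF f C(2)]])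
  then have "f absolutely_integrable_on C"
    unfolding set_integrable_def using integrable_completion[OF borel_measurable_integrable[OF i]] by simp
  then have "(\<lambda>x. if x \<in> C then f x else 0) absolutely_integrable_on UNIV"
    by (simp add: absolutely_integrable_restrict_UNIV)
  moreover have "(\<lambda>x. if x \<in> C then f x else 0) = (\<lambda>x. if x \<in> S then f x else 0)"
    using z C(2) by (auto simp: fun_eq_iff)
  ultimately show ?thesis by (simp add: absolutely_integrable_restrict_UNIV)
qed

lemma integral_chart_support:
  fixes f :: "'a::euclidean_space \<Rightarrow> real"
  assumes "W \<subseteq> S" and z: "\<And>x. x \<in> S \<Longrightarrow> x \<notin> W \<Longrightarrow> f x = 0"
  shows "f absolutely_integrable_on W \<longleftrightarrow> f absolutely_integrable_on S"
    and "integral W f = integral S f"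
proof -
  have eq: "(\<lambda>x. if x \<in> W then f x else 0) = (\<lambda>x. if x \<in> S then f x else 0)"
    using assms by (auto simp: fun_eq_iff)
  show "f absolutely_integrable_on W \<longleftrightarrow> f absolutely_integrable_on S"
    using eq absolutely_integrable_restrict_UNIV[of W f] absolutely_integrable_restrict_UNIV[of S f] by simp
  show "integral W f = integral S f"
    using eq Henstock_Kurzweil_Integration.integral_restrict_UNIV[of W f] Henstock_Kurzweil_Integration.integral_restrict_UNIV[of S f] by simp
qed

lemma change_of_variables_real:
  fixes f :: "real^2 \<Rightarrow> real" and g :: "real^2 \<Rightarrow> real^2"
  assumes S: "S \<in> sets lebesgue" and d: "\<And>x. x \<in> S \<Longrightarrow> (g has_derivative g' x) (at x within S)" and inj: "inj_on g S"
  shows "(\<lambda>x. \<bar>det (matrix (g' x))\<bar> * f (g x)) absolutely_integrable_on S \<and>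
           integral S (\<lambda>x. \<bar>det (matrix (g' x))\<bar> * f (g x)) = b
     \<longleftrightarrow> f absolutely_integrable_on (g ` S) \<and> integral (g ` S) f = b"
proof -
  have "(\<lambda>x. \<bar>det (matrix (g' x))\<bar> *\<^sub>R vec (f (g x)) :: real^1) absolutely_integrable_on S \<and>
           integral S (\<lambda>x. \<bar>det (matrix (g' x))\<bar> *\<^sub>R vec (f (g x))) = (vec b :: real^1)
     \<longleftrightarrow> (\<lambda>x. vec (f x) :: real^1) absolutely_integrable_on (g ` S) \<and> integral (g ` S) (\<lambda>x. vec (f x)) = (vec b :: real^1)"
    by (rule has_absolute_integral_change_of_variables[OF S d inj])
  then show ?thesis by (simp add: absolutely_integrable_on_1_iff integral_on_1_eq)
qed

definition C1_surface :: "'m atlas \<Rightarrow> ('m \<Rightarrow> 'b::real_normed_vector) \<Rightarrow> bool" where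
  "C1_surface A h \<longleftrightarrow> (\<forall>(U, \<psi>)\<in>A. C1_within (\<psi> ` U) (h \<circ> inv_into U \<psi>))"

type_synonym 'm chart = "'m set \<times> ('m \<Rightarrow> real^2)"

definition chart_deriv :: "'m chart \<Rightarrow> ('m \<Rightarrow> 'b::real_normed_vector) \<Rightarrow> 2 \<Rightarrow> real^2 \<Rightarrow> 'b" where
  "chart_deriv c h i x = partial_within (snd c ` fst c) (h \<circ> inv_into (fst c) (snd c)) i x"

locale oriented_surface =
  fixes M :: "'m topology" and A :: "'m atlas" and \<phi> N :: "'m \<Rightarrow> real^3"
  assumes surface: "compact_surface_with_boundary M A"
    and immersed: "immersion A \<phi>" and normal: "unit_normal_field A \<phi> N"
begin

abbreviation dom :: "'m chart \<Rightarrow> (real^2) set" where "dom c \<equiv> snd c ` fst c"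
abbreviation pt :: "'m chart \<Rightarrow> real^2 \<Rightarrow> 'm" where "pt c \<equiv> inv_into (fst c) (snd c)"

lemma chart_open: "c \<in> A \<Longrightarrow> openin M (fst c)"
  and chart_dom: "c \<in> A \<Longrightarrow> half_plane_open (dom c)"
  and chart_homeo: "c \<in> A \<Longrightarrow> homeomorphic_map (subtopology M (fst c)) (top_of_set (dom c)) (snd c)"
  using surface unfolding compact_surface_with_boundary_def smooth_atlas_def by (auto simp: case_prod_unfold)

lemma chart_subset: "c \<in> A \<Longrightarrow> fst c \<subseteq> topspace M"
  using chart_open openin_subset by blast

lemma charts_cover: "p \<in> topspace M \<Longrightarrow> \<exists>c\<in>A. p \<in> fst c"
  using surface unfolding compact_surface_with_boundary_def smooth_atlas_def by blast

lemma chart_inj: "c \<in> A \<Longrightarrow> inj_on (snd c) (fst c)"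
  using homeomorphic_imp_injective_map[OF chart_homeo] chart_subset by (simp add: Int_absorb1)

lemma pt_chart: "c \<in> A \<Longrightarrow> p \<in> fst c \<Longrightarrow> pt c (snd c p) = p"
  by (rule inv_into_f_f[OF chart_inj])

lemma pt_in: "x \<in> dom c \<Longrightarrow> pt c x \<in> fst c"
  by (rule inv_into_into)

lemma chart_pt: "x \<in> dom c \<Longrightarrow> snd c (pt c x) = x"
  by (rule f_inv_into_f)

lemma dom_half_plane: "c \<in> A \<Longrightarrow> dom c \<subseteq> half_plane"
  using chart_dom openin_imp_subset by blast

lemma chart_image_open:
  assumes c: "c \<in> A" and V: "openin M V"
  shows "half_plane_open (snd c ` (fst c \<inter> V))"
proof -
  have "openin (subtopology M (fst c)) (fst c \<inter> V)"
    using V by (simp add: openin_subtopology_Int2)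
  then have "openin (top_of_set (dom c)) (snd c ` (fst c \<inter> V))"
    using homeomorphic_imp_open_map[OF chart_homeo[OF c]] unfolding open_map_def by blast
  then show ?thesis using chart_dom[OF c] openin_trans by blast
qed

lemma pt_continuous: "c \<in> A \<Longrightarrow> continuous_map (top_of_set (dom c)) M (pt c)"
proof -
  assume c: "c \<in> A"
  obtain g where g: "homeomorphic_maps (subtopology M (fst c)) (top_of_set (dom c)) (snd c) g"
    using chart_homeo[OF c] homeomorphic_map_maps by blast
  have top: "topspace (subtopology M (fst c)) = fst c" using chart_subset[OF c] by (simp add: Int_absorb1)
  have "continuous_map (top_of_set (dom c)) (subtopology M (fst c)) (pt c)"
  proof (rule continuous_map_eq)
    show "continuous_map (top_of_set (dom c)) (subtopology M (fst c)) g"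
      using g by (simp add: homeomorphic_maps_def)
    fix x assume "x \<in> topspace (top_of_set (dom c))"
    then have x: "x \<in> dom c" by simp
    have "g (snd c p) = p" if "p \<in> fst c" for p using g that top by (auto simp: homeomorphic_maps_def)
    from this[OF pt_in[OF x]] show "g x = pt c x" by (simp only: chart_pt[OF x])
  qed
  then show ?thesis by (simp add: continuous_map_in_subtopology)
qed

lemma hausdorff: "Hausdorff_space M"
  using surface by (simp add: compact_surface_with_boundary_def)

lemma chart_ball_closed:
  assumes c: "c \<in> A" and K: "half_plane \<inter> cball x r \<subseteq> dom c"
  shows "closedin M (pt c ` (half_plane \<inter> cball x r))"
proof -
  have "compactin (top_of_set (dom c)) (half_plane \<inter> cball x r)"
    using compact_half_plane_ball K by (simp add: compactin_subtopology)
  then have "compactin M (pt c ` (half_plane \<inter> cball x r))"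
    using image_compactin pt_continuous[OF c] by blast
  then show ?thesis using compactin_imp_closedin hausdorff by blast
qed

definition transition :: "'m chart \<Rightarrow> 'm chart \<Rightarrow> real^2 \<Rightarrow> real^2" where
  "transition c d = snd d \<circ> pt c"

definition overlap :: "'m chart \<Rightarrow> 'm chart \<Rightarrow> (real^2) set" where
  "overlap c d = snd c ` (fst c \<inter> fst d)"

lemma overlap_open: "c \<in> A \<Longrightarrow> d \<in> A \<Longrightarrow> half_plane_open (overlap c d)"
  unfolding overlap_def by (rule chart_image_open[OF _ chart_open])

lemma overlap_subset: "overlap c d \<subseteq> dom c"
  by (auto simp: overlap_def)

lemma overlap_iff: assumes "c \<in> A" shows "x \<in> overlap c d \<longleftrightarrow> x \<in> dom c \<and> pt c x \<in> fst d"
  using pt_chart[OF assms] pt_in chart_pt by (force simp: overlap_def)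

lemma transition_C1: "c \<in> A \<Longrightarrow> d \<in> A \<Longrightarrow> C1_within (overlap c d) (transition c d)"
proof (rule smooth_on_C1_within[OF overlap_open])
  assume cd: "c \<in> A" "d \<in> A"
  have "\<forall>(U, \<psi>)\<in>A. \<forall>(U', \<psi>')\<in>A. smooth_on (\<psi> ` (U \<inter> U')) (\<psi>' \<circ> inv_into U \<psi>)"
    using surface by (simp add: compact_surface_with_boundary_def smooth_atlas_def)
  then show "smooth_on (overlap c d) (transition c d)"
    using cd unfolding overlap_def transition_def by (auto simp: case_prod_unfold)
qed

lemma transition_image: assumes c: "c \<in> A" "d \<in> A" shows "transition c d ` overlap c d = overlap d c"
  unfolding overlap_def transition_def image_comp[symmetric] image_image
  using pt_chart[OF c(1)] by (auto simp: image_iff)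

lemma transition_in: "c \<in> A \<Longrightarrow> d \<in> A \<Longrightarrow> x \<in> overlap c d \<Longrightarrow> transition c d x \<in> dom d"
  using transition_image overlap_subset by blast

lemma pt_trans: "c \<in> A \<Longrightarrow> d \<in> A \<Longrightarrow> x \<in> overlap c d \<Longrightarrow> pt d (transition c d x) = pt c x"
  using overlap_iff pt_chart by (simp add: transition_def)

lemma transition_inj: assumes c: "c \<in> A" "d \<in> A" shows "inj_on (transition c d) (overlap c d)"
proof (rule inj_on_inverseI[where g = "\<lambda>y. snd c (pt d y)"])
  fix x assume x: "x \<in> overlap c d"
  then have "x \<in> dom c" using overlap_subset by blast
  from chart_pt[OF this] show "snd c (pt d (transition c d x)) = x" by (simp add: pt_trans[OF c x])
qed

text \<open>This is the chain rule; the first derivatives of the change of chart are its coefficients.\<close>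

lemma transition_rule:
  assumes c: "c \<in> A" "d \<in> A" and h: "C1_within (dom d) (h \<circ> pt d)" and x: "x \<in> overlap c d"
  shows "chart_deriv c h i x =
      (partial_within (overlap c d) (transition c d) i x $ 1) *\<^sub>R chart_deriv d h 1 (transition c d x)
    + (partial_within (overlap c d) (transition c d) i x $ 2) *\<^sub>R chart_deriv d h 2 (transition c d x)"
proof -
  let ?W = "overlap c d" and ?T = "transition c d"
  have TW: "?T ` ?W \<subseteq> dom d" using transition_in[OF c] by blast
  have xd: "x \<in> dom c" using x overlap_subset by blast
  have "((\<lambda>x. (h \<circ> pt d) (?T x)) has_derivative (\<lambda>v. frechet_derivative (h \<circ> pt d) (at (?T x) within dom d)
      (frechet_derivative ?T (at x within ?W) v))) (at x within ?W)"
    by (rule C1_within_compose(2)[OF overlap_open[OF c] transition_C1[OF c] TW h x])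
  then have "((h \<circ> pt c) has_derivative (\<lambda>v. frechet_derivative (h \<circ> pt d) (at (?T x) within dom d)
      (frechet_derivative ?T (at x within ?W) v))) (at x within ?W)"
    by (rule has_derivative_transform[OF x, rotated]) (simp add: pt_trans[OF c])
  then have "((h \<circ> pt c) has_derivative (\<lambda>v. frechet_derivative (h \<circ> pt d) (at (?T x) within dom d)
      (frechet_derivative ?T (at x within ?W) v))) (at x within dom c)"
    using half_plane_at_within_openin[OF chart_dom[OF c(1)] overlap_open[OF c] xd overlap_subset x] by simp
  from partial_within_eqI[OF chart_dom[OF c(1)] xd this, of i]
  have "chart_deriv c h i x = frechet_derivative (h \<circ> pt d) (at (?T x) within dom d) (partial_within ?W ?T i x)"
    by (simp add: chart_deriv_def partial_within_def)
  also have "\<dots> = (partial_within ?W ?T i x $ 1) *\<^sub>R chart_deriv d h 1 (?T x) + (partial_within ?W ?T i x $ 2) *\<^sub>R chart_deriv d h 2 (?T x)"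
    unfolding chart_deriv_def
    by (rule frechet_derivative_expand2, rule C1_within_differentiable[OF h], rule transition_in[OF c x])
  finally show ?thesis .
qed

lemma C1_transition:
  assumes c: "c \<in> A" "d \<in> A" and h: "C1_within (dom d) (h \<circ> pt d)"
  shows "C1_within (overlap c d) (h \<circ> pt c)"
proof -
  have "C1_within (overlap c d) (\<lambda>x. (h \<circ> pt d) (transition c d x))"
    by (rule C1_within_compose(1)[OF overlap_open[OF c] transition_C1[OF c] _ h]) (use transition_in[OF c] in blast)
  then show ?thesis
    by (rule C1_within_cong[OF overlap_open[OF c]]) (simp add: pt_trans[OF c])
qed

lemma C1_surfaceD: "C1_surface A h \<Longrightarrow> c \<in> A \<Longrightarrow> C1_within (dom c) (h \<circ> pt c)"
  unfolding C1_surface_def by (auto simp: case_prod_unfold)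

lemma C1_surfaceI: "(\<And>c. c \<in> A \<Longrightarrow> C1_within (dom c) (h \<circ> pt c)) \<Longrightarrow> C1_surface A h"
  unfolding C1_surface_def by (auto simp: case_prod_unfold)

lemma immersion_smooth: "c \<in> A \<Longrightarrow> smooth_on (dom c) (\<phi> \<circ> pt c)"
  and normal_smooth: "c \<in> A \<Longrightarrow> smooth_on (dom c) (N \<circ> pt c)"
  using immersed normal unfolding immersion_def unit_normal_field_def smooth_on_surface_def by (auto simp: case_prod_unfold)

lemma immersion_C1: "C1_surface A \<phi>" and normal_C1: "C1_surface A N"
  by (auto intro!: C1_surfaceI smooth_on_C1_within chart_dom immersion_smooth normal_smooth)

section \<open>The orientation given by the normal\<close>

text \<open>The determinant of \<open>N\<close> and the coordinate tangent vectors. Its sign tells whether the chart agrees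
  with the orientation given by the normal, and its absolute value is a density for integration: under a change of
  chart it is multiplied by the Jacobian.\<close>

definition orient :: "'m chart \<Rightarrow> real^2 \<Rightarrow> real" where
  "orient c x = N (pt c x) \<bullet> cross3 (chart_deriv c \<phi> 1 x) (chart_deriv c \<phi> 2 x)"

lemma normal_chart:
  assumes c: "c \<in> A" and x: "x \<in> dom c"
  shows "sol_norm (\<phi> (pt c x)) (N (pt c x)) = 1"
    and "sol_inner (\<phi> (pt c x)) (frechet_derivative (\<phi> \<circ> pt c) (at x within dom c) v) (N (pt c x)) = 0"
proof -
  have *: "\<forall>c\<in>A. \<forall>p\<in>fst c. sol_norm (\<phi> p) (N p) = 1 \<and>
        (\<forall>v. sol_inner (\<phi> p) (frechet_derivative (\<phi> \<circ> pt c) (at (snd c p) within dom c) v) (N p) = 0)"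
    using normal by (simp add: unit_normal_field_def case_prod_unfold)
  from *[rule_format, OF c pt_in[OF x]] chart_pt[OF x]
  show "sol_norm (\<phi> (pt c x)) (N (pt c x)) = 1"
    and "sol_inner (\<phi> (pt c x)) (frechet_derivative (\<phi> \<circ> pt c) (at x within dom c) v) (N (pt c x)) = 0" by auto
qed

lemma immersion_inj: "c \<in> A \<Longrightarrow> x \<in> dom c \<Longrightarrow> inj (frechet_derivative (\<phi> \<circ> pt c) (at x within dom c))"
  using immersed unfolding immersion_def by (auto simp: case_prod_unfold)

text \<open>In the orthonormal frame the cross product of the tangent vectors is a multiple of the unit normal, with factor
  \<open>orient\<close>; for an immersion it does not vanish.\<close>

lemma orient_nonzero:
  assumes c: "c \<in> A" and x: "x \<in> dom c"
  shows "orient c x \<noteq> 0"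
proof
  assume o: "orient c x = 0"
  let ?p = "\<phi> (pt c x)"
  let ?P = "sol_frame ?p"
  let ?a = "chart_deriv c \<phi> 1 x" and ?b = "chart_deriv c \<phi> 2 x" and ?n = "N (pt c x)"
  have perp: "?P (chart_deriv c \<phi> i x) \<bullet> ?P ?n = 0" for i
    using normal_chart(2)[OF c x] by (simp add: chart_deriv_def partial_within_def sol_inner_frame)
  have unit: "?P ?n \<bullet> ?P ?n = 1"
    using normal_chart(1)[OF c x] by (simp add: sol_norm_def sol_inner_frame)
  have "cross3 (?P ?a) (?P ?b) = (?P ?n \<bullet> cross3 (?P ?a) (?P ?b)) *\<^sub>R ?P ?n"
    by (rule cross_of_orthogonal_to_unit[OF perp perp unit])
  also have "?P ?n \<bullet> cross3 (?P ?a) (?P ?b) = 0" using o unfolding sol_frame_cross orient_def .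
  finally have "cross3 (?P ?a) (?P ?b) = 0" by simp
  moreover have "cross3 ?a ?b \<noteq> 0"
    unfolding chart_deriv_def
    by (rule inj_derivative_cross_nonzero[OF C1_within_differentiable[OF C1_surfaceD[OF immersion_C1 c] x] immersion_inj[OF c x]])
  ultimately show False using sol_frame_cross_nonzero by blast
qed

lemma chart_deriv_continuous: "C1_surface A h \<Longrightarrow> c \<in> A \<Longrightarrow> continuous_on (dom c) (chart_deriv c h i)"
  unfolding chart_deriv_def[abs_def] by (rule C1_within_partial_continuous[OF C1_surfaceD])

lemma C1_surface_continuous: "C1_surface A h \<Longrightarrow> c \<in> A \<Longrightarrow> continuous_on (dom c) (\<lambda>x. h (pt c x))"
  using C1_within_continuous[OF C1_surfaceD] by (simp add: o_def)

lemma orient_continuous: "c \<in> A \<Longrightarrow> continuous_on (dom c) (orient c)"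
  unfolding orient_def[abs_def]
  by (intro continuous_on_inner continuous_on_cross chart_deriv_continuous C1_surface_continuous immersion_C1 normal_C1)

definition jacobian :: "'m chart \<Rightarrow> 'm chart \<Rightarrow> real^2 \<Rightarrow> real" where
  "jacobian c d x = det (matrix (frechet_derivative (transition c d) (at x within overlap c d)))"

lemma jacobian_expand:
  "jacobian c d x = partial_within (overlap c d) (transition c d) 1 x $ 1 * partial_within (overlap c d) (transition c d) 2 x $ 2
     - partial_within (overlap c d) (transition c d) 1 x $ 2 * partial_within (overlap c d) (transition c d) 2 x $ 1"
  by (simp add: jacobian_def det_2 matrix_def partial_within_def)

lemma orient_transition:
  assumes c: "c \<in> A" "d \<in> A" and x: "x \<in> overlap c d"
  shows "orient c x = jacobian c d x * orient d (transition c d x)"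
proof -
  note t = transition_rule[OF c C1_surfaceD[OF immersion_C1 c(2)] x]
  show ?thesis
    unfolding orient_def t jacobian_expand pt_trans[OF c x]
    by (simp add: Cross3.cross_add_left Cross3.cross_add_right Cross3.cross_mult_left Cross3.cross_mult_right
        inner_add_right Cross3.cross_skew[of "chart_deriv d \<phi> 2 _" "chart_deriv d \<phi> 1 _"] algebra_simps)
qed

text \<open>The coefficients in a chart of the one-form \<open>v \<mapsto> \<Lambda> \<bullet> v\<close> pulled back by the
  immersion.\<close>

definition pull :: "('m \<Rightarrow> real^3) \<Rightarrow> 'm chart \<Rightarrow> 2 \<Rightarrow> real^2 \<Rightarrow> real" where
  "pull \<Lambda> c i x = \<Lambda> (pt c x) \<bullet> chart_deriv c \<phi> i x"

text \<open>The coefficient of \<open>dh \<and> \<theta>\<close> in a chart, where \<open>\<theta>\<close> is the form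
  represented by \<open>\<Lambda>\<close>.\<close>

definition wedge :: "('m \<Rightarrow> real) \<Rightarrow> ('m \<Rightarrow> real^3) \<Rightarrow> 'm chart \<Rightarrow> real^2 \<Rightarrow> real" where
  "wedge h \<Lambda> c x = chart_deriv c h 1 x * pull \<Lambda> c 2 x - chart_deriv c h 2 x * pull \<Lambda> c 1 x"

lemma wedge_transition:
  assumes c: "c \<in> A" "d \<in> A" and x: "x \<in> overlap c d" and h: "C1_surface A h"
  shows "wedge h \<Lambda> c x = jacobian c d x * wedge h \<Lambda> d (transition c d x)"
proof -
  note t = transition_rule[OF c C1_surfaceD[OF immersion_C1 c(2)] x] and th = transition_rule[OF c C1_surfaceD[OF h c(2)] x]
  show ?thesis
    unfolding wedge_def pull_def t th jacobian_expand pt_trans[OF c x]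
    by (simp add: inner_add_right algebra_simps)
qed

text \<open>The quotient of two coefficients that transform with the same Jacobian, hence a function on the surface; any chart
  around \<open>p\<close> gives the same value.\<close>

definition wedge_density :: "('m \<Rightarrow> real) \<Rightarrow> ('m \<Rightarrow> real^3) \<Rightarrow> 'm \<Rightarrow> real" where
  "wedge_density h \<Lambda> p = (let c = (SOME c. c \<in> A \<and> p \<in> fst c) in wedge h \<Lambda> c (snd c p) / orient c (snd c p))"

lemma wedge_density_chart:
  assumes c: "c \<in> A" and x: "x \<in> dom c" and h: "C1_surface A h"
  shows "wedge_density h \<Lambda> (pt c x) = wedge h \<Lambda> c x / orient c x"
proof -
  let ?p = "pt c x"
  define d where "d = (SOME c. c \<in> A \<and> ?p \<in> fst c)"
  have "d \<in> A \<and> ?p \<in> fst d" unfolding d_def by (rule someI[of _ c]) (use c pt_in[OF x] in simp)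
  then have d: "d \<in> A" "?p \<in> fst d" by auto
  have xo: "x \<in> overlap c d" using overlap_iff[OF c] x d by simp
  have T: "transition c d x = snd d ?p" by (simp add: transition_def)
  have "jacobian c d x \<noteq> 0" using orient_transition[OF c d(1) xo] orient_nonzero[OF c x] by auto
  then show ?thesis
    unfolding wedge_density_def d_def[symmetric] Let_def T[symmetric]
    using orient_transition[OF c d(1) xo] wedge_transition[OF c d(1) xo h, of \<Lambda>] by simp
qed

lemma chart_deriv_zero:
  assumes c: "c \<in> A" and x: "x \<in> dom c" and V: "openin M V" "pt c x \<in> V" and h: "\<And>p. p \<in> V \<Longrightarrow> h p = k"
  shows "chart_deriv c h i x = 0"
proof -
  let ?W = "snd c ` (fst c \<inter> V)"
  have W: "half_plane_open ?W" by (rule chart_image_open[OF c V(1)])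
  have "snd c (pt c x) \<in> ?W" using pt_in[OF x] V(2) by blast
  then have xW: "x \<in> ?W" by (simp only: chart_pt[OF x])
  have Ws: "?W \<subseteq> dom c" by blast
  have "((h \<circ> pt c) has_derivative (\<lambda>v. 0)) (at x within ?W)"
    by (rule has_derivative_transform[OF xW _ has_derivative_const[of k]]) (auto simp: pt_chart[OF c] h)
  then have "((h \<circ> pt c) has_derivative (\<lambda>v. 0)) (at x within dom c)"
    using half_plane_at_within_openin[OF chart_dom[OF c] W x Ws xW] by simp
  from partial_within_eqI[OF chart_dom[OF c] x this] show ?thesis by (simp add: chart_deriv_def)
qed

lemma wedge_density_zero:
  assumes V: "openin M V" "p \<in> V" and h: "\<And>p. p \<in> V \<Longrightarrow> h p = k" and C1: "C1_surface A h"
  shows "wedge_density h \<Lambda> p = 0"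
proof -
  obtain c where c: "c \<in> A" "p \<in> fst c" using charts_cover openin_subset[OF V(1)] V(2) by blast
  have x: "snd c p \<in> dom c" and p: "pt c (snd c p) = p" using c pt_chart by auto
  have "wedge h \<Lambda> c (snd c p) = 0"
    unfolding wedge_def using chart_deriv_zero[OF c(1) x V(1) _ h] p V(2) by simp
  then show ?thesis using wedge_density_chart[OF c(1) x C1, of \<Lambda>] p by simp
qed

text \<open>The density \<open>|orient|\<close> transforms with the absolute value of the Jacobian, so the integral of a
  function on the surface against it does not depend on the chart. The equivalence also transfers integrability.\<close>

lemma change_of_chart:
  assumes c: "c \<in> A" "d \<in> A"
  shows "(\<lambda>x. F (pt c x) * \<bar>orient c x\<bar>) absolutely_integrable_on overlap c d \<and>
         integral (overlap c d) (\<lambda>x. F (pt c x) * \<bar>orient c x\<bar>) = b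
    \<longleftrightarrow> (\<lambda>x. F (pt d x) * \<bar>orient d x\<bar>) absolutely_integrable_on overlap d c \<and>
         integral (overlap d c) (\<lambda>x. F (pt d x) * \<bar>orient d x\<bar>) = b"
proof -
  have leb: "overlap c d \<in> sets lebesgue"
  proof -
    obtain V where "open V" "overlap c d = half_plane \<inter> V" using overlap_open[OF c] by (auto simp: openin_open)
    moreover have "closed half_plane" unfolding half_plane_def by (simp add: closed_halfspace_component_ge_cart)
    ultimately show ?thesis by (simp add: sets.Int lebesgue_openin borel_closed)
  qed
  let ?f = "\<lambda>y. F (pt d y) * \<bar>orient d y\<bar>"
  have eq: "\<bar>det (matrix (frechet_derivative (transition c d) (at x within overlap c d)))\<bar> * ?f (transition c d x) = F (pt c x) * \<bar>orient c x\<bar>"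
    if x: "x \<in> overlap c d" for x
    unfolding jacobian_def[symmetric] orient_transition[OF c x] pt_trans[OF c x] by (simp add: abs_mult)
  have "(\<lambda>x. \<bar>det (matrix (frechet_derivative (transition c d) (at x within overlap c d)))\<bar> * ?f (transition c d x)) absolutely_integrable_on overlap c d \<longleftrightarrow>
      (\<lambda>x. F (pt c x) * \<bar>orient c x\<bar>) absolutely_integrable_on overlap c d"
    by (rule set_integrable_cong) (auto simp: eq)
  moreover have "integral (overlap c d) (\<lambda>x. \<bar>det (matrix (frechet_derivative (transition c d) (at x within overlap c d)))\<bar> * ?f (transition c d x))
      = integral (overlap c d) (\<lambda>x. F (pt c x) * \<bar>orient c x\<bar>)"
    by (rule Henstock_Kurzweil_Integration.integral_cong) (rule eq)
  ultimately show ?thesis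
    using change_of_variables_real[OF leb C1_within_has_derivative[OF transition_C1[OF c]] transition_inj[OF c], of ?f b]
    unfolding transition_image[OF c] by simp
qed

section \<open>Partitions of unity\<close>

definition chart_ball :: "'m chart \<times> (real^2) \<times> real \<Rightarrow> 'm set" where
  "chart_ball k = pt (fst k) ` (half_plane \<inter> cball (fst (snd k)) (snd (snd k)))"

text \<open>Triples of a chart, a centre and a radius for which the half-disc lies in the image of the chart. The half-disc is
  convex, so \<open>orient\<close> has constant sign on it.\<close>

definition chart_balls :: "('m chart \<times> (real^2) \<times> real) set" where
  "chart_balls = {k. fst k \<in> A \<and> snd (snd k) > 0 \<and> half_plane \<inter> cball (fst (snd k)) (snd (snd k)) \<subseteq> dom (fst k)}"

definition chart_bump :: "'m chart \<times> (real^2) \<times> real \<Rightarrow> 'm \<Rightarrow> real" where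
  "chart_bump k p = (if p \<in> fst (fst k) then bump (fst (snd k)) (snd (snd k)) (snd (fst k) p) else 0)"

lemma chart_ball_closedin: "k \<in> chart_balls \<Longrightarrow> closedin M (chart_ball k)"
  unfolding chart_balls_def chart_ball_def using chart_ball_closed by blast

lemma chart_ball_iff:
  assumes k: "k \<in> chart_balls" and x: "x \<in> dom (fst k)"
  shows "pt (fst k) x \<in> chart_ball k \<longleftrightarrow> x \<in> cball (fst (snd k)) (snd (snd k))"
proof
  have kA: "fst k \<in> A" and sub: "half_plane \<inter> cball (fst (snd k)) (snd (snd k)) \<subseteq> dom (fst k)"
    using k by (auto simp: chart_balls_def)
  show "x \<in> cball (fst (snd k)) (snd (snd k))" if a: "pt (fst k) x \<in> chart_ball k"
  proof -
    obtain y where y: "y \<in> half_plane \<inter> cball (fst (snd k)) (snd (snd k))" "pt (fst k) x = pt (fst k) y"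
      using a unfolding chart_ball_def by blast
    then have "x = y" using chart_pt[OF x] chart_pt[of y "fst k"] sub by auto
    then show ?thesis using y by simp
  qed
  show "pt (fst k) x \<in> chart_ball k" if "x \<in> cball (fst (snd k)) (snd (snd k))"
    using that dom_half_plane[OF kA] x unfolding chart_ball_def by blast
qed

lemma chart_bump_nonzero:
  assumes k: "k \<in> chart_balls" and p: "chart_bump k p \<noteq> 0"
  shows "p \<in> fst (fst k)" "dist (snd (fst k) p) (fst (snd k)) < snd (snd k)" "p \<in> chart_ball k"
proof -
  have kA: "fst k \<in> A" and r: "snd (snd k) > 0" using k by (auto simp: chart_balls_def)
  show pU: "p \<in> fst (fst k)" using p by (auto simp: chart_bump_def split: if_splits)
  show d: "dist (snd (fst k) p) (fst (snd k)) < snd (snd k)"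
    using p pU bump_pos_iff[OF r] by (simp add: chart_bump_def)
  have "snd (fst k) p \<in> dom (fst k)" using pU by blast
  from chart_ball_iff[OF k this] show "p \<in> chart_ball k"
    using d pt_chart[OF kA pU] by (simp add: dist_commute)
qed

lemma chart_bump_nonneg: "chart_bump k p \<ge> 0"
  by (simp add: chart_bump_def bump_nonneg)

text \<open>The preimage of the closed half-disc is compact, hence closed since the surface is Hausdorff. So near a point
  outside the chart the extension by zero vanishes identically.\<close>

lemma chart_bump_C1:
  assumes k: "k \<in> chart_balls"
  shows "C1_surface A (chart_bump k)"
proof (rule C1_surfaceI)
  let ?c = "fst k"
  have kA: "?c \<in> A" using k by (simp add: chart_balls_def)
  have own: "C1_within (dom ?c) (chart_bump k \<circ> pt ?c)"
    by (rule C1_within_cong[OF chart_dom[OF kA] bump_C1[OF chart_dom[OF kA], of "fst (snd k)" "snd (snd k)"]])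
       (simp add: chart_bump_def pt_in chart_pt)
  fix d assume d: "d \<in> A"
  show "C1_within (dom d) (chart_bump k \<circ> pt d)"
  proof (rule C1_within_local[OF chart_dom[OF d]])
    fix x assume x: "x \<in> dom d"
    show "\<exists>W. half_plane_open W \<and> x \<in> W \<and> W \<subseteq> dom d \<and> C1_within W (chart_bump k \<circ> pt d)"
    proof (cases "pt d x \<in> fst ?c")
      case True
      then have "x \<in> overlap d ?c" using overlap_iff[OF d] x by simp
      then show ?thesis using overlap_open[OF d kA] overlap_subset C1_transition[OF d kA own] by blast
    next
      case False
      let ?V = "topspace M - chart_ball k"
      let ?W = "snd d ` (fst d \<inter> ?V)"
      have V: "openin M ?V" using chart_ball_closedin[OF k] by (simp add: openin_diff)
      have W: "half_plane_open ?W" by (rule chart_image_open[OF d V])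
      have "pt d x \<notin> chart_ball k"
      proof
        assume "pt d x \<in> chart_ball k"
        then obtain y where "y \<in> dom ?c" "pt d x = pt ?c y" using k unfolding chart_ball_def chart_balls_def by blast
        then show False using pt_in False by simp
      qed
      then have "snd d (pt d x) \<in> ?W" using pt_in[OF x] chart_subset[OF d] by blast
      then have xW: "x \<in> ?W" by (simp only: chart_pt[OF x])
      have "(chart_bump k \<circ> pt d) y = 0" if y: "y \<in> ?W" for y
      proof -
        obtain p where p: "p \<in> fst d" "p \<notin> chart_ball k" "y = snd d p" using y by blast
        then have "pt d y = p" using pt_chart[OF d] by simp
        then show ?thesis using chart_bump_nonzero(3)[OF k] p(2) by auto
      qed
      then have "C1_within ?W (chart_bump k \<circ> pt d)"
        by (rule C1_within_cong[OF W C1_within_const[OF W, of 0]])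
      then show ?thesis using W xW by blast
    qed
  qed
qed

lemma chart_bump_support_open:
  assumes k: "k \<in> chart_balls"
  shows "openin M {p \<in> fst (fst k). dist (snd (fst k) p) (fst (snd k)) < snd (snd k)}"
proof -
  let ?c = "fst k"
  have kA: "?c \<in> A" using k by (simp add: chart_balls_def)
  have top: "topspace (subtopology M (fst ?c)) = fst ?c" using chart_subset[OF kA] by (simp add: Int_absorb1)
  have cm: "continuous_map (subtopology M (fst ?c)) (top_of_set (dom ?c)) (snd ?c)"
    using homeomorphic_imp_continuous_map[OF chart_homeo[OF kA]] .
  have "openin (top_of_set (dom ?c)) (dom ?c \<inter> ball (fst (snd k)) (snd (snd k)))" by (simp add: openin_open_Int)
  from openin_continuous_map_preimage[OF cm this]
  have "openin (subtopology M (fst ?c)) {p \<in> fst ?c. snd ?c p \<in> dom ?c \<inter> ball (fst (snd k)) (snd (snd k))}"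
    unfolding top .
  moreover have "{p \<in> fst ?c. snd ?c p \<in> dom ?c \<inter> ball (fst (snd k)) (snd (snd k))}
     = {p \<in> fst ?c. dist (snd ?c p) (fst (snd k)) < snd (snd k)}" by (auto simp: dist_commute)
  ultimately show ?thesis using openin_trans_full[OF _ chart_open[OF kA]] by simp
qed

lemma chart_balls_cover:
  assumes p: "p \<in> topspace M"
  shows "\<exists>k\<in>chart_balls. p \<in> fst (fst k) \<and> dist (snd (fst k) p) (fst (snd k)) < snd (snd k)"
proof -
  obtain c where c: "c \<in> A" "p \<in> fst c" using charts_cover[OF p] by blast
  then have "snd c p \<in> dom c" by blast
  then obtain e where e: "e > 0" "cball (snd c p) e \<inter> half_plane \<subseteq> dom c"
    using chart_dom[OF c(1)] unfolding openin_contains_cball by blast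
  then have "(c, snd c p, e) \<in> chart_balls" using c by (auto simp: chart_balls_def)
  then show ?thesis using c e by (intro bexI[of _ "(c, snd c p, e)"]) auto
qed

lemma partition_of_unity:
  obtains I \<rho> where "finite I" "I \<subseteq> chart_balls" "\<And>k. k \<in> I \<Longrightarrow> C1_surface A (\<rho> k)"
    "\<And>k p. k \<in> I \<Longrightarrow> \<rho> k p \<noteq> 0 \<Longrightarrow> p \<in> chart_ball k"
    "\<And>p. p \<in> topspace M \<Longrightarrow> (\<Sum>k\<in>I. \<rho> k p) = (1::real)"
proof -
  let ?V = "\<lambda>k. {p \<in> fst (fst k). dist (snd (fst k) p) (fst (snd k)) < snd (snd k)}"
  have "compactin M (topspace M)"
    using surface by (simp add: compact_surface_with_boundary_def compact_space_def)
  moreover have "topspace M \<subseteq> \<Union> (?V ` chart_balls)" using chart_balls_cover by blast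
  moreover have "openin M V" if "V \<in> ?V ` chart_balls" for V using that chart_bump_support_open by blast
  ultimately obtain F where F: "finite F" "F \<subseteq> ?V ` chart_balls" "topspace M \<subseteq> \<Union>F"
    using compactinD by meson
  then obtain I where I: "I \<subseteq> chart_balls" "finite I" "F = ?V ` I" using finite_subset_image by meson
  define s where "s p = (\<Sum>k\<in>I. chart_bump k p)" for p
  have spos: "s p > 0" if p: "p \<in> topspace M" for p
  proof -
    obtain k where k: "k \<in> I" "p \<in> ?V k" using F(3) I(3) p by blast
    then have r: "snd (snd k) > 0" using I(1) by (auto simp: chart_balls_def)
    have "chart_bump k p \<noteq> 0" using k bump_pos_iff[OF r] by (simp add: chart_bump_def)
    then have "chart_bump k p > 0" using chart_bump_nonneg[of k p] by linarith
    then show ?thesis unfolding s_def using k(1) I(2) chart_bump_nonneg by (intro sum_pos2) auto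
  qed
  show ?thesis
  proof (rule that[of I "\<lambda>k p. chart_bump k p / s p"])
    show "C1_surface A (\<lambda>p. chart_bump k p / s p)" if k: "k \<in> I" for k
    proof (rule C1_surfaceI)
      fix c assume c: "c \<in> A"
      have b: "C1_within (dom c) (\<lambda>x. chart_bump j (pt c x))" if "j \<in> I" for j
        using C1_surfaceD[OF chart_bump_C1 c, of j] that I(1) by (auto simp: o_def)
      have sC: "C1_within (dom c) (\<lambda>x. s (pt c x))"
        unfolding s_def by (rule C1_within_sum[OF chart_dom[OF c] b])
      have "s (pt c x) \<noteq> 0" if "x \<in> dom c" for x
        using spos[of "pt c x"] pt_in[OF that] chart_subset[OF c] by force
      from C1_within_divide[OF chart_dom[OF c] b[OF k] sC this]
      show "C1_within (dom c) ((\<lambda>p. chart_bump k p / s p) \<circ> pt c)" by (simp add: o_def)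
    qed
    show "p \<in> chart_ball k" if "k \<in> I" "chart_bump k p / s p \<noteq> 0" for k p
      using that I(1) by (intro chart_bump_nonzero(3)) auto
    show "(\<Sum>k\<in>I. chart_bump k p / s p) = 1" if "p \<in> topspace M" for p
      using spos[OF that] by (simp add: sum_divide_distrib[symmetric] s_def[symmetric])
  qed (use I in auto)
qed

lemma wedge_density_support:
  assumes k: "k \<in> chart_balls" and h: "C1_surface A h" "\<And>p. h p \<noteq> 0 \<Longrightarrow> p \<in> chart_ball k"
    and p: "p \<in> topspace M" "p \<notin> chart_ball k"
  shows "wedge_density h \<Lambda> p = 0"
proof (rule wedge_density_zero[OF _ _ _ h(1), where V = "topspace M - chart_ball k"])
  show "openin M (topspace M - chart_ball k)" using chart_ball_closedin[OF k] by (simp add: openin_diff)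
qed (use h(2) p in auto)

lemma wedge_continuous:
  assumes h: "C1_surface A h" and \<Lambda>: "C1_surface A \<Lambda>" and c: "c \<in> A"
  shows "continuous_on (dom c) (wedge h \<Lambda> c)"
  unfolding wedge_def[abs_def] pull_def
  by (intro continuous_intros chart_deriv_continuous C1_surface_continuous h \<Lambda> immersion_C1 c)

lemma wedge_density_integrable:
  assumes k: "k \<in> chart_balls" and h: "C1_surface A h" "\<And>p. h p \<noteq> 0 \<Longrightarrow> p \<in> chart_ball k"
    and \<Lambda>: "C1_surface A \<Lambda>" and g: "C1_surface A g"
  shows "(\<lambda>x. (g (pt (fst k) x) * wedge_density h \<Lambda> (pt (fst k) x)) * \<bar>orient (fst k) x\<bar>) absolutely_integrable_on dom (fst k)"
proof (rule absolutely_integrable_compact_support)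
  let ?c = "fst k"
  have c: "?c \<in> A" and sub: "half_plane \<inter> cball (fst (snd k)) (snd (snd k)) \<subseteq> dom ?c"
    using k by (auto simp: chart_balls_def)
  show "compact (half_plane \<inter> cball (fst (snd k)) (snd (snd k)))" by (rule compact_half_plane_ball)
  show "half_plane \<inter> cball (fst (snd k)) (snd (snd k)) \<subseteq> dom ?c" by (rule sub)
  have "continuous_on (dom ?c) (\<lambda>x. (g (pt ?c x) * (wedge h \<Lambda> ?c x / orient ?c x)) * \<bar>orient ?c x\<bar>)"
    by (intro continuous_intros C1_surface_continuous[OF g c] wedge_continuous[OF h(1) \<Lambda> c] orient_continuous[OF c])
       (use orient_nonzero[OF c] in blast)
  then show "continuous_on (dom ?c) (\<lambda>x. (g (pt ?c x) * wedge_density h \<Lambda> (pt ?c x)) * \<bar>orient ?c x\<bar>)"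
    by (rule continuous_on_eq) (simp add: wedge_density_chart[OF c _ h(1)])
  fix x assume x: "x \<in> dom ?c" "x \<notin> half_plane \<inter> cball (fst (snd k)) (snd (snd k))"
  then have "pt ?c x \<notin> chart_ball k" using chart_ball_iff[OF k x(1)] dom_half_plane[OF c] by blast
  then show "(g (pt ?c x) * wedge_density h \<Lambda> (pt ?c x)) * \<bar>orient ?c x\<bar> = 0"
    using wedge_density_support[OF k h] pt_in[OF x(1)] chart_subset[OF c] by (simp add: subset_iff)
qed

text \<open>The sum over \<open>k\<close> of \<open>d\<rho>\<^sub>k \<and> \<theta>\<close> is
  \<open>d1 \<and> \<theta> = 0\<close>, but its terms are integrated in different charts. A second factor
  \<open>\<rho>\<^sub>l\<close> moves the \<open>k\<close>-th integral to the \<open>l\<close>-th chart, and there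
  the sum over \<open>k\<close> vanishes pointwise.\<close>

lemma sum_of_wedges_zero:
  assumes I: "finite I" "I \<subseteq> chart_balls" and \<rho>: "\<And>k. k \<in> I \<Longrightarrow> C1_surface A (\<rho> k)"
    "\<And>k p. k \<in> I \<Longrightarrow> \<rho> k p \<noteq> 0 \<Longrightarrow> p \<in> chart_ball k"
    and one: "\<And>p. p \<in> topspace M \<Longrightarrow> (\<Sum>k\<in>I. \<rho> k p) = (1::real)"
    and \<Lambda>: "C1_surface A \<Lambda>"
  shows "(\<Sum>k\<in>I. integral (dom (fst k)) (\<lambda>x. wedge_density (\<rho> k) \<Lambda> (pt (fst k) x) * \<bar>orient (fst k) x\<bar>)) = 0"
proof -
  let ?u = "\<lambda>k. wedge_density (\<rho> k) \<Lambda>"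
  let ?F = "\<lambda>k l p. \<rho> l p * ?u k p"
  let ?i = "\<lambda>k l c x. ?F k l (pt c x) * \<bar>orient c x\<bar>"
  have kA: "fst k \<in> A" if "k \<in> I" for k using I(2) that by (auto simp: chart_balls_def)
  have ballU: "chart_ball k \<subseteq> fst (fst k)" if "k \<in> I" for k
    using I(2) that pt_in unfolding chart_ball_def chart_balls_def by blast
  have top: "pt c x \<in> topspace M" if "c \<in> A" "x \<in> dom c" for c x using pt_in[OF that(2)] chart_subset[OF that(1)] by blast
  have int1: "?i k l (fst k) absolutely_integrable_on dom (fst k)" if "k \<in> I" "l \<in> I" for k l
    by (rule wedge_density_integrable) (use that I(2) \<rho> \<Lambda> in auto)
  have swap: "?i k l (fst l) absolutely_integrable_on dom (fst l) \<and>
      integral (dom (fst l)) (?i k l (fst l)) = integral (dom (fst k)) (?i k l (fst k))" if k: "k \<in> I" and l: "l \<in> I" for k l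
  proof -
    let ?c = "fst k" and ?d = "fst l"
    have z1: "?i k l ?c x = 0" if "x \<in> dom ?c" "x \<notin> overlap ?c ?d" for x
    proof -
      have "pt ?c x \<notin> fst ?d" using that overlap_iff[OF kA[OF k]] by simp
      then have "\<rho> l (pt ?c x) = 0" using \<rho>(2)[OF l] ballU[OF l] by blast
      then show ?thesis by simp
    qed
    have z2: "?i k l ?d x = 0" if x: "x \<in> dom ?d" "x \<notin> overlap ?d ?c" for x
    proof -
      have "pt ?d x \<notin> fst ?c" using x overlap_iff[OF kA[OF l]] by simp
      then have "pt ?d x \<notin> chart_ball k" using ballU[OF k] by blast
      then have "?u k (pt ?d x) = 0"
        using wedge_density_support[of k "\<rho> k" "pt ?d x" \<Lambda>] I(2) k \<rho> top[OF kA[OF l] x(1)] by auto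
      then show ?thesis by simp
    qed
    note s1 = integral_chart_support[OF overlap_subset z1] and s2 = integral_chart_support[OF overlap_subset z2]
    show ?thesis
      using change_of_chart[OF kA[OF k] kA[OF l], of "?F k l" "integral (dom ?c) (?i k l ?c)"] int1[OF k l] s1 s2 by simp
  qed
  have split: "integral (dom (fst k)) (\<lambda>x. ?u k (pt (fst k) x) * \<bar>orient (fst k) x\<bar>) = (\<Sum>l\<in>I. integral (dom (fst k)) (?i k l (fst k)))"
    if k: "k \<in> I" for k
  proof -
    have "integral (dom (fst k)) (\<lambda>x. ?u k (pt (fst k) x) * \<bar>orient (fst k) x\<bar>) = integral (dom (fst k)) (\<lambda>x. \<Sum>l\<in>I. ?i k l (fst k) x)"
    proof (rule Henstock_Kurzweil_Integration.integral_cong)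
      fix x assume x: "x \<in> dom (fst k)"
      have "(\<Sum>l\<in>I. ?i k l (fst k) x) = (\<Sum>l\<in>I. \<rho> l (pt (fst k) x)) * (?u k (pt (fst k) x) * \<bar>orient (fst k) x\<bar>)"
        by (simp add: sum_distrib_right mult.assoc)
      then show "?u k (pt (fst k) x) * \<bar>orient (fst k) x\<bar> = (\<Sum>l\<in>I. ?i k l (fst k) x)"
        using one[OF top[OF kA[OF k] x]] by simp
    qed
    also have "\<dots> = (\<Sum>l\<in>I. integral (dom (fst k)) (?i k l (fst k)))"
      by (rule integral_sum[OF I(1)]) (use int1[OF k] set_lebesgue_integral_eq_integral(1) in blast)
    finally show ?thesis .
  qed
  have col: "(\<Sum>k\<in>I. integral (dom (fst l)) (?i k l (fst l))) = 0" if l: "l \<in> I" for l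
  proof -
    let ?c = "fst l"
    have usum: "(\<Sum>k\<in>I. ?u k (pt ?c x)) = 0" if x: "x \<in> dom ?c" for x
    proof -
      have cd: "(\<Sum>k\<in>I. chart_deriv ?c (\<rho> k) i x) = 0" for i
      proof -
        have "((\<lambda>y. \<Sum>k\<in>I. (\<rho> k \<circ> pt ?c) y) has_derivative (\<lambda>v. \<Sum>k\<in>I. frechet_derivative (\<rho> k \<circ> pt ?c) (at x within dom ?c) v)) (at x within dom ?c)"
          by (rule has_derivative_sum) (rule C1_within_has_derivative[OF C1_surfaceD[OF \<rho>(1) kA[OF l]] x])
        then have "((\<lambda>y. 1) has_derivative (\<lambda>v. \<Sum>k\<in>I. frechet_derivative (\<rho> k \<circ> pt ?c) (at x within dom ?c) v)) (at x within dom ?c)"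
          by (rule has_derivative_transform[OF x, rotated]) (use one top[OF kA[OF l]] in simp)
        from half_plane_derivative_unique[OF chart_dom[OF kA[OF l]] x this has_derivative_const]
        show ?thesis by (simp add: chart_deriv_def partial_within_def fun_eq_iff)
      qed
      have "(\<Sum>k\<in>I. ?u k (pt ?c x)) = (\<Sum>k\<in>I. wedge (\<rho> k) \<Lambda> ?c x) / orient ?c x"
        using wedge_density_chart[OF kA[OF l] x \<rho>(1)] by (simp add: sum_divide_distrib)
      also have "(\<Sum>k\<in>I. wedge (\<rho> k) \<Lambda> ?c x) = (\<Sum>k\<in>I. chart_deriv ?c (\<rho> k) 1 x) * pull \<Lambda> ?c 2 x - (\<Sum>k\<in>I. chart_deriv ?c (\<rho> k) 2 x) * pull \<Lambda> ?c 1 x"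
        by (simp add: wedge_def sum_subtractf sum_distrib_right)
      finally show ?thesis using cd by simp
    qed
    have "(\<Sum>k\<in>I. integral (dom ?c) (?i k l ?c)) = integral (dom ?c) (\<lambda>x. \<Sum>k\<in>I. ?i k l ?c x)"
      by (rule integral_sum[symmetric, OF I(1)]) (use swap[OF _ l] set_lebesgue_integral_eq_integral(1) in blast)
    also have "\<dots> = integral (dom ?c) (\<lambda>x. 0)"
    proof (rule Henstock_Kurzweil_Integration.integral_cong)
      fix x assume x: "x \<in> dom ?c"
      have "(\<Sum>k\<in>I. ?i k l ?c x) = (\<rho> l (pt ?c x) * \<bar>orient ?c x\<bar>) * (\<Sum>k\<in>I. ?u k (pt ?c x))"
        by (simp add: sum_distrib_left mult_ac)
      then show "(\<Sum>k\<in>I. ?i k l ?c x) = 0" using usum[OF x] by simp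
    qed
    finally show ?thesis by simp
  qed
  have "(\<Sum>k\<in>I. integral (dom (fst k)) (\<lambda>x. ?u k (pt (fst k) x) * \<bar>orient (fst k) x\<bar>)) = (\<Sum>k\<in>I. \<Sum>l\<in>I. integral (dom (fst l)) (?i k l (fst l)))"
    using split swap by (simp cong: sum.cong)
  also have "\<dots> = (\<Sum>l\<in>I. \<Sum>k\<in>I. integral (dom (fst l)) (?i k l (fst l)))" by (rule sum.swap)
  also have "\<dots> = 0" using col by (simp cong: sum.cong)
  finally show ?thesis .
qed

end

section \<open>The boundary integral of a closed form\<close>

lemma connected_nonzero_sign:
  fixes f :: "'a::topological_space \<Rightarrow> real"
  assumes "connected C" "continuous_on C f" "\<And>x. x \<in> C \<Longrightarrow> f x \<noteq> 0"
  obtains e where "\<bar>e\<bar> = 1" "\<And>x. x \<in> C \<Longrightarrow> sgn (f x) = e"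
proof -
  have con: "connected (f ` C)" using connected_continuous_image[OF assms(2,1)] .
  have no: "\<not> (x \<in> C \<and> y \<in> C \<and> f x < 0 \<and> f y > 0)" for x y
  proof
    assume a: "x \<in> C \<and> y \<in> C \<and> f x < 0 \<and> f y > 0"
    then have "0 \<in> f ` C" using con[unfolded connected_iff_interval, rule_format, of "f x" "f y" 0] by auto
    then show False using assms(3) by auto
  qed
  show ?thesis
  proof (cases "\<exists>x\<in>C. f x < 0")
    case True
    then have "sgn (f x) = -1" if "x \<in> C" for x
      using no assms(3)[OF that] that by (metis linorder_neqE_linordered_idom sgn_neg)
    then show ?thesis using that[of "-1"] by simp
  next
    case False
    then have "sgn (f x) = 1" if "x \<in> C" for x
      using assms(3)[OF that] that by (metis linorder_neqE_linordered_idom sgn_pos)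
    then show ?thesis using that[of 1] by simp
  qed
qed

context oriented_surface
begin

lemma pull_C1: assumes \<Lambda>: "C1_surface A \<Lambda>" and c: "c \<in> A" shows "C1_within (dom c) (pull \<Lambda> c i)"
proof -
  have "C1_within (dom c) (\<lambda>x. (\<Lambda> \<circ> pt c) x \<bullet> partial_within (dom c) (\<phi> \<circ> pt c) i x)"
    by (intro C1_within_inner chart_dom c C1_surfaceD[OF \<Lambda>] smooth_on_C1_within smooth_on_partial_within immersion_smooth)
  then show ?thesis unfolding pull_def[abs_def] chart_deriv_def by (simp add: o_def)
qed

text \<open>On the half-disc the sign of \<open>orient\<close> is constant, so Stokes' theorem in the chart applies to the
  signed form.\<close>

lemma chart_boundary_flux:
  assumes k: "k \<in> chart_balls" and \<rho>: "C1_surface A \<rho>" "\<And>p. \<rho> p \<noteq> 0 \<Longrightarrow> p \<in> chart_ball k"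
    and \<Lambda>: "C1_surface A \<Lambda>"
    and closed: "\<And>c x. c \<in> A \<Longrightarrow> x \<in> dom c \<Longrightarrow> x $ 2 > 0 \<Longrightarrow>
       partial_within (dom c) (pull \<Lambda> c 2) 1 x = partial_within (dom c) (pull \<Lambda> c 1) 2 x"
  defines "c \<equiv> fst k"
  defines "f \<equiv> \<lambda>s. sgn (orient c (vector [s, 0])) * (\<rho> (pt c (vector [s, 0])) * pull \<Lambda> c 1 (vector [s, 0]))"
  shows "f absolutely_integrable_on {s. vector [s, 0] \<in> dom c}"
    and "integral {s. vector [s, 0] \<in> dom c} f = integral (dom c) (\<lambda>x. wedge_density \<rho> \<Lambda> (pt c x) * \<bar>orient c x\<bar>)"
proof -
  let ?x = "fst (snd k)" and ?r = "snd (snd k)"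
  let ?B = "half_plane \<inter> cball ?x ?r"
  have c: "c \<in> A" and sub: "?B \<subseteq> dom c" using k by (auto simp: chart_balls_def c_def)
  have ball: "pt c x \<in> chart_ball k \<longleftrightarrow> x \<in> cball ?x ?r" if "x \<in> dom c" for x
    using chart_ball_iff[OF k] that unfolding c_def by blast
  have "connected ?B" by (intro convex_connected convex_Int convex_half_plane convex_cball)
  then obtain e where e: "\<bar>e\<bar> = 1" "\<And>x. x \<in> ?B \<Longrightarrow> sgn (orient c x) = e"
    using connected_nonzero_sign[OF _ continuous_on_subset[OF orient_continuous[OF c] sub]] orient_nonzero[OF c] sub by blast
  have \<rho>C: "C1_within (dom c) (\<rho> \<circ> pt c)" by (rule C1_surfaceD[OF \<rho>(1) c])
  have z: "(\<rho> \<circ> pt c) x = 0" if "x \<in> dom c" "x \<notin> cball ?x ?r" for x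
    using \<rho>(2) ball[OF that(1)] that(2) by auto
  have fe: "f s = e * ((\<rho> \<circ> pt c) (vector [s, 0]) * pull \<Lambda> c 1 (vector [s, 0]))" if "vector [s, 0] \<in> dom c" for s
  proof (cases "vector [s, 0] \<in> cball ?x ?r")
    case True
    then have "vector [s, 0] \<in> ?B" using dom_half_plane[OF c] that by blast
    then show ?thesis using e(2) by (simp add: f_def)
  next
    case False then show ?thesis using z[OF that] by (simp add: f_def)
  qed
  have we: "wedge_density \<rho> \<Lambda> (pt c x) * \<bar>orient c x\<bar> = e * wedge \<rho> \<Lambda> c x" if x: "x \<in> dom c" for x
  proof (cases "x \<in> cball ?x ?r")
    case True
    then have "sgn (orient c x) = e" using e(2) dom_half_plane[OF c] x by blast
    then have "\<bar>orient c x\<bar> = e * orient c x" using abs_sgn[of "orient c x"] by (simp add: mult.commute)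
    then show ?thesis using wedge_density_chart[OF c x \<rho>(1), of \<Lambda>] orient_nonzero[OF c x] by simp
  next
    case False
    have "wedge_density \<rho> \<Lambda> (pt c x) = 0"
      by (rule wedge_density_support[OF k \<rho>]) (use ball[OF x] False pt_in[OF x] chart_subset[OF c] in auto)
    then show ?thesis using wedge_density_chart[OF c x \<rho>(1), of \<Lambda>] orient_nonzero[OF c x] by simp
  qed
  have "integral {s. vector [s, 0] \<in> dom c} f = integral {s. vector [s, 0] \<in> dom c} (\<lambda>s. e * ((\<rho> \<circ> pt c) (vector [s, 0]) * pull \<Lambda> c 1 (vector [s, 0])))"
    by (rule Henstock_Kurzweil_Integration.integral_cong) (simp only: fe mem_Collect_eq)
  also have "\<dots> = e * integral {s. vector [s, 0] \<in> dom c} (\<lambda>s. (\<rho> \<circ> pt c) (vector [s, 0]) * pull \<Lambda> c 1 (vector [s, 0]))"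
    by (rule Henstock_Kurzweil_Integration.integral_mult_right)
  also have "integral {s. vector [s, 0] \<in> dom c} (\<lambda>s. (\<rho> \<circ> pt c) (vector [s, 0]) * pull \<Lambda> c 1 (vector [s, 0]))
     = integral (dom c) (\<lambda>x. partial_within (dom c) (\<rho> \<circ> pt c) 1 x * pull \<Lambda> c 2 x - partial_within (dom c) (\<rho> \<circ> pt c) 2 x * pull \<Lambda> c 1 x)"
    by (rule chart_stokes[OF chart_dom[OF c] sub \<rho>C pull_C1[OF \<Lambda> c] pull_C1[OF \<Lambda> c] z closed[OF c], symmetric])
  also have "\<dots> = integral (dom c) (wedge \<rho> \<Lambda> c)"
    by (simp add: wedge_def[abs_def] chart_deriv_def)
  also have "e * \<dots> = integral (dom c) (\<lambda>x. e * wedge \<rho> \<Lambda> c x)"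
    by (rule Henstock_Kurzweil_Integration.integral_mult_right[symmetric])
  also have "\<dots> = integral (dom c) (\<lambda>x. wedge_density \<rho> \<Lambda> (pt c x) * \<bar>orient c x\<bar>)"
    by (rule Henstock_Kurzweil_Integration.integral_cong) (simp add: we)
  finally show "integral {s. vector [s, 0] \<in> dom c} f = integral (dom c) (\<lambda>x. wedge_density \<rho> \<Lambda> (pt c x) * \<bar>orient c x\<bar>)" .
  show "f absolutely_integrable_on {s. vector [s, 0] \<in> dom c}"
  proof (rule absolutely_integrable_compact_support)
    have "continuous_on {s. vector [s, 0] \<in> dom c} (\<lambda>s. e * ((\<rho> \<circ> pt c) (vector [s, 0]) * pull \<Lambda> c 1 (vector [s, 0])))"
      by (intro continuous_on_mult_left continuous_on_mult continuous_on_compose2[OF C1_within_continuous[OF \<rho>C]]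
          continuous_on_compose2[OF C1_within_continuous[OF pull_C1[OF \<Lambda> c]]] continuous_intros) auto
    then show "continuous_on {s. vector [s, 0] \<in> dom c} f"
      by (rule continuous_on_eq) (simp only: fe mem_Collect_eq)
    have eq: "{s. vector [s, 0] \<in> ?B} = (\<lambda>x. x $ 1) ` (?B \<inter> {x. x $ 2 = 0})"
    proof (intro equalityI subsetI)
      fix s assume "s \<in> {s. vector [s, 0] \<in> ?B}"
      then show "s \<in> (\<lambda>x. x $ 1) ` (?B \<inter> {x. x $ 2 = 0})" by (intro image_eqI[of _ _ "vector [s, 0]"]) auto
    next
      fix s assume "s \<in> (\<lambda>x. x $ 1) ` (?B \<inter> {x. x $ 2 = 0})"
      then obtain x where x: "x \<in> ?B" "x $ 2 = 0" "s = x $ 1" by blast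
      then have "vector [s, 0] = x" by (simp add: vec_eq_iff forall_2)
      then show "s \<in> {s. vector [s, 0] \<in> ?B}" using x by simp
    qed
    have "closed {x :: real^2. x $ 2 = 0}" by (intro closed_Collect_eq continuous_intros)
    then show "compact {s. vector [s, 0] \<in> ?B}"
      unfolding eq by (intro compact_continuous_image compact_Int_closed compact_half_plane_ball continuous_intros)
    show "{s. vector [s, 0] \<in> ?B} \<subseteq> {s. vector [s, 0] \<in> dom c}" using sub by blast
    fix s assume s: "s \<in> {s. vector [s, 0] \<in> dom c}" "s \<notin> {s. vector [s, 0] \<in> ?B}"
    then have "vector [s, 0] \<notin> cball ?x ?r" using dom_half_plane[OF c] by blast
    then show "f s = 0" using z[of "vector [s, 0]"] s(1) by (simp add: f_def)
  qed
qed

text \<open>Invariance of the boundary under changes of chart. If a boundary point were mapped to an interior point of another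
  chart, the second component of the transition map would have an interior minimum there, and its Jacobian would
  vanish.\<close>

lemma boundary_in_chart:
  assumes p: "p \<in> surface_boundary A" and c: "c \<in> A" "p \<in> fst c"
  shows "snd c p $ 2 = 0"
proof (rule ccontr)
  assume ne: "snd c p $ 2 \<noteq> 0"
  obtain d where d: "d \<in> A" "p \<in> fst d" "snd d p $ 2 = 0"
    using p unfolding surface_boundary_def by (auto simp: case_prod_unfold)
  let ?x = "snd c p"
  have x: "?x \<in> dom c" using c by blast
  have xo: "?x \<in> overlap c d" using overlap_iff[OF c(1)] x pt_chart[OF c] d by simp
  have x2: "?x $ 2 > 0" using dom_half_plane[OF c(1)] x ne by (auto simp: half_plane_def)
  let ?T = "transition c d" and ?W = "overlap c d"
  have W: "half_plane_open ?W" by (rule overlap_open[OF c(1) d(1)])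
  have "(?T has_derivative frechet_derivative ?T (at ?x within ?W)) (at ?x)"
    using C1_within_has_derivative[OF transition_C1[OF c(1) d(1)] xo] half_plane_at_within_interior[OF W xo x2] by simp
  from has_derivative_component[OF this, of 2]
  have der: "((\<lambda>y. ?T y $ 2) has_derivative (\<lambda>v. frechet_derivative ?T (at ?x within ?W) v $ 2)) (at ?x)" .
  have T0: "?T ?x $ 2 = 0" using d pt_chart[OF c] by (simp add: transition_def)
  have "\<forall>\<^sub>F y in nhds ?x. y \<in> interior ?W"
    using half_plane_interior_nhd[OF W xo x2] eventually_nhds_in_open open_interior by blast
  then have "\<forall>\<^sub>F y in at ?x. ?T ?x $ 2 \<le> ?T y $ 2"
    unfolding eventually_at_filter
  proof eventually_elim
    case (elim y)
    then have "y \<in> ?W" using interior_subset by blast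
    then have "?T y \<in> half_plane" using transition_in[OF c(1) d(1)] dom_half_plane[OF d(1)] by blast
    then show ?case using T0 by (simp add: half_plane_def)
  qed
  from has_derivative_local_min[OF der this]
  have "partial_within ?W ?T i ?x $ 2 = 0" for i
    unfolding partial_within_def by (rule fun_cong)
  then have "jacobian c d ?x = 0" by (simp add: jacobian_expand)
  then show False using orient_transition[OF c(1) d(1) xo] orient_nonzero[OF c(1) x] by simp
qed

text \<open>At a boundary point the second component of a change of chart has its minimal value \<open>0\<close>, so it cannot
  decrease in the inward direction.\<close>

lemma transition_inward:
  assumes c: "c \<in> A" "d \<in> A" and x: "x \<in> overlap c d" and T0: "transition c d x $ 2 = 0"
  shows "partial_within (overlap c d) (transition c d) 2 x $ 2 \<ge> 0"
proof (rule ccontr)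
  let ?T = "transition c d" and ?W = "overlap c d"
  let ?l = "\<lambda>t::real. x + t *\<^sub>R axis 2 1"
  let ?S = "{t. ?l t \<in> ?W}"
  assume "\<not> partial_within ?W ?T 2 x $ 2 \<ge> 0"
  then have neg: "partial_within ?W ?T 2 x $ 2 < 0" by simp
  have l: "(?l has_vector_derivative axis 2 1) (at 0 within ?S)"
    unfolding has_vector_derivative_def by (auto intro!: derivative_eq_intros)
  have sub: "?l ` ?S \<subseteq> ?W" by auto
  have "(?T has_derivative frechet_derivative ?T (at x within ?W)) (at (?l 0) within ?l ` ?S)"
    using has_derivative_subset[OF C1_within_has_derivative[OF transition_C1[OF c] x] sub] by simp
  from vector_derivative_diff_chain_within[OF l this]
  have "((\<lambda>t. ?T (?l t)) has_vector_derivative partial_within ?W ?T 2 x) (at 0 within ?S)"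
    by (simp add: o_def partial_within_def)
  from bounded_linear.has_vector_derivative[OF bounded_linear_vec_nth this, of 2]
  have "((\<lambda>t. ?T (?l t) $ 2) has_real_derivative partial_within ?W ?T 2 x $ 2) (at 0 within ?S)"
    by (simp add: has_real_derivative_iff_has_vector_derivative)
  from has_real_derivative_neg_dec_right[OF this neg]
  obtain e where e: "e > 0" "\<And>h. h > 0 \<Longrightarrow> h \<in> ?S \<Longrightarrow> h < e \<Longrightarrow> ?T (?l h) $ 2 < ?T (?l 0) $ 2" by auto
  obtain r where r: "r > 0" "ball x r \<inter> half_plane \<subseteq> ?W"
    using overlap_open[OF c] x by (auto simp: openin_contains_ball)
  define h where "h = min e r / 2"
  have h: "h > 0" "h < e" "h < r" using e r by (auto simp: h_def)
  have "x \<in> half_plane" using overlap_open[OF c] x openin_imp_subset by blast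
  then have "?l h \<in> half_plane" using h by (simp add: half_plane_def axis_def)
  moreover have "?l h \<in> ball x r" using h by (simp add: dist_norm)
  ultimately have "?l h \<in> ball x r \<inter> half_plane" by blast
  then have W: "?l h \<in> ?W" using r by blast
  then have "?T (?l h) $ 2 < 0" using e(2)[of h] h T0 by simp
  moreover have "?T (?l h) \<in> half_plane" using transition_in[OF c W] dom_half_plane[OF c(2)] by blast
  ultimately show False by (simp add: half_plane_def)
qed

end

section \<open>The boundary curve\<close>

locale spanning_surface = oriented_surface M A \<phi> N
  for M :: "'m topology" and A :: "'m atlas" and \<phi> N :: "'m \<Rightarrow> real^3" +
  fixes \<gamma> :: "real \<Rightarrow> real^3" and \<Gamma> :: "(real^3) set"
  assumes curve: "parametrises_closed_curve \<gamma> \<Gamma>" and spanning: "spans M A \<phi> \<Gamma>"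
begin

abbreviation vel :: "real \<Rightarrow> real^3" where "vel t \<equiv> vector_derivative \<gamma> (at t)"

text \<open>The parametrisation of the boundary of the surface that corresponds to \<open>\<gamma>\<close> under the immersion.\<close>

definition lift :: "real \<Rightarrow> 'm" where "lift = inv_into (surface_boundary A) \<phi> \<circ> \<gamma>"

lemma curve_in: "\<gamma> t \<in> \<Gamma>" and curve_period: "\<gamma> (t + 1) = \<gamma> t"
  using curve by (auto simp: parametrises_closed_curve_def)

lemma vel: "(\<gamma> has_vector_derivative vel t) (at t)" and vel_continuous: "continuous_on UNIV vel"
  using parametrises_closed_curve_derivative[OF curve] by auto

lemma vel_nonzero: "vel t \<noteq> 0" using curve by (simp add: parametrises_closed_curve_def)

lemma boundary_bij: "bij_betw \<phi> (surface_boundary A) \<Gamma>" using spanning by (simp add: spans_def)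

lemma lift_boundary: "lift t \<in> surface_boundary A" and \<phi>_lift: "\<phi> (lift t) = \<gamma> t"
  using boundary_bij curve_in[of t] unfolding lift_def bij_betw_def by (auto simp: inv_into_into f_inv_into_f)

lemma lift_top: "lift t \<in> topspace M"
  using lift_boundary[of t] chart_subset unfolding surface_boundary_def by (auto simp: case_prod_unfold)

lemma lift_surj:
  assumes p: "p \<in> surface_boundary A" shows "\<exists>t\<in>{0..<1}. lift t = p"
proof -
  have "\<phi> p \<in> \<Gamma>" using boundary_bij p by (auto simp: bij_betw_def)
  then obtain s where "\<phi> p = \<gamma> s" using curve by (auto simp: parametrises_closed_curve_def)
  then have "\<phi> p = \<gamma> (frac s)" using closed_curve_frac[of \<gamma> s, OF curve_period] by simp
  then have "lift (frac s) = p" unfolding lift_def o_def using boundary_bij p by (metis bij_betw_def inv_into_f_f)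
  then show ?thesis using frac_ge_0[of s] frac_lt_1[of s] by (intro bexI[of _ "frac s"]) auto
qed

lemma lift_inj: "inj_on lift {0..<1}"
proof (rule inj_onI)
  fix s t assume st: "s \<in> {0..<1}" "t \<in> {0..<1}" "lift s = lift t"
  then have "\<gamma> s = \<gamma> t" by (metis \<phi>_lift)
  then show "s = t" using curve st by (auto simp: parametrises_closed_curve_def inj_on_def)
qed

lemma lift_continuous: "continuous_map euclidean M lift"
proof -
  have cg: "continuous_on UNIV \<gamma>"
    using vel by (meson continuous_at_imp_continuous_on has_vector_derivative_continuous)
  then have "continuous_map euclidean (top_of_set \<Gamma>) \<gamma>"
    using curve_in by (simp add: continuous_map_in_subtopology image_subset_iff)
  moreover have "continuous_map (top_of_set \<Gamma>) M (inv_into (surface_boundary A) \<phi>)"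
    using spanning by (simp add: spans_def smooth_into_surface_def)
  ultimately show ?thesis unfolding lift_def by (rule continuous_map_compose)
qed

definition times :: "'m chart \<Rightarrow> real set" where "times c = {t. lift t \<in> fst c}"

lemma times_open: assumes c: "c \<in> A" shows "open (times c)"
proof -
  have "openin euclidean {t \<in> topspace euclidean. lift t \<in> fst c}"
    by (rule openin_continuous_map_preimage[OF lift_continuous chart_open[OF c]])
  then show ?thesis by (simp add: times_def)
qed

text \<open>In a chart the lifted curve runs on the boundary line, so its first coordinate determines it.\<close>

definition coord :: "'m chart \<Rightarrow> real \<Rightarrow> real" where "coord c t = snd c (lift t) $ 1"

lemma chart_lift:
  assumes c: "c \<in> A" and t: "t \<in> times c"
  shows "snd c (lift t) = vector [coord c t, 0]" "vector [coord c t, 0] \<in> dom c" "pt c (vector [coord c t, 0]) = lift t"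
proof -
  have "snd c (lift t) $ 2 = 0" using boundary_in_chart[OF lift_boundary c] t by (simp add: times_def)
  then show 1: "snd c (lift t) = vector [coord c t, 0]" by (simp add: vec_eq_iff forall_2 coord_def)
  show "vector [coord c t, 0] \<in> dom c" unfolding 1[symmetric] using t by (simp add: times_def)
  show "pt c (vector [coord c t, 0]) = lift t" unfolding 1[symmetric] using pt_chart[OF c] t by (simp add: times_def)
qed

text \<open>The lift is differentiable in a chart because the inverse of the immersion along the boundary is smooth; its
  velocity cannot vanish since that of \<open>\<gamma>\<close> does not.\<close>

lemma coord_derivative:
  assumes c: "c \<in> A" and t: "t \<in> times c"
  shows "\<exists>s. (coord c has_real_derivative s) (at t) \<and> vel t = s *\<^sub>R chart_deriv c \<phi> 1 (vector [coord c t, 0]) \<and> s \<noteq> 0"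
proof -
  let ?h = "inv_into (surface_boundary A) \<phi>"
  let ?Q = "{q \<in> \<Gamma>. ?h q \<in> fst c}"
  let ?X = "\<lambda>t. snd c (lift t)"
  have at: "at t within times c = at t" using at_within_open[OF t times_open[OF c]] .
  have "smooth_on ?Q (snd c \<circ> ?h)"
    using spanning c by (auto simp: spans_def smooth_into_surface_def case_prod_unfold)
  moreover have "\<gamma> t \<in> ?Q" using t curve_in by (simp add: times_def lift_def)
  ultimately have "(snd c \<circ> ?h) differentiable (at (\<gamma> t) within ?Q)" by (rule smooth_on_differentiable)
  then obtain D where D: "((snd c \<circ> ?h) has_derivative D) (at (\<gamma> t) within ?Q)" by (auto simp: differentiable_def)
  have "\<gamma> ` times c \<subseteq> ?Q" using curve_in by (auto simp: times_def lift_def)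
  from has_derivative_subset[OF D this]
  have "((snd c \<circ> ?h) has_derivative D) (at (\<gamma> t) within \<gamma> ` times c)" .
  moreover have "(\<gamma> has_vector_derivative vel t) (at t within times c)" using vel has_vector_derivative_at_within by blast
  ultimately have "(((snd c \<circ> ?h) \<circ> \<gamma>) has_vector_derivative D (vel t)) (at t within times c)"
    by (intro vector_derivative_diff_chain_within)
  then have X: "(?X has_vector_derivative D (vel t)) (at t within times c)" by (simp add: o_def lift_def)
  have comp: "((\<lambda>t. ?X t $ i) has_real_derivative D (vel t) $ i) (at t within times c)" for i
    using bounded_linear.has_vector_derivative[OF bounded_linear_vec_nth X]
    by (simp add: has_real_derivative_iff_has_vector_derivative)
  have "((\<lambda>t. 0) has_real_derivative D (vel t) $ 2) (at t)"
    by (rule has_field_derivative_transform_within_open[OF comp[of 2, unfolded at] times_open[OF c] t])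
       (simp add: chart_lift(1)[OF c])
  then have D2: "D (vel t) $ 2 = 0" by (rule DERIV_unique) (rule DERIV_const)
  have xd: "?X t \<in> dom c" using t by (simp add: times_def)
  have "?X ` times c \<subseteq> dom c" by (auto simp: times_def)
  then have "((\<phi> \<circ> pt c) has_derivative frechet_derivative (\<phi> \<circ> pt c) (at (?X t) within dom c)) (at (?X t) within ?X ` times c)"
    by (rule has_derivative_subset[OF C1_within_has_derivative[OF C1_surfaceD[OF immersion_C1 c] xd]])
  from vector_derivative_diff_chain_within[OF X this]
  have "(((\<phi> \<circ> pt c) \<circ> ?X) has_vector_derivative frechet_derivative (\<phi> \<circ> pt c) (at (?X t) within dom c) (D (vel t))) (at t within times c)" .
  then have "(\<gamma> has_vector_derivative frechet_derivative (\<phi> \<circ> pt c) (at (?X t) within dom c) (D (vel t))) (at t within times c)"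
    by (rule has_vector_derivative_transform[OF t, rotated]) (simp add: times_def pt_chart[OF c] \<phi>_lift)
  then have "vel t = frechet_derivative (\<phi> \<circ> pt c) (at (?X t) within dom c) (D (vel t))"
    unfolding at by (rule vector_derivative_at)
  also have "\<dots> = D (vel t) $ 1 *\<^sub>R chart_deriv c \<phi> 1 (?X t)"
    unfolding frechet_derivative_expand2[OF C1_within_differentiable[OF C1_surfaceD[OF immersion_C1 c] xd]] D2
    by (simp add: chart_deriv_def)
  finally have v: "vel t = D (vel t) $ 1 *\<^sub>R chart_deriv c \<phi> 1 (?X t)" .
  have "D (vel t) $ 1 \<noteq> 0"
  proof
    assume "D (vel t) $ 1 = 0"
    then have "vel t = 0" using v by (metis scaleR_zero_left)
    then show False using vel_nonzero by blast
  qed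
  moreover have "(coord c has_real_derivative D (vel t) $ 1) (at t)"
    using comp[of 1] unfolding at coord_def[abs_def] .
  ultimately show ?thesis using v unfolding chart_lift(1)[OF c t] by blast
qed

text \<open>Its sign compares the direction of the lifted curve with the boundary orientation: the velocity and the inward
  vector of a chart form an oriented frame or its opposite.\<close>

definition side :: "'m chart \<Rightarrow> real \<Rightarrow> real" where
  "side c t = N (lift t) \<bullet> cross3 (vel t) (chart_deriv c \<phi> 2 (vector [coord c t, 0]))"

lemma side_coord:
  assumes c: "c \<in> A" and t: "t \<in> times c" and v: "vel t = s *\<^sub>R chart_deriv c \<phi> 1 (vector [coord c t, 0])"
  shows "side c t = s * orient c (vector [coord c t, 0])"
  unfolding side_def orient_def v chart_lift(3)[OF c t] by (simp add: Cross3.cross_mult_left)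

lemma side_nonzero: assumes c: "c \<in> A" and t: "t \<in> times c" shows "side c t \<noteq> 0"
  using coord_derivative[OF c t] side_coord[OF c t] orient_nonzero[OF c chart_lift(2)[OF c t]] by auto

lemma side_independent:
  assumes c: "c \<in> A" "d \<in> A" and t: "t \<in> times c" "t \<in> times d"
  shows "sgn (side c t) = sgn (side d t)"
proof -
  let ?x = "vector [coord c t, 0] :: real^2"
  have xo: "?x \<in> overlap c d" using overlap_iff[OF c(1)] chart_lift[OF c(1) t(1)] t(2) by (simp add: times_def)
  have Tx: "transition c d ?x = vector [coord d t, 0]"
    using chart_lift[OF c(1) t(1)] chart_lift[OF c(2) t(2)] by (simp add: transition_def)
  obtain s where s: "vel t = s *\<^sub>R chart_deriv d \<phi> 1 (vector [coord d t, 0])" using coord_derivative[OF c(2) t(2)] by blast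
  let ?m = "partial_within (overlap c d) (transition c d) 2 ?x"
  have "chart_deriv c \<phi> 2 ?x = (?m $ 1) *\<^sub>R chart_deriv d \<phi> 1 (vector [coord d t, 0]) + (?m $ 2) *\<^sub>R chart_deriv d \<phi> 2 (vector [coord d t, 0])"
    using transition_rule[OF c C1_surfaceD[OF immersion_C1 c(2)] xo, of 2] unfolding Tx .
  then have eq: "side c t = ?m $ 2 * side d t"
    unfolding side_def s by (simp add: Cross3.cross_add_right Cross3.cross_mult_left Cross3.cross_mult_right)
  have "?m $ 2 \<ge> 0" by (rule transition_inward[OF c xo]) (simp add: Tx)
  moreover have "?m $ 2 \<noteq> 0" using eq side_nonzero[OF c(1) t(1)] by auto
  ultimately show ?thesis unfolding eq by (simp add: sgn_mult)
qed

lemma coord_continuous: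
  assumes c: "c \<in> A" shows "continuous_on (times c) (\<lambda>t. vector [coord c t, 0] :: real^2)"
proof -
  have "isCont (coord c) t" if "t \<in> times c" for t
    using coord_derivative[OF c that] DERIV_isCont by blast
  then have "continuous_on (times c) (coord c)" by (simp add: continuous_at_imp_continuous_on)
  then show ?thesis by (intro continuous_intros)
qed

lemma continuous_along_lift:
  assumes h: "C1_surface A h"
  shows "continuous_on UNIV (\<lambda>t. h (lift t))"
proof (rule continuous_at_imp_continuous_on, rule ballI)
  fix t
  obtain c where c: "c \<in> A" "t \<in> times c" using charts_cover[OF lift_top[of t]] by (auto simp: times_def)
  have "continuous_on (times c) (\<lambda>t. h (pt c (vector [coord c t, 0])))"
    using continuous_on_compose2[OF C1_surface_continuous[OF h c(1)] coord_continuous[OF c(1)]] chart_lift(2)[OF c(1)] by blast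
  then have "continuous_on (times c) (\<lambda>t. h (lift t))"
    by (rule continuous_on_eq) (simp add: chart_lift(3)[OF c(1)])
  then show "isCont (\<lambda>t. h (lift t)) t"
    using times_open[OF c(1)] c(2) by (simp add: continuous_on_eq_continuous_at)
qed

lemma side_continuous: assumes c: "c \<in> A" shows "continuous_on (times c) (side c)"
proof -
  have d: "continuous_on (times c) (\<lambda>t. chart_deriv c \<phi> 2 (vector [coord c t, 0]))"
    using continuous_on_compose2[OF chart_deriv_continuous[OF immersion_C1 c] coord_continuous[OF c]] chart_lift(2)[OF c] by blast
  show ?thesis unfolding side_def[abs_def]
    by (intro continuous_on_inner continuous_on_cross d continuous_on_subset[OF vel_continuous]
        continuous_on_subset[OF continuous_along_lift[OF normal_C1]]) auto
qed

text \<open>In one chart the sign is locally constant in \<open>t\<close>, and different charts agree by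
  \<open>side_independent\<close>. So it is a continuous function without zeros on the real line.\<close>

lemma side_sign_constant:
  obtains e where "\<bar>e\<bar> = 1" "\<And>c t. c \<in> A \<Longrightarrow> t \<in> times c \<Longrightarrow> sgn (side c t) = e"
proof -
  define \<sigma> where "\<sigma> t = sgn (side (SOME c. c \<in> A \<and> t \<in> times c) t)" for t
  have ex: "\<exists>c. c \<in> A \<and> t \<in> times c" for t using charts_cover[OF lift_top[of t]] by (auto simp: times_def)
  have \<sigma>: "\<sigma> t = sgn (side c t)" if c: "c \<in> A" "t \<in> times c" for c t
  proof -
    define d where "d = (SOME c. c \<in> A \<and> t \<in> times c)"
    have "d \<in> A \<and> t \<in> times d" unfolding d_def using someI_ex[OF ex[of t]] .
    then show ?thesis unfolding \<sigma>_def d_def[symmetric] using side_independent[of d c t] c by blast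
  qed
  have nz: "\<sigma> t \<noteq> 0" for t using ex[of t] \<sigma> side_nonzero by (metis sgn_zero_iff)
  have cs: "continuous_on UNIV \<sigma>"
  proof (rule continuous_at_imp_continuous_on, rule ballI)
    fix t
    obtain c where c: "c \<in> A" "t \<in> times c" using ex by blast
    have "continuous_on (times c) (\<lambda>t. sgn (side c t))"
      by (rule continuous_on_sgn[OF side_continuous[OF c(1)]]) (use side_nonzero[OF c(1)] in blast)
    then have "continuous_on (times c) \<sigma>"
      by (rule continuous_on_eq) (use \<sigma> c in simp)
    then show "isCont \<sigma> t" using times_open[OF c(1)] c(2) by (simp add: continuous_on_eq_continuous_at)
  qed
  show ?thesis
  proof (rule connected_nonzero_sign[OF connected_UNIV cs nz])
    fix e assume e: "\<bar>e\<bar> = 1" "\<And>t. t \<in> UNIV \<Longrightarrow> sgn (\<sigma> t) = e"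
    show ?thesis
    proof (rule that[OF e(1)])
      fix c t assume "c \<in> A" "t \<in> times c"
      then show "sgn (side c t) = e" using \<sigma>[of c t] e(2)[of t] by simp
    qed
  qed
qed

text \<open>Stokes' theorem on the surface for a closed one-form. Each summand \<open>\<rho>\<^sub>k \<theta>\<close> is
  integrated in its chart along the boundary line, and the substitution \<open>coord\<close> turns this into an
  integral over the curve parameter. The signs that arise are those of \<open>side\<close>, hence all equal, and
  the weights \<open>\<rho>\<^sub>k\<close> add up to \<open>1\<close>.\<close>

lemma closed_form_boundary_integral:
  assumes \<Lambda>: "C1_surface A \<Lambda>"
    and closed: "\<And>c x. c \<in> A \<Longrightarrow> x \<in> dom c \<Longrightarrow> x $ 2 > 0 \<Longrightarrow>
       partial_within (dom c) (pull \<Lambda> c 2) 1 x = partial_within (dom c) (pull \<Lambda> c 1) 2 x"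
  shows "integral {0..1} (\<lambda>t. \<Lambda> (lift t) \<bullet> vel t) = 0"
proof -
  obtain I \<rho> where I: "finite I" "I \<subseteq> chart_balls" and \<rho>: "\<And>k. k \<in> I \<Longrightarrow> C1_surface A (\<rho> k)"
    "\<And>k p. k \<in> I \<Longrightarrow> \<rho> k p \<noteq> 0 \<Longrightarrow> p \<in> chart_ball k"
    and one: "\<And>p. p \<in> topspace M \<Longrightarrow> (\<Sum>k\<in>I. \<rho> k p) = (1::real)"
    by (rule partition_of_unity) blast
  obtain e where e: "\<bar>e\<bar> = 1" "\<And>c t. c \<in> A \<Longrightarrow> t \<in> times c \<Longrightarrow> sgn (side c t) = e"
    using side_sign_constant by blast
  let ?J = "\<lambda>k. integral (dom (fst k)) (\<lambda>x. wedge_density (\<rho> k) \<Lambda> (pt (fst k) x) * \<bar>orient (fst k) x\<bar>)"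
  let ?g = "\<lambda>k t. e * (\<rho> k (lift t) * (\<Lambda> (lift t) \<bullet> vel t))"
  have piece: "?g k absolutely_integrable_on {0..<1} \<and> integral {0..<1} (?g k) = ?J k" if k: "k \<in> I" for k
  proof -
    define c where "c = fst k"
    have kb: "k \<in> chart_balls" using I k by blast
    then have c: "c \<in> A" by (simp add: c_def chart_balls_def)
    let ?f = "\<lambda>s. sgn (orient c (vector [s, 0])) * (\<rho> k (pt c (vector [s, 0])) * pull \<Lambda> c 1 (vector [s, 0]))"
    let ?S = "{0..<1} \<inter> times c"
    have F: "?f absolutely_integrable_on {s. vector [s, 0] \<in> dom c}" "integral {s. vector [s, 0] \<in> dom c} ?f = ?J k"
      using chart_boundary_flux[OF kb \<rho>(1)[OF k] \<rho>(2)[OF k] \<Lambda> closed] unfolding c_def by blast+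
    have "\<forall>t\<in>times c. \<exists>s. (coord c has_real_derivative s) (at t) \<and> vel t = s *\<^sub>R chart_deriv c \<phi> 1 (vector [coord c t, 0]) \<and> s \<noteq> 0"
      using coord_derivative[OF c] by blast
    then obtain D where D: "\<And>t. t \<in> times c \<Longrightarrow> (coord c has_real_derivative D t) (at t)"
      "\<And>t. t \<in> times c \<Longrightarrow> vel t = D t *\<^sub>R chart_deriv c \<phi> 1 (vector [coord c t, 0])" by metis
    have meas: "?S \<in> sets lebesgue" using times_open[OF c] by (simp add: sets.Int)
    have der: "(coord c has_field_derivative D t) (at t within ?S)" if "t \<in> ?S" for t
      using D(1)[of t] that has_field_derivative_at_within by blast
    have inj: "inj_on (coord c) ?S"
    proof (rule inj_onI)
      fix s t assume st: "s \<in> ?S" "t \<in> ?S" "coord c s = coord c t"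
      then have "lift s = lift t" using chart_lift(3)[OF c, of s] chart_lift(3)[OF c, of t] by simp
      then show "s = t" using lift_inj st by (auto simp: inj_on_def)
    qed
    have img: "coord c ` ?S = {s. vector [s, 0] \<in> dom c}"
    proof (intro equalityI subsetI)
      fix s assume "s \<in> coord c ` ?S" then show "s \<in> {s. vector [s, 0] \<in> dom c}" using chart_lift(2)[OF c] by blast
    next
      fix s assume "s \<in> {s. vector [s, 0] \<in> dom c}"
      then have s: "vector [s, 0] \<in> dom c" by simp
      let ?p = "pt c (vector [s, 0])"
      have p: "?p \<in> fst c" "snd c ?p = vector [s, 0]" using pt_in[OF s] chart_pt[OF s] by auto
      then have "?p \<in> surface_boundary A" using c unfolding surface_boundary_def by (auto simp: case_prod_unfold intro!: bexI[of _ c])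
      then obtain t where t: "t \<in> {0..<1}" "lift t = ?p" using lift_surj by blast
      then have "t \<in> ?S" "coord c t = s" using p by (auto simp: times_def coord_def)
      then show "s \<in> coord c ` ?S" by blast
    qed
    have cv: "(\<lambda>t. \<bar>D t\<bar> * ?f (coord c t)) absolutely_integrable_on ?S \<and> integral ?S (\<lambda>t. \<bar>D t\<bar> * ?f (coord c t)) = ?J k"
      using has_absolute_integral_change_of_variables_1'[OF meas der inj, of ?f "?J k"] F unfolding img by blast
    have eq: "\<bar>D t\<bar> * ?f (coord c t) = ?g k t" if t: "t \<in> ?S" for t
    proof -
      have tc: "t \<in> times c" using t by simp
      have a: "sgn (D t) * sgn (orient c (vector [coord c t, 0])) = e"
        using e(2)[OF c tc] side_coord[OF c tc D(2)[OF tc]] by (simp add: sgn_mult)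
      have b: "\<Lambda> (lift t) \<bullet> vel t = D t * pull \<Lambda> c 1 (vector [coord c t, 0])"
        unfolding D(2)[OF tc] pull_def chart_lift(3)[OF c tc] by simp
      have d: "\<bar>D t\<bar> = sgn (D t) * D t" by (simp add: abs_sgn mult.commute)
      show ?thesis unfolding chart_lift(3)[OF c tc] b d a[symmetric] by (simp only: mult_ac)
    qed
    have z: "?g k t = 0" if "t \<in> {0..<1}" "t \<notin> ?S" for t
    proof -
      have "lift t \<notin> fst c" using that by (simp add: times_def)
      moreover have "chart_ball k \<subseteq> fst c" using kb pt_in unfolding chart_ball_def chart_balls_def c_def by blast
      ultimately have "\<rho> k (lift t) = 0" using \<rho>(2)[OF k] by blast
      then show ?thesis by simp
    qed
    have "?g k absolutely_integrable_on ?S"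
      using cv set_integrable_cong[of lebesgue lebesgue ?S ?S "\<lambda>t. \<bar>D t\<bar> * ?f (coord c t)" "?g k"] eq by simp
    moreover have "integral ?S (?g k) = ?J k"
      using cv Henstock_Kurzweil_Integration.integral_cong[of ?S "\<lambda>t. \<bar>D t\<bar> * ?f (coord c t)" "?g k", OF eq] by simp
    ultimately show ?thesis
      using integral_chart_support[of ?S "{0..<1}" "?g k", OF _ z] by simp
  qed
  have "0 = (\<Sum>k\<in>I. ?J k)" using sum_of_wedges_zero[OF I \<rho> one \<Lambda>] by simp
  also have "\<dots> = (\<Sum>k\<in>I. integral {0..<1} (?g k))" using piece by simp
  also have "\<dots> = integral {0..<1} (\<lambda>t. \<Sum>k\<in>I. ?g k t)"
    by (rule integral_sum[symmetric, OF I(1)]) (use piece set_lebesgue_integral_eq_integral(1) in blast)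
  also have "(\<lambda>t. \<Sum>k\<in>I. ?g k t) = (\<lambda>t. e * (\<Lambda> (lift t) \<bullet> vel t))"
    using one[OF lift_top] by (simp add: sum_distrib_left[symmetric] sum_distrib_right[symmetric])
  also have "integral {0..<1} (\<lambda>t. e * (\<Lambda> (lift t) \<bullet> vel t)) = e * integral {0..<1} (\<lambda>t. \<Lambda> (lift t) \<bullet> vel t)"
    by (rule Henstock_Kurzweil_Integration.integral_mult_right)
  finally have "integral {0..<1} (\<lambda>t. \<Lambda> (lift t) \<bullet> vel t) = 0" using e(1) by auto
  moreover have "integral {0..<1} (\<lambda>t. \<Lambda> (lift t) \<bullet> vel t) = integral {0..1} (\<lambda>t. \<Lambda> (lift t) \<bullet> vel t)"
    by (rule integral_spike_set; rule negligible_subset[of "{1}"]) auto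
  ultimately show ?thesis by simp
qed

end

section \<open>The flux of a Killing field\<close>

lemma continuous_on_vector3 [continuous_intros]:
  fixes f g h :: "'a::topological_space \<Rightarrow> real"
  assumes "continuous_on S f" "continuous_on S g" "continuous_on S h"
  shows "continuous_on S (\<lambda>x. vector [f x, g x, h x] :: real^3)"
proof -
  have eq: "vector [r, s, t] = r *\<^sub>R axis 1 1 + s *\<^sub>R axis 2 1 + t *\<^sub>R (axis 3 1 :: real^3)" for r s t :: real
    by (simp add: vec_eq_iff forall_3 axis_def)
  show ?thesis unfolding eq using assms by (intro continuous_intros)
qed

lemma flux_form_C1:
  assumes S: "half_plane_open S" and f: "C1_within S f" and n: "C1_within S n"
  shows "C1_within S (\<lambda>x. flux_form q H (f x) (n x))"
  by (rule C1_withinI[OF S flux_form_has_derivative[OF C1_within_has_derivative[OF f] C1_within_has_derivative[OF n]]])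
     (auto simp: killing_deriv_def killing_def flux_potential_deriv_def intro!: continuous_intros continuous_on_cross
        C1_within_continuous[OF f] C1_within_continuous[OF n] C1_within_derivative_continuous[OF f] C1_within_derivative_continuous[OF n])

lemma norm_cross3_le: "norm (cross3 u v) \<le> norm u * norm v"
proof (rule power2_le_imp_le)
  show "(norm (cross3 u v))\<^sup>2 \<le> (norm u * norm v)\<^sup>2"
    using norm_cross_dot[of u v] zero_le_power2[of "u \<bullet> v"] by linarith
qed simp

lemma sol_norm_plane: assumes "p $ 3 = 0" shows "sol_norm p v = norm v"
  using assms by (simp add: sol_norm_def sol_inner_expand norm_eq_sqrt_inner inner_vec_def sum_3)

lemma norm_killing: "norm (killing q p) = sqrt (1 + (p $ 1 - q $ 1)\<^sup>2 + (p $ 2 - q $ 2)\<^sup>2)"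
  by (simp add: killing_def norm_eq_sqrt_inner inner_vec_def sum_3 power2_eq_square algebra_simps)

context spanning_surface
begin

lemma curve_continuous: "continuous_on UNIV \<gamma>"
  using vel by (meson continuous_at_imp_continuous_on has_vector_derivative_continuous)

lemma normal_unit_norm: "sol_norm (\<phi> (lift t)) (N (lift t)) = 1"
proof -
  obtain c where c: "c \<in> A" "t \<in> times c" using charts_cover[OF lift_top[of t]] by (auto simp: times_def)
  from normal_chart(1)[OF c(1) chart_lift(2)[OF c]] show ?thesis unfolding chart_lift(3)[OF c] .
qed

lemma plane_curve:
  assumes "\<Gamma> \<subseteq> plane_R" shows "\<gamma> t $ 3 = 0" "vel t $ 3 = 0"
proof -
  show z: "\<gamma> t $ 3 = 0" for t using assms curve_in plane_R_iff by blast
  have "((\<lambda>t. \<gamma> t $ 3) has_vector_derivative vel t $ 3) (at t)"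
    by (rule bounded_linear.has_vector_derivative[OF bounded_linear_vec_nth vel])
  then have "((\<lambda>t. 0) has_vector_derivative vel t $ 3) (at t)" by (simp add: z)
  then show "vel t $ 3 = 0" using vector_derivative_unique_at has_vector_derivative_const by blast
qed

text \<open>The value on the velocity of \<open>\<gamma>\<close> of the restriction of \<open>flux_potential q\<close> to the
  plane \<open>R\<close>.\<close>

definition area_form :: "real^2 \<Rightarrow> real \<Rightarrow> real" where
  "area_form q t = ((\<gamma> t $ 1 - q $ 1) * vel t $ 2 - (\<gamma> t $ 2 - q $ 2) * vel t $ 1) / 2"

lemma flux_balance:
  assumes plane: "\<Gamma> \<subseteq> plane_R" and cmc: "constant_mean_curvature A \<phi> N H"
  shows "integral {0..1} (\<lambda>t. cross3 (N (lift t)) (killing q (\<gamma> t)) \<bullet> vel t) = 2 * H * integral {0..1} (area_form q)"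
proof -
  let ?L = "\<lambda>p. flux_form q H (\<phi> p) (N p)"
  have L: "C1_surface A ?L"
  proof (rule C1_surfaceI)
    fix c assume c: "c \<in> A"
    show "C1_within (dom c) (?L \<circ> pt c)"
      using flux_form_C1[OF chart_dom[OF c] C1_surfaceD[OF immersion_C1 c] C1_surfaceD[OF normal_C1 c]] by (simp add: o_def)
  qed
  have "integral {0..1} (\<lambda>t. ?L (lift t) \<bullet> vel t) = 0"
  proof (rule closed_form_boundary_integral[OF L])
    fix c x assume c: "c \<in> A" and x: "x \<in> dom c" "x $ 2 > 0"
    have p: "pull ?L c i = (\<lambda>y. flux_form q H ((\<phi> \<circ> pt c) y) ((N \<circ> pt c) y) \<bullet> partial_within (dom c) (\<phi> \<circ> pt c) i y)" for i
      by (simp add: pull_def[abs_def] chart_deriv_def)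
    have mc: "mean_curvature (dom c) (\<phi> \<circ> pt c) (N \<circ> pt c) x = H"
      using cmc c x(1) unfolding constant_mean_curvature_def by (auto simp: case_prod_unfold)
    show "partial_within (dom c) (pull ?L c 2) 1 x = partial_within (dom c) (pull ?L c 1) 2 x"
      unfolding p
      by (rule flux_form_closed[OF chart_dom[OF c] immersion_smooth[OF c] normal_smooth[OF c] x _ _ immersion_inj[OF c x(1)] mc])
         (use normal_chart[OF c] in \<open>simp_all\<close>)
  qed
  also have "(\<lambda>t. ?L (lift t) \<bullet> vel t) = (\<lambda>t. cross3 (N (lift t)) (killing q (\<gamma> t)) \<bullet> vel t - 2 * H * area_form q t)"
  proof
    fix t
    have "flux_potential q (\<gamma> t) \<bullet> vel t = area_form q t"
      using plane_curve(2)[OF plane, of t]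
      by (simp add: flux_potential_def area_form_def inner_vec_def sum_3 field_simps)
    then show "?L (lift t) \<bullet> vel t = cross3 (N (lift t)) (killing q (\<gamma> t)) \<bullet> vel t - 2 * H * area_form q t"
      by (simp add: flux_form_def \<phi>_lift inner_diff_left)
  qed
  also have "integral {0..1} \<dots> = integral {0..1} (\<lambda>t. cross3 (N (lift t)) (killing q (\<gamma> t)) \<bullet> vel t) - integral {0..1} (\<lambda>t. 2 * H * area_form q t)"
    by (intro Henstock_Kurzweil_Integration.integral_diff integrable_continuous_real)
       (auto simp: killing_def area_form_def intro!: continuous_intros continuous_on_cross
         continuous_on_subset[OF vel_continuous] continuous_on_subset[OF curve_continuous]
         continuous_on_subset[OF continuous_along_lift[OF normal_C1]])
  also have "integral {0..1} (\<lambda>t. 2 * H * area_form q t) = 2 * H * integral {0..1} (area_form q)"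
    by (rule Henstock_Kurzweil_Integration.integral_mult_right)
  finally show ?thesis by simp
qed

text \<open>Along \<open>R\<close> the metric is Euclidean and the normal has length \<open>1\<close>, so
  \<open>|det (\<gamma>', N, X)| \<le> |X| |\<gamma>'|\<close>.\<close>

lemma flux_inequality:
  assumes plane: "\<Gamma> \<subseteq> plane_R" and cmc: "constant_mean_curvature A \<phi> N H"
  shows "2 * \<bar>H\<bar> * \<bar>integral {0..1} (area_form q)\<bar>
     \<le> integral {0..1} (\<lambda>t. sqrt (1 + (\<gamma> t $ 1 - q $ 1)\<^sup>2 + (\<gamma> t $ 2 - q $ 2)\<^sup>2) * norm (vel t))"
proof -
  have "2 * \<bar>H\<bar> * \<bar>integral {0..1} (area_form q)\<bar> = norm (integral {0..1} (\<lambda>t. cross3 (N (lift t)) (killing q (\<gamma> t)) \<bullet> vel t))"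
    unfolding flux_balance[OF assms] by (simp add: abs_mult)
  also have "\<dots> \<le> integral {0..1} (\<lambda>t. sqrt (1 + (\<gamma> t $ 1 - q $ 1)\<^sup>2 + (\<gamma> t $ 2 - q $ 2)\<^sup>2) * norm (vel t))"
  proof (rule integral_norm_bound_integral)
    show "(\<lambda>t. cross3 (N (lift t)) (killing q (\<gamma> t)) \<bullet> vel t) integrable_on {0..1}"
      by (intro integrable_continuous_real)
        (auto simp: killing_def intro!: continuous_intros continuous_on_cross
         continuous_on_subset[OF vel_continuous] continuous_on_subset[OF curve_continuous]
         continuous_on_subset[OF continuous_along_lift[OF normal_C1]])
    show "(\<lambda>t. sqrt (1 + (\<gamma> t $ 1 - q $ 1)\<^sup>2 + (\<gamma> t $ 2 - q $ 2)\<^sup>2) * norm (vel t)) integrable_on {0..1}"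
      by (intro integrable_continuous_real continuous_intros continuous_on_subset[OF vel_continuous] continuous_on_subset[OF curve_continuous]) auto
    fix t :: real
    have n: "norm (N (lift t)) = 1"
      using normal_unit_norm[of t] sol_norm_plane plane_curve(1)[OF plane] by (simp add: \<phi>_lift)
    have "norm (cross3 (N (lift t)) (killing q (\<gamma> t)) \<bullet> vel t) \<le> norm (cross3 (N (lift t)) (killing q (\<gamma> t))) * norm (vel t)"
      unfolding real_norm_def by (rule Cauchy_Schwarz_ineq2)
    also have "\<dots> \<le> (norm (N (lift t)) * norm (killing q (\<gamma> t))) * norm (vel t)"
      by (intro mult_right_mono norm_cross3_le) simp
    finally show "norm (cross3 (N (lift t)) (killing q (\<gamma> t)) \<bullet> vel t)
       \<le> sqrt (1 + (\<gamma> t $ 1 - q $ 1)\<^sup>2 + (\<gamma> t $ 2 - q $ 2)\<^sup>2) * norm (vel t)"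
      by (simp add: n norm_killing)
  qed
  finally show ?thesis .
qed

text \<open>With \<open>q\<close> at the centre of the circle, the velocity is orthogonal to the radius. So the area form is
  \<open>\<plusminus> r / 2\<close> times the speed, with a sign that is constant because it never vanishes, and
  the length cancels from the flux inequality.\<close>

lemma circle_bound:
  assumes cmc: "constant_mean_curvature A \<phi> N H" and c: "c > 0" and circ: "\<Gamma> = circle_in_R q c"
  shows "\<bar>H\<bar> \<le> sqrt (c\<^sup>2 + 1)"
proof -
  define r where "r = 1 / c"
  have r: "r > 0" using c by (simp add: r_def)
  have plane: "\<Gamma> \<subseteq> plane_R" unfolding circ circle_in_R_def plane_R_def by blast
  define X Y where "X t = \<gamma> t $ 1 - q $ 1" and "Y t = \<gamma> t $ 2 - q $ 2" for t
  define X' Y' where "X' t = vel t $ 1" and "Y' t = vel t $ 2" for t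
  have rad: "(X t)\<^sup>2 + (Y t)\<^sup>2 = r\<^sup>2" for t
  proof -
    obtain u where u: "u \<in> sphere q r" "\<gamma> t = plane_point u"
      using curve_in[of t] unfolding circ circle_in_R_def r_def by blast
    have "(u - q) \<bullet> (u - q) = r\<^sup>2"
      using u(1) unfolding power2_norm_eq_inner[symmetric] by (simp add: dist_norm norm_minus_commute)
    then show ?thesis unfolding X_def Y_def u(2)
      by (simp add: inner_vec_def sum_2 power2_eq_square)
  qed
  have dX: "(X has_real_derivative X' t) (at t)" and dY: "(Y has_real_derivative Y' t) (at t)" for t
  proof -
    have comp: "((\<lambda>t. \<gamma> t $ i) has_real_derivative vel t $ i) (at t)" for i
      using bounded_linear.has_vector_derivative[OF bounded_linear_vec_nth vel]
      by (simp add: has_real_derivative_iff_has_vector_derivative)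
    show "(X has_real_derivative X' t) (at t)" unfolding X_def[abs_def] X'_def
      using DERIV_diff[OF comp[of 1] DERIV_const[of "q $ 1"]] by simp
    show "(Y has_real_derivative Y' t) (at t)" unfolding Y_def[abs_def] Y'_def
      using DERIV_diff[OF comp[of 2] DERIV_const[of "q $ 2"]] by simp
  qed
  have orth: "X t * X' t + Y t * Y' t = 0" for t
  proof -
    have "((\<lambda>t. (X t)\<^sup>2 + (Y t)\<^sup>2) has_real_derivative (2 * X t * X' t + 2 * Y t * Y' t)) (at t)"
      by (rule DERIV_cong[OF DERIV_add[OF DERIV_power[OF dX] DERIV_power[OF dY]]]) (simp add: algebra_simps)
    \<comment> \<open>On the circle the squared radius is constant, so the velocity is orthogonal to the radius.\<close>
  then have "((\<lambda>t. r\<^sup>2) has_real_derivative (2 * X t * X' t + 2 * Y t * Y' t)) (at t)" unfolding rad .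
    from DERIV_unique[OF this DERIV_const] show ?thesis by simp
  qed
  have nv: "(norm (vel t))\<^sup>2 = (X' t)\<^sup>2 + (Y' t)\<^sup>2" for t
    unfolding power2_norm_eq_inner using plane_curve(2)[OF plane]
    by (simp add: inner_vec_def sum_3 X'_def Y'_def power2_eq_square)
  have a: "area_form q t = (X t * Y' t - Y t * X' t) / 2" for t
    by (simp add: area_form_def X_def Y_def X'_def Y'_def)
  have abs: "\<bar>area_form q t\<bar> = r / 2 * norm (vel t)" for t
  proof -
    \<comment> \<open>Lagrange's identity in the plane.\<close>
    have "(X t * Y' t - Y t * X' t)\<^sup>2 = ((X t)\<^sup>2 + (Y t)\<^sup>2) * ((X' t)\<^sup>2 + (Y' t)\<^sup>2) - (X t * X' t + Y t * Y' t)\<^sup>2"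
      by (simp add: power2_eq_square algebra_simps)
    also have "\<dots> = (r * norm (vel t))\<^sup>2" unfolding rad orth nv[symmetric] by (simp add: power_mult_distrib)
    finally have "X t * Y' t - Y t * X' t = r * norm (vel t) \<or> X t * Y' t - Y t * X' t = - (r * norm (vel t))"
      by (simp only: power2_eq_iff)
    then have "\<bar>X t * Y' t - Y t * X' t\<bar> = \<bar>r * norm (vel t)\<bar>" by auto
    then show ?thesis using r by (simp add: a abs_mult)
  qed
  have cont: "continuous_on S (area_form q)" for S
    unfolding area_form_def[abs_def]
    by (intro continuous_intros continuous_on_subset[OF vel_continuous] continuous_on_subset[OF curve_continuous]) auto
  have nz: "area_form q t \<noteq> 0" for t
  proof
    assume "area_form q t = 0"
    then have "r / 2 * norm (vel t) = 0" using abs[of t] by simp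
    then show False using r vel_nonzero by simp
  qed
  obtain e where e: "\<bar>e\<bar> = 1" "\<forall>t. sgn (area_form q t) = e"
    by (rule connected_nonzero_sign[OF connected_UNIV cont nz]) auto
  have "area_form q t = e * (r / 2 * norm (vel t))" for t
  proof -
    have "sgn (area_form q t) * \<bar>area_form q t\<bar> = area_form q t" by (rule sgn_mult_abs)
    then show ?thesis unfolding abs using e(2) by simp
  qed
  then have "area_form q = (\<lambda>t. (e * (r / 2)) * norm (vel t))" by (simp only: fun_eq_iff mult.assoc simp_thms)
  then have "integral {0..1} (area_form q) = integral {0..1} (\<lambda>t. (e * (r / 2)) * norm (vel t))" by simp
  also have "\<dots> = (e * (r / 2)) * integral {0..1} (\<lambda>t. norm (vel t))"
    by (rule Henstock_Kurzweil_Integration.integral_mult_right)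
  finally have area: "integral {0..1} (area_form q) = (e * (r / 2)) * integral {0..1} (\<lambda>t. norm (vel t))" .
  define L where "L = integral {0..1} (\<lambda>t. norm (vel t))"
  have "integral {0..1} (\<lambda>t::real. 0) < L" unfolding L_def
    by (rule integral_less_real)
       (auto intro!: continuous_intros continuous_on_subset[OF vel_continuous] simp: vel_nonzero)
  then have L: "L > 0" by simp
  have "2 * \<bar>H\<bar> * \<bar>integral {0..1} (area_form q)\<bar>
     \<le> integral {0..1} (\<lambda>t. sqrt (1 + (\<gamma> t $ 1 - q $ 1)\<^sup>2 + (\<gamma> t $ 2 - q $ 2)\<^sup>2) * norm (vel t))"
    by (rule flux_inequality[OF plane cmc])
  also have "(\<lambda>t. sqrt (1 + (\<gamma> t $ 1 - q $ 1)\<^sup>2 + (\<gamma> t $ 2 - q $ 2)\<^sup>2) * norm (vel t)) = (\<lambda>t. sqrt (1 + r\<^sup>2) * norm (vel t))"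
    using rad by (simp add: X_def Y_def add.assoc)
  also have "integral {0..1} \<dots> = sqrt (1 + r\<^sup>2) * L"
    unfolding L_def by (rule Henstock_Kurzweil_Integration.integral_mult_right)
  also have "2 * \<bar>H\<bar> * \<bar>integral {0..1} (area_form q)\<bar> = (\<bar>H\<bar> * r) * L"
    unfolding area L_def[symmetric] using e(1) r L by (simp add: abs_mult)
  finally have "\<bar>H\<bar> * r \<le> sqrt (1 + r\<^sup>2)" using L by simp
  then have "\<bar>H\<bar> \<le> sqrt (1 + r\<^sup>2) / r" using r by (simp add: pos_le_divide_eq)
  also have "sqrt (1 + r\<^sup>2) / r = sqrt ((1 + r\<^sup>2) / r\<^sup>2)" using r by (simp add: real_sqrt_divide)
  also have "(1 + r\<^sup>2) / r\<^sup>2 = c\<^sup>2 + 1" using c by (simp add: r_def field_simps)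
  finally show ?thesis .
qed

end

theorem theorem2p4:
  fixes M :: "'m topology" and A :: "'m atlas"
    and \<phi> N :: "'m \<Rightarrow> real^3"
    and \<gamma> :: "real \<Rightarrow> real^3" and \<Gamma> D :: "(real^3) set"
    and H :: real
  assumes "parametrises_closed_curve \<gamma> \<Gamma>"
    and "\<Gamma> \<subseteq> plane_R"
    and "bounded_domain_of \<Gamma> D"
    and "compact_surface_with_boundary M A"
    and "spans M A \<phi> \<Gamma>"
    and "unit_normal_field A \<phi> N"
    and "constant_mean_curvature A \<phi> N H"
  shows "\<bar>H\<bar> \<le> boundary_integral A \<phi> \<gamma> (\<lambda>p. sqrt (1 + (\<phi> p $ 1)\<^sup>2 + (\<phi> p $ 2)\<^sup>2))
                / (2 * plane_area D)
         \<and> (\<forall>q c. c > 0 \<and> \<Gamma> = circle_in_R q c \<longrightarrow> \<bar>H\<bar> \<le> sqrt (c\<^sup>2 + 1))"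
proof -
  have "immersion A \<phi>" using assms(5) by (simp add: spans_def)
  then interpret spanning_surface M A \<phi> N \<gamma> \<Gamma>
    using assms by unfold_locales auto
  note area = bounded_domain_area[OF assms(1-3)]
  have "plane_area D \<le> \<bar>integral {0..1} (area_form 0)\<bar>"
    using area(2) closed_curve_area_form[OF assms(1), of 0] unfolding area_form_def[abs_def] by simp
  then have "2 * \<bar>H\<bar> * plane_area D \<le> 2 * \<bar>H\<bar> * \<bar>integral {0..1} (area_form 0)\<bar>"
    by (intro mult_left_mono) auto
  also have "\<dots> \<le> integral {0..1} (\<lambda>t. sqrt (1 + (\<gamma> t $ 1 - (0 :: real^2) $ 1)\<^sup>2 + (\<gamma> t $ 2 - (0 :: real^2) $ 2)\<^sup>2) * norm (vel t))"
    by (rule flux_inequality[OF assms(2,7)])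
  also have "\<dots> = boundary_integral A \<phi> \<gamma> (\<lambda>p. sqrt (1 + (\<phi> p $ 1)\<^sup>2 + (\<phi> p $ 2)\<^sup>2))"
  proof -
    have "\<phi> \<circ> lift = \<gamma>" by (simp add: fun_eq_iff \<phi>_lift)
    then show ?thesis
      unfolding boundary_integral_def Let_def lift_def[symmetric]
      by (simp add: \<phi>_lift sol_norm_plane plane_curve(1)[OF assms(2)])
  qed
  finally have "\<bar>H\<bar> \<le> boundary_integral A \<phi> \<gamma> (\<lambda>p. sqrt (1 + (\<phi> p $ 1)\<^sup>2 + (\<phi> p $ 2)\<^sup>2)) / (2 * plane_area D)"
    using area(1) by (simp add: pos_le_divide_eq mult_ac)
  then show ?thesis using circle_bound[OF assms(7)] by blast
qed

end
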